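(* Let $\Gamma\subset\mathbb R^2$ be a connected Lipschitz triangulable curve containing the origin, and let $\hat P_\Gamma:\pi_1(\Gamma)\to G_c[[r]]$ be the homomorphism determined by $P=\hat P_\Gamma\circ\Psi_\Gamma$ on $\mathcal A_0(\Gamma)$. Then $\Gamma$ is universal if and only if $\hat P_\Gamma$ is a monomorphism (i.e. injective).
   Context: Fix $T>0$. A compact set $\Gamma\subset\mathbb R^2$ is a Lipschitz triangulable curve if there exist a finite subset $S\subset\Gamma$ and Lipschitz and locally bi-Lipschitz arcs $h_1,\dots,h_k:(0,1)\to\mathbb R^2$ such that $\Gamma\setminus S$ is the disjoint union of the sets $h_i((0,1))$, $1\le i\le k$. Let $\mathcal A$ be the set of pairs $a=(a_1,a_2)$ of real bounded Lebesgue measurable functions on $[0,T]$. To $a\in\mathcal A$ associate the Abel equation $\frac{dv}{dt}=a_1v^2+a_2v^3$ on $[0,T]$ (solutions are absolutely continuous functions satisfying the equation almost everywhere), and the Lipschitz path $\tilde A:[0,T]\to\mathbb R^2$, $\tilde A(t)=\bigl(\int_0^t a_1(s)\,ds,\int_0^t a_2(s)\,ds\bigr)$, with image $\Gamma_{\tilde A}$. The equation has a center on $[0,T]$ if for all sufficiently small initial values $v_0$ the solution with $v(0)=v_0$ satisfies $v(T)=v_0$. The center is universal if all iterated integrals $I_{i_1,\dots,i_k}(a)=\int\cdots\int_{0\le s_1\le\cdots\le s_k\le T}a_{i_k}(s_k)\cdots a_{i_1}(s_1)\,ds_k\cdots ds_1$ ($k\ge1$, $i_1,\dots,i_k\in\{1,2\}$)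 vanish. A connected Lipschitz triangulable curve $\Gamma\subset\mathbb R^2$ containing the origin is universal if, whenever an Abel equation $\frac{dv}{dt}=a_1v^2+a_2v^3$ on $[0,T]$ with $a=(a_1,a_2)\in\mathcal A$ and $\Gamma_{\tilde A}\subset\Gamma$ has a center on $[0,T]$, this center is universal. The first return map $P(a)$ of the equation associated with $a\in\mathcal A$ sends a sufficiently small initial value $r$ to the value at $T$ of the solution with $v(0)=r$; it is given by a power series $P(a)(r)=r+\sum_{i\ge1}c_ir^{i+1}$ convergent near $0$. $G_c[[r]]$ denotes the group, under composition, of all real power series of the form $r+\sum_{i\ge1}c_ir^{i+1}$ convergent in a neighbourhood of $0$. $\mathcal A_0(\Gamma)$ is the set of $a\in\mathcal A$ with $\tilde A(T)=0$ and $\Gamma_{\tilde A}\subset\Gamma$. $\pi_1(\Gamma)$ is the fundamental group of $\Gamma$ with base point $0$; the product convention is that $g\cdot h$ is represented by the path that first traverses a representative of $h$ and then a representative of $g$. The map $\Psi_\Gamma:\mathcal A_0(\Gamma)\to\pi_1(\Gamma)$, $a\mapsto[\tilde A]$, is surjective. It is known that $P$ is constant on $\Psi_\Gamma^{-1}(g)$ for each $g\in\pi_1(\Gamma)$, so there is a well-defined group homomorphism $\hat P_\Gamma:\pi_1(\Gamma)\to G_c[[r]]$ with $P=\hat P_\Gamma\circ\Psi_\Gamma$ on $\mathcal A_0(\Gamma)$. *)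

theory Defs
  imports "HOL-Analysis.Analysis" "HOL-Algebra.Group"
begin

section \<open>Lipschitz triangulable curves\<close>

definition locally_bilipschitz_on :: "'a::metric_space set \<Rightarrow> ('a \<Rightarrow> 'b::metric_space) \<Rightarrow> bool"
  where "locally_bilipschitz_on U f \<longleftrightarrow>
    (\<forall>x\<in>U. \<exists>e>0. \<exists>c>0. \<exists>C. \<forall>s\<in>ball x e \<inter> U. \<forall>t\<in>ball x e \<inter> U.
       c * dist s t \<le> dist (f s) (f t) \<and> dist (f s) (f t) \<le> C * dist s t)"

text \<open>The word \<^emph>\<open>arc\<close> is read as usual: the parametrisation is injective.\<close>

definition lipschitz_arc :: "(real \<Rightarrow> real \<times> real) \<Rightarrow> bool"
  where "lipschitz_arc h \<longleftrightarrow>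
    inj_on h {0<..<1} \<and> (\<exists>C. C-lipschitz_on {0<..<1} h) \<and> locally_bilipschitz_on {0<..<1} h"

definition lipschitz_triangulable_curve :: "(real \<times> real) set \<Rightarrow> bool"
  where "lipschitz_triangulable_curve \<Gamma> \<longleftrightarrow>
    compact \<Gamma> \<and>
    (\<exists>S k. \<exists>h :: nat \<Rightarrow> real \<Rightarrow> real \<times> real.
       finite S \<and> S \<subseteq> \<Gamma> \<and>
       (\<forall>i\<in>{1..k}. lipschitz_arc (h i)) \<and>
       disjoint_family_on (\<lambda>i. h i ` {0<..<1}) {1..k} \<and>
       \<Gamma> - S = (\<Union>i\<in>{1..k}. h i ` {0<..<1}))"

section \<open>Abel equations\<close>

text \<open>Functions on \<open>[0,T]\<close> are represented by total functions; their values outside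
  \<open>[0,T]\<close> are never used.\<close>

type_synonym coeff_pair = "(real \<Rightarrow> real) \<times> (real \<Rightarrow> real)"

definition abel_coeffs :: "real \<Rightarrow> coeff_pair set"
  where "abel_coeffs T = {a.
    fst a \<in> borel_measurable (lebesgue_on {0..T}) \<and> bounded (fst a ` {0..T}) \<and>
    snd a \<in> borel_measurable (lebesgue_on {0..T}) \<and> bounded (snd a ` {0..T})}"

definition primitive_path :: "coeff_pair \<Rightarrow> real \<Rightarrow> real \<times> real"
  where "primitive_path a t = (integral {0..t} (fst a), integral {0..t} (snd a))"

definition abs_continuous_on :: "real \<Rightarrow> real \<Rightarrow> (real \<Rightarrow> real) \<Rightarrow> bool"
  where "abs_continuous_on \<alpha> \<beta> f \<longleftrightarrow>
    (\<forall>e>0. \<exists>d>0. \<forall>n::nat. \<forall>u w :: nat \<Rightarrow> real.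
       (\<forall>i<n. \<alpha> \<le> u i \<and> u i \<le> w i \<and> w i \<le> \<beta>) \<and>
       disjoint_family_on (\<lambda>i. {u i<..<w i}) {..<n} \<and>
       (\<Sum>i<n. w i - u i) < d
       \<longrightarrow> (\<Sum>i<n. \<bar>f (w i) - f (u i)\<bar>) < e)"

definition abel_solution :: "real \<Rightarrow> coeff_pair \<Rightarrow> (real \<Rightarrow> real) \<Rightarrow> bool"
  where "abel_solution T a v \<longleftrightarrow>
    abs_continuous_on 0 T v \<and>
    (AE t in lebesgue_on {0..T}.
       (v has_real_derivative fst a t * v t ^ 2 + snd a t * v t ^ 3) (at t within {0..T}))"

definition has_center :: "real \<Rightarrow> coeff_pair \<Rightarrow> bool"
  where "has_center T a \<longleftrightarrow>
    (\<forall>\<^sub>F r in nhds 0. \<exists>v. abel_solution T a v \<and> v 0 = r \<and> v T = r)"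

definition component :: "coeff_pair \<Rightarrow> nat \<Rightarrow> real \<Rightarrow> real"
  where "component a i = (if i = 1 then fst a else snd a)"

text \<open>\<open>iterated_tail T a [i\<^sub>1,\<dots>,i\<^sub>k] s\<close> is the integral of
  \<open>a\<^bsub>i\<^sub>k\<^esub>(s\<^sub>k) \<cdots> a\<^bsub>i\<^sub>1\<^esub>(s\<^sub>1) ds\<^sub>k \<cdots> ds\<^sub>1\<close> over
  \<open>s \<le> s\<^sub>1 \<le> \<dots> \<le> s\<^sub>k \<le> T\<close>, where \<open>s\<^sub>k\<close> is the innermost variable.\<close>

primrec iterated_tail :: "real \<Rightarrow> coeff_pair \<Rightarrow> nat list \<Rightarrow> real \<Rightarrow> real" where
  "iterated_tail T a [] s = 1"
| "iterated_tail T a (i # w) s = integral {s..T} (\<lambda>u. component a i u * iterated_tail T a w u)"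

definition iterated_integral :: "real \<Rightarrow> coeff_pair \<Rightarrow> nat list \<Rightarrow> real"
  where "iterated_integral T a w = iterated_tail T a w 0"

definition universal_center :: "real \<Rightarrow> coeff_pair \<Rightarrow> bool"
  where "universal_center T a \<longleftrightarrow> has_center T a \<and>
    (\<forall>w. w \<noteq> [] \<and> set w \<subseteq> {1, 2} \<longrightarrow> iterated_integral T a w = 0)"

definition universal_curve :: "real \<Rightarrow> (real \<times> real) set \<Rightarrow> bool"
  where "universal_curve T \<Gamma> \<longleftrightarrow>
    (\<forall>a\<in>abel_coeffs T. primitive_path a ` {0..T} \<subseteq> \<Gamma> \<and> has_center T a
       \<longrightarrow> universal_center T a)"

section \<open>The first return map\<close>

definition return_group :: "real fps monoid"
  where "return_group =
    \<lparr>carrier = {F. fps_nth F 0 = 0 \<and> fps_nth F 1 = 1 \<and> fps_conv_radius F > 0},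
     mult = fps_compose, one = fps_X\<rparr>"

definition first_return :: "real \<Rightarrow> coeff_pair \<Rightarrow> real fps"
  where "first_return T a = (THE F. F \<in> carrier return_group \<and>
    (\<forall>\<^sub>F r in nhds 0. \<exists>v. abel_solution T a v \<and> v 0 = r \<and> v T = eval_fps F r))"

section \<open>The fundamental group\<close>

definition loop_class :: "'a::topological_space set \<Rightarrow> (real \<Rightarrow> 'a) \<Rightarrow> (real \<Rightarrow> 'a) set"
  where "loop_class \<Gamma> p = {q. homotopic_paths \<Gamma> p q}"

text \<open>The product of the classes of \<open>g\<close> and \<open>h\<close> is the class of the loop that
  traverses \<open>h\<close> first and \<open>g\<close> second. This is the convention under which the first
  return map is multiplicative for composition of power series.\<close>

definition fundamental_group ::
    "'a::real_normed_vector set \<Rightarrow> 'a \<Rightarrow> (real \<Rightarrow> 'a) set monoid"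
  where "fundamental_group \<Gamma> x =
    \<lparr>carrier = loop_class \<Gamma> `
       {p. path p \<and> path_image p \<subseteq> \<Gamma> \<and> pathstart p = x \<and> pathfinish p = x},
     mult = (\<lambda>A B. \<Union>g\<in>A. \<Union>h\<in>B. loop_class \<Gamma> (h +++ g)),
     one = loop_class \<Gamma> (\<lambda>_. x)\<rparr>"

definition closed_coeffs :: "real \<Rightarrow> (real \<times> real) set \<Rightarrow> coeff_pair set"
  where "closed_coeffs T \<Gamma> =
    {a \<in> abel_coeffs T. primitive_path a T = 0 \<and> primitive_path a ` {0..T} \<subseteq> \<Gamma>}"

text \<open>Library paths are parametrised by \<open>[0,1]\<close>, hence the rescaling of \<open>[0,T]\<close>.\<close>

definition path_class :: "real \<Rightarrow> (real \<times> real) set \<Rightarrow> coeff_pair \<Rightarrow> (real \<Rightarrow> real \<times> real) set"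
  where "path_class T \<Gamma> a = loop_class \<Gamma> (\<lambda>s. primitive_path a (T * s))"

end

theory Submission
  imports Defs "HOL-Complex_Analysis.Cauchy_Integral_Formula"
begin

text \<open>Since \<open>a\<close> has a center iff its first return map is the identity, and every class of loops is
  represented by some \<open>a\<close>, both implications reduce to one fact: for a closed path in \<open>\<Gamma>\<close> all
  iterated integrals vanish iff the path is null-homotopic in \<open>\<Gamma>\<close>.

  For this \<open>\<Gamma>\<close> is subdivided into a simple graph. Consider triangular systems
  \<open>dz\<^bsub>j+1\<^esub> = z\<^bsub>j\<^esub> f\<^bsub>j\<^esub> dx\<^bsub>c\<^esub>\<close> with continuous \<open>f\<^bsub>j\<^esub>\<close> along Lipschitz paths in \<open>\<Gamma>\<close>. On the star of a
  vertex, which is contractible and one-dimensional, every form has a primitive, so the transport of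
  solutions along a path depends on its homotopy class only; constant \<open>f\<^bsub>j\<^esub>\<close> give the iterated
  integrals. Conversely, if the iterated integrals of \<open>a\<close> vanish, then by shuffle relations and
  Weierstrass approximation all such systems have trivial transport along the path of \<open>a\<close>. If that
  path were not null-homotopic, it would be homotopic to a non-trivial edge walk without
  backtracking, and taking for \<open>f\<^bsub>j\<^esub>\<close> a bump function on the edge number \<open>j\<close> of the walk makes
  the transport non-trivial.\<close>

text \<open>The obstacle is regularity. An edge is bi-Lipschitz only locally inside the open arc,
  and a Lipschitz path may meet a vertex on a Cantor set of times, so it cannot be cut into finitely
  many edge traversals. This is why differentials are compared through increments, why solutions are
  glued from functions living on stars, and why transport is defined along merely continuous paths,
  as the stages of a homotopy are. Constant coefficients see only the iterated integrals of the
  whole path and cannot single out an edge; bumps can. In a walk without backtracking consecutive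
  edges differ, so while edge \<open>j\<close> is traversed component \<open>j\<close> is frozen,
  component \<open>j + 1\<close> becomes nonzero and all later ones are still zero. The last
  component therefore ends nonzero even if edges recur in the walk. A center is given without any
  closedness of the path. The coefficients of \<open>r^2\<close> and \<open>r^3\<close> of the
  return map supply it, and only then does the homomorphism on classes of loops apply.\<close>

section \<open>Stieltjes differentials\<close>

text \<open>The relation \<open>dF = g dx\<close> for Lipschitz \<open>x\<close>, stated through increments so that no
  differentiability and no null sets are involved.\<close>

definition stieltjes_diff :: "real set \<Rightarrow> (real \<Rightarrow> real) \<Rightarrow> (real \<Rightarrow> real) \<Rightarrow> (real \<Rightarrow> real) \<Rightarrow> bool"
  where "stieltjes_diff I F g x \<longleftrightarrow>
    (\<forall>e>0. \<exists>d>0. \<forall>s\<in>I. \<forall>t\<in>I. \<bar>t - s\<bar> < d \<longrightarrow>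
       \<bar>F t - F s - g s * (x t - x s)\<bar> \<le> e * \<bar>t - s\<bar>)"

lemma stieltjes_diffI:
  assumes "\<And>e. e > 0 \<Longrightarrow> \<exists>d>0. \<forall>s\<in>I. \<forall>t\<in>I. \<bar>t - s\<bar> < d \<longrightarrow>
       \<bar>F t - F s - g s * (x t - x s)\<bar> \<le> e * \<bar>t - s\<bar>"
  shows "stieltjes_diff I F g x"
  using assms unfolding stieltjes_diff_def by blast

lemma stieltjes_diffE:
  assumes "stieltjes_diff I F g x" "e > 0"
  obtains d where "d > 0" "\<And>s t. \<lbrakk>s \<in> I; t \<in> I; \<bar>t - s\<bar> < d\<rbrakk> \<Longrightarrow>
       \<bar>F t - F s - g s * (x t - x s)\<bar> \<le> e * \<bar>t - s\<bar>"
  using assms unfolding stieltjes_diff_def by meson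

lemma stieltjes_diff_subset: "stieltjes_diff I F g x \<Longrightarrow> J \<subseteq> I \<Longrightarrow> stieltjes_diff J F g x"
  unfolding stieltjes_diff_def by (meson subset_iff)

lemma stieltjes_diff_cong:
  assumes "stieltjes_diff I F g x" "\<And>t. t \<in> I \<Longrightarrow> F t = F' t" "\<And>t. t \<in> I \<Longrightarrow> g t = g' t"
    "\<And>t. t \<in> I \<Longrightarrow> x t = x' t"
  shows "stieltjes_diff I F' g' x'"
  using assms unfolding stieltjes_diff_def by simp

lemma stieltjes_diff_add:
  assumes "stieltjes_diff I F g x" "stieltjes_diff I G h x"
  shows "stieltjes_diff I (\<lambda>t. F t + G t) (\<lambda>t. g t + h t) x"
proof (rule stieltjes_diffI)
  fix e :: real assume "e > 0"
  then have e: "e/2 > 0" by simp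
  obtain d1 where d1: "d1 > 0" "\<And>s t. \<lbrakk>s \<in> I; t \<in> I; \<bar>t - s\<bar> < d1\<rbrakk> \<Longrightarrow>
       \<bar>F t - F s - g s * (x t - x s)\<bar> \<le> e/2 * \<bar>t - s\<bar>" using stieltjes_diffE[OF assms(1) e] by metis
  obtain d2 where d2: "d2 > 0" "\<And>s t. \<lbrakk>s \<in> I; t \<in> I; \<bar>t - s\<bar> < d2\<rbrakk> \<Longrightarrow>
       \<bar>G t - G s - h s * (x t - x s)\<bar> \<le> e/2 * \<bar>t - s\<bar>" using stieltjes_diffE[OF assms(2) e] by metis
  show "\<exists>d>0. \<forall>s\<in>I. \<forall>t\<in>I. \<bar>t - s\<bar> < d \<longrightarrow>
       \<bar>F t + G t - (F s + G s) - (g s + h s) * (x t - x s)\<bar> \<le> e * \<bar>t - s\<bar>"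
  proof (intro exI[of _ "min d1 d2"] conjI ballI impI)
    fix s t assume st: "s \<in> I" "t \<in> I" "\<bar>t - s\<bar> < min d1 d2"
    have eq: "F t + G t - (F s + G s) - (g s + h s) * (x t - x s)
      = (F t - F s - g s * (x t - x s)) + (G t - G s - h s * (x t - x s))" by (simp add: algebra_simps)
    show "\<bar>F t + G t - (F s + G s) - (g s + h s) * (x t - x s)\<bar> \<le> e * \<bar>t - s\<bar>"
      unfolding eq using d1(2)[of s t] d2(2)[of s t] st by (auto intro!: abs_triangle_ineq[THEN order_trans])
  qed (use d1 d2 in auto)
qed

lemma stieltjes_diff_const: "stieltjes_diff I (\<lambda>_. c) (\<lambda>_. 0) x"
  by (auto simp: stieltjes_diff_def intro: exI[of _ 1])

lemma stieltjes_diff_minus: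
  "stieltjes_diff I F g x \<Longrightarrow> stieltjes_diff I (\<lambda>t. - F t) (\<lambda>t. - g t) x"
  unfolding stieltjes_diff_def
  by (simp add: abs_le_iff algebra_simps) (metis add.commute)

lemma stieltjes_diff_add_const:
  "stieltjes_diff I F g x \<Longrightarrow> stieltjes_diff I (\<lambda>t. F t + c) g x"
  using stieltjes_diff_add[OF _ stieltjes_diff_const[of I c x], of F g] by simp

text \<open>The error term is linear in the increment, so a Lipschitz change of parameter costs only
  a factor; \<open>L + 1\<close> in place of \<open>L\<close> covers constant
  \<open>u\<close>.\<close>

lemma stieltjes_diff_comp:
  assumes "stieltjes_diff J F g x" "L-lipschitz_on I u" "u ` I \<subseteq> J"
  shows "stieltjes_diff I (\<lambda>t. F (u t)) (\<lambda>t. g (u t)) (\<lambda>t. x (u t))"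
proof (rule stieltjes_diffI)
  fix e :: real assume "e > 0"
  have L: "L \<ge> 0" using assms(2) by (rule lipschitz_on_nonneg)
  obtain d where d: "d > 0" "\<And>s t. \<lbrakk>s \<in> J; t \<in> J; \<bar>t - s\<bar> < d\<rbrakk> \<Longrightarrow>
       \<bar>F t - F s - g s * (x t - x s)\<bar> \<le> e/(L+1) * \<bar>t - s\<bar>"
    using stieltjes_diffE[OF assms(1), of "e/(L+1)"] \<open>e > 0\<close> L by (metis add_nonneg_pos zero_less_divide_iff zero_less_one)
  show "\<exists>d>0. \<forall>s\<in>I. \<forall>t\<in>I. \<bar>t - s\<bar> < d \<longrightarrow>
       \<bar>F (u t) - F (u s) - g (u s) * (x (u t) - x (u s))\<bar> \<le> e * \<bar>t - s\<bar>"
  proof (intro exI[of _ "d/(L+1)"] conjI ballI impI)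
    show "d/(L+1) > 0" using d L by auto
    fix s t assume st: "s \<in> I" "t \<in> I" "\<bar>t - s\<bar> < d/(L+1)"
    have 1: "\<bar>u t - u s\<bar> \<le> L * \<bar>t - s\<bar>"
      using lipschitz_onD[OF assms(2) st(2,1)] by (simp add: dist_real_def)
    also have 2: "\<dots> \<le> (L+1) * \<bar>t - s\<bar>" by (simp add: algebra_simps)
    finally have 2: "\<bar>u t - u s\<bar> \<le> (L+1) * \<bar>t - s\<bar>" .
    also have "\<dots> < d" using st(3) L by (simp add: field_simps)
    finally have "\<bar>F (u t) - F (u s) - g (u s) * (x (u t) - x (u s))\<bar> \<le> e/(L+1) * \<bar>u t - u s\<bar>"
      using d(2) assms(3) st by blast
    also have "\<dots> \<le> e/(L+1) * ((L+1) * \<bar>t - s\<bar>)"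
      using 2 \<open>e>0\<close> L by (intro mult_left_mono) auto
    also have "\<dots> = e * \<bar>t - s\<bar>" using L by simp
    finally show "\<bar>F (u t) - F (u s) - g (u s) * (x (u t) - x (u s))\<bar> \<le> e * \<bar>t - s\<bar>" .
  qed
qed

text \<open>The hypothesis forces derivative 0 at every point of the interval, one-sided at its
  ends.\<close>

lemma small_increments_imp_const:
  fixes D :: "real \<Rightarrow> real"
  assumes D: "\<And>e. e > 0 \<Longrightarrow> \<exists>d>0. \<forall>s\<in>{a..b}. \<forall>t\<in>{a..b}. \<bar>t - s\<bar> < d \<longrightarrow> \<bar>D t - D s\<bar> \<le> e * \<bar>t - s\<bar>"
    and st: "s \<in> {a..b}" "t \<in> {a..b}"
  shows "D s = D t"
proof -
  have deriv: "(D has_real_derivative 0) (at x within {a..b})" if "x \<in> {a..b}" for x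
    unfolding has_field_derivative_iff Lim_within
  proof (intro allI impI)
    fix e :: real assume e: "e > 0"
    obtain d where d: "d > 0" "\<And>s t. s\<in>{a..b} \<Longrightarrow> t\<in>{a..b} \<Longrightarrow> \<bar>t - s\<bar> < d \<Longrightarrow> \<bar>D t - D s\<bar> \<le> e/2 * \<bar>t - s\<bar>"
      using D[of "e/2"] e by auto
    show "\<exists>s>0. \<forall>xa\<in>{a..b}. 0 < dist xa x \<and> dist xa x < s \<longrightarrow> dist ((D xa - D x) / (xa - x)) 0 < e"
    proof (intro exI[of _ d] conjI ballI impI)
      fix y assume y: "y \<in> {a..b}" "0 < dist y x \<and> dist y x < d"
      have "\<bar>D y - D x\<bar> \<le> e/2 * \<bar>y - x\<bar>" using d(2)[of x y] that y by (simp add: dist_real_def)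
      also have "\<dots> < e * \<bar>y - x\<bar>" using e y by (intro mult_strict_right_mono) auto
      finally show "dist ((D y - D x) / (y - x)) 0 < e" using y by (simp add: field_simps)
    qed (use d in auto)
  qed
  have "\<exists>c. \<forall>x\<in>{a..b}. D x = c"
    by (rule has_field_derivative_zero_constant) (use deriv in auto)
  then show ?thesis using st by metis
qed

text \<open>The terms in \<open>x\<close> cancel in the difference \<open>F - G\<close>, whose
  increments are then \<open>o(t - s)\<close> uniformly. This replaces the almost-everywhere
  uniqueness of primitives.\<close>

lemma stieltjes_diff_unique:
  assumes "stieltjes_diff {a..b} F g x" "stieltjes_diff {a..b} G g x" "s \<in> {a..b}" "t \<in> {a..b}"
  shows "F t - F s = G t - G s"
proof -
  have "stieltjes_diff {a..b} (\<lambda>t. F t + - G t) (\<lambda>t. g t + - g t) x"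
    by (intro stieltjes_diff_add assms stieltjes_diff_minus)
  then have "F s + - G s = F t + - G t"
    by (intro small_increments_imp_const[OF _ assms(3,4)]) (auto simp: stieltjes_diff_def)
  then show ?thesis by simp
qed

section \<open>Lipschitz functions and bounded densities\<close>

lemma emeasure_interval_measure_Ioo:
  assumes "a \<le> b" and mono: "\<And>x y. x \<le> y \<Longrightarrow> F x \<le> F y" and cont: "continuous_on UNIV F"
  shows "emeasure (interval_measure F) {a<..<b} = ennreal (F b - F a)"
proof (cases "a = b")
  case False
  with assms have ab: "a < b" by simp
  let ?N = "interval_measure F"
  have rc: "continuous (at_right a) F" for a
    using cont by (auto simp: continuous_on_eq_continuous_within intro: continuous_at_imp_continuous_at_within)
  have "emeasure ?N {b} = 0"
    using emeasure_interval_measure_Icc[OF order_refl mono cont, of b] by simp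
  moreover have "{a<..b} = {a<..<b} \<union> {b}" using ab by auto
  moreover have "emeasure ?N ({a<..<b} \<union> {b}) = emeasure ?N {a<..<b} + emeasure ?N {b}"
    by (rule plus_emeasure[symmetric]) auto
  ultimately show ?thesis
    using emeasure_interval_measure_Ioc[OF assms(1) mono rc] by simp
qed simp

text \<open>The slope bound makes both \<open>F\<close> and \<open>t - F t\<close> nondecreasing.
  Their Stieltjes measures add up to Lebesgue measure, so each is absolutely continuous, and the
  Radon-Nikodym density of the first is at most 1 almost everywhere.\<close>

lemma lipschitz_mono_density:
  fixes F :: "real \<Rightarrow> real"
  assumes mono: "\<And>x y. x \<le> y \<Longrightarrow> F x \<le> F y" and slope: "\<And>x y. x \<le> y \<Longrightarrow> F y - F x \<le> y - x"
  obtains p where "p \<in> borel_measurable borel" "\<And>x. 0 \<le> p x" "\<And>x. p x \<le> (1::real)"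
    "\<And>a b. a \<le> b \<Longrightarrow> (p has_integral (F b - F a)) {a..b}"
proof -
  define G where "G t = t - F t" for t
  have monoG: "G x \<le> G y" if "x \<le> y" for x y using slope[OF that] by (simp add: G_def)
  have "1-lipschitz_on UNIV F"
  proof (rule lipschitz_onI)
    fix x y show "dist (F x) (F y) \<le> 1 * dist x y"
      using mono[of x y] mono[of y x] slope[of x y] slope[of y x] by (cases "x \<le> y") (auto simp: dist_real_def)
  qed simp
  then have contF: "continuous_on UNIV F" by (rule lipschitz_on_continuous_on)
  then have contG: "continuous_on UNIV G" unfolding G_def by (intro continuous_intros)
  let ?N = "interval_measure F" and ?N' = "interval_measure G"
  \<comment> \<open>The sum of the two measures. It is identified with \<open>lborel\<close> on open
    boxes, where the increments of \<open>F\<close> and \<open>G\<close> add up to the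
    length.\<close>
  define M where "M = measure_of UNIV (sets borel) (\<lambda>A. emeasure ?N A + emeasure ?N' A)"
  have emM: "emeasure M A = emeasure ?N A + emeasure ?N' A" if "A \<in> sets borel" for A
    unfolding M_def
  proof (rule emeasure_measure_of_sigma)
    show "sigma_algebra UNIV (sets borel)" using sets.sigma_algebra_axioms[of borel] by simp
    show "positive (sets borel) (\<lambda>A. emeasure ?N A + emeasure ?N' A)" by (simp add: positive_def)
    show "countably_additive (sets borel) (\<lambda>A. emeasure ?N A + emeasure ?N' A)"
    proof (rule countably_additiveI)
      fix A :: "nat \<Rightarrow> real set" assume A: "range A \<subseteq> sets borel" "disjoint_family A" "\<Union> (range A) \<in> sets borel"
      have "(\<Sum>i. emeasure ?N (A i) + emeasure ?N' (A i)) = (\<Sum>i. emeasure ?N (A i)) + (\<Sum>i. emeasure ?N' (A i))"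
        by (rule suminf_add[symmetric]) auto
      then show "(\<Sum>i. emeasure ?N (A i) + emeasure ?N' (A i)) = emeasure ?N (\<Union> (range A)) + emeasure ?N' (\<Union> (range A))"
        using A by (simp add: suminf_emeasure)
    qed
  qed fact
  have "sets M = sets borel" unfolding M_def using sets.sigma_sets_eq[of borel] by simp
  have MI: "lborel = M"
  proof (rule lborel_eqI)
    fix l u :: real assume "\<And>b. b \<in> Basis \<Longrightarrow> l \<bullet> b \<le> u \<bullet> b"
    then have lu: "l \<le> u" by simp
    have "emeasure M (box l u) = ennreal (F u - F l) + ennreal (G u - G l)"
      by (simp add: emM box_real emeasure_interval_measure_Ioo[OF lu mono contF]
          emeasure_interval_measure_Ioo[OF lu monoG contG])
    also have "\<dots> = ennreal ((F u - F l) + (G u - G l))"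
      using mono[OF lu] monoG[OF lu] by (simp add: ennreal_plus)
    finally show "emeasure M (box l u) = (\<Prod>b\<in>Basis. (u - l) \<bullet> b)" by (simp add: G_def)
  qed fact
  have em: "emeasure ?N A + emeasure ?N' A = emeasure lborel A" if "A \<in> sets borel" for A
    using emM[OF that] MI by simp
  have "\<exists>f\<in>borel_measurable lborel. density lborel f = ?N"
  proof (rule sigma_finite_measure.Radon_Nikodym[OF sigma_finite_lborel])
    show "absolutely_continuous lborel ?N" unfolding absolutely_continuous_def
      using em by (auto simp: null_sets_def) (metis add_eq_0_iff_both_eq_0)
  qed simp
  then obtain f where f: "f \<in> borel_measurable lborel" "density lborel f = ?N" by blast
  have "\<exists>f\<in>borel_measurable lborel. density lborel f = ?N'"
  proof (rule sigma_finite_measure.Radon_Nikodym[OF sigma_finite_lborel])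
    show "absolutely_continuous lborel ?N'" unfolding absolutely_continuous_def
      using em by (auto simp: null_sets_def) (metis add_eq_0_iff_both_eq_0)
  qed simp
  then obtain f' where f': "f' \<in> borel_measurable lborel" "density lborel f' = ?N'" by blast
  note [measurable] = f(1) f'(1)
  have "density lborel (\<lambda>x. f x + f' x) = density lborel (\<lambda>_. 1)"
  proof (rule measure_eqI)
    fix A :: "real set" assume "A \<in> sets (density lborel (\<lambda>x. f x + f' x))"
    then have A[measurable]: "A \<in> sets borel" by simp
    have "emeasure (density lborel (\<lambda>x. f x + f' x)) A = (\<integral>\<^sup>+x. f x * indicator A x + f' x * indicator A x \<partial>lborel)"
      by (subst emeasure_density) (auto simp: distrib_right)
    also have "\<dots> = (\<integral>\<^sup>+x. f x * indicator A x \<partial>lborel) + (\<integral>\<^sup>+x. f' x * indicator A x \<partial>lborel)"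
      by (rule nn_integral_add) auto
    also have "\<dots> = emeasure ?N A + emeasure ?N' A"
      unfolding f(2)[symmetric] f'(2)[symmetric] by (simp add: emeasure_density)
    also have "\<dots> = emeasure (density lborel (\<lambda>_. 1)) A" using em[OF A] by (simp add: emeasure_density)
    finally show "emeasure (density lborel (\<lambda>x. f x + f' x)) A = emeasure (density lborel (\<lambda>_. 1)) A" .
  qed simp
  then have "AE x in lborel. f x + f' x = 1" by (intro sigma_finite_measure.density_unique[OF sigma_finite_lborel]) auto
  then have le1: "AE x in lborel. f x \<le> 1"
    by eventually_elim (metis le_iff_add)
  \<comment> \<open>Cutting at 1 turns the almost-everywhere bound on the density into one at every
    point and keeps \<open>enn2real\<close> away from infinity.\<close>
  define p where "p x = enn2real (min (f x) 1)" for x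
  have p[measurable]: "p \<in> borel_measurable borel" unfolding p_def by measurable
  have p0: "0 \<le> p x" "p x \<le> 1" for x unfolding p_def by (auto intro: enn2real_leI)
  have ep: "AE x in lborel. ennreal (p x) = f x"
    using le1 by eventually_elim (auto simp: p_def min_absorb1 intro!: ennreal_enn2real intro: le_less_trans)
  have "(p has_integral (F b - F a)) {a..b}" if "a \<le> b" for a b
  proof -
    have "((\<lambda>x. if x \<in> {a..b} then p x else 0) has_integral (F b - F a)) UNIV"
    proof (rule nn_integral_has_integral)
      have "(\<integral>\<^sup>+x. ennreal (if x \<in> {a..b} then p x else 0) \<partial>lborel) = (\<integral>\<^sup>+x. f x * indicator {a..b} x \<partial>lborel)"
        by (rule nn_integral_cong_AE, use ep in eventually_elim) (auto simp: indicator_def)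
      also have "\<dots> = emeasure ?N {a..b}" unfolding f(2)[symmetric] by (simp add: emeasure_density)
      also have "\<dots> = ennreal (F b - F a)" by (rule emeasure_interval_measure_Icc[OF that mono contF])
      finally show "(\<integral>\<^sup>+x. ennreal (if x \<in> {a..b} then p x else 0) \<partial>lborel) = ennreal (F b - F a)" .
    qed (use p0 mono[OF that] in auto)
    then show ?thesis by (simp only: has_integral_restrict_UNIV)
  qed
  then show ?thesis using that[of p] p p0 by blast
qed

text \<open>Adding a multiple of the identity makes a Lipschitz function monotone: all slopes of
  \<open>t / 2 + f / (2 (L + 1))\<close> lie between 0 and 1, so the monotone case applies and its
  density is rescaled back.\<close>

lemma lipschitz_density:
  fixes f :: "real \<Rightarrow> real"
  assumes f: "L-lipschitz_on {0..T} f" and T: "T \<ge> 0"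
  obtains a where "a \<in> borel_measurable borel" "\<And>t. \<bar>a t\<bar> \<le> L + 1"
    "\<And>t. t \<in> {0..T} \<Longrightarrow> (a has_integral (f t - f 0)) {0..t}"
proof -
  have L: "L \<ge> 0" using f by (rule lipschitz_on_nonneg)
  \<comment> \<open>Clamping to \<open>[0, T]\<close> extends \<open>f\<close> to the whole line
    with the same Lipschitz constant.\<close>
  define c where "c t = max 0 (min T t)" for t
  have cT: "c t \<in> {0..T}" for t using T by (auto simp: c_def)
  define F where "F t = t / 2 + f (c t) / (2 * (L + 1))" for t
  have fd: "\<bar>f (c y) - f (c x)\<bar> \<le> (L + 1) * (y - x)" if "x \<le> y" for x y
  proof -
    have "\<bar>f (c y) - f (c x)\<bar> \<le> L * \<bar>c y - c x\<bar>"
      using lipschitz_onD[OF f cT cT, of y x] by (simp add: dist_real_def)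
    also have "\<dots> \<le> (L + 1) * (y - x)" using that L by (intro mult_mono) (auto simp: c_def)
    finally show ?thesis .
  qed
  have d: "\<bar>F y - F x - (y - x) / 2\<bar> \<le> (y - x) / 2" if "x \<le> y" for x y
  proof -
    have "F y - F x - (y - x) / 2 = (f (c y) - f (c x)) / (2 * (L + 1))"
      by (simp add: F_def diff_divide_distrib)
    then have "\<bar>F y - F x - (y - x) / 2\<bar> = \<bar>f (c y) - f (c x)\<bar> / (2 * (L + 1))" using L by simp
    also have "\<dots> \<le> (y - x) / 2" using fd[OF that] L by (simp add: field_simps)
    finally show ?thesis .
  qed
  obtain p where p: "p \<in> borel_measurable borel" "\<And>x. 0 \<le> p x" "\<And>x. p x \<le> (1::real)"
    "\<And>a b. a \<le> b \<Longrightarrow> (p has_integral (F b - F a)) {a..b}"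
  proof (rule lipschitz_mono_density[of F])
    fix x y :: real assume "x \<le> y"
    then have "\<bar>F y - F x - (y - x) / 2\<bar> \<le> (y - x) / 2" by (rule d)
    then show "F x \<le> F y" "F y - F x \<le> y - x" by (auto simp: abs_le_iff field_simps)
  qed blast
  \<comment> \<open>This inverts the affine passage from \<open>f\<close> to \<open>F\<close>; since
    \<open>p\<close> lies in \<open>[0, 1]\<close>, the values stay within
    \<open>L + 1\<close>.\<close>
  define a where "a t = (p t - 1/2) * (2 * (L + 1))" for t
  show ?thesis
  proof (rule that[of a])
    show "a \<in> borel_measurable borel" unfolding a_def using p(1) by measurable
    fix t :: real
    have "\<bar>p t - 1/2\<bar> \<le> 1/2" using p(2,3)[of t] by linarith
    then have "\<bar>p t - 1/2\<bar> * (2 * (L + 1)) \<le> 1/2 * (2 * (L + 1))" using L by (intro mult_right_mono) auto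
    moreover have "\<bar>a t\<bar> = \<bar>p t - 1/2\<bar> * (2 * (L + 1))" using L unfolding a_def abs_mult by simp
    ultimately show "\<bar>a t\<bar> \<le> L + 1" by simp
    assume t: "t \<in> {0..T}"
    have "((\<lambda>t. (p t - 1/2) * (2 * (L + 1))) has_integral ((F t - F 0 - (1/2) * (t - 0)) * (2 * (L + 1)))) {0..t}"
      using t by (intro has_integral_mult_left has_integral_diff p(4) has_integral_const_real[of "1/2" 0 t, simplified, THEN has_integral_eq_rhs]) auto
    moreover have "(F t - F 0 - (1/2) * (t - 0)) * (2 * (L + 1)) = f t - f 0"
    proof -
      have "c t = t" "c 0 = 0" using t T by (auto simp: c_def)
      then have "F t - F 0 - (1/2) * (t - 0) = (f t - f 0) / (2 * (L + 1))"
        by (simp add: F_def diff_divide_distrib)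
      then show ?thesis using L by simp
    qed
    ultimately show "(a has_integral (f t - f 0)) {0..t}" unfolding a_def by simp
  qed
qed

section \<open>Bounded measurable functions and their indefinite integrals\<close>

definition bdd_measurable :: "real \<Rightarrow> (real \<Rightarrow> real) \<Rightarrow> bool"
  where "bdd_measurable T a \<longleftrightarrow> a \<in> borel_measurable (lebesgue_on {0..T}) \<and> bounded (a ` {0..T})"

lemma bdd_measurableE:
  assumes "bdd_measurable T a"
  obtains K where "K > 0" "\<And>t. t \<in> {0..T} \<Longrightarrow> \<bar>a t\<bar> \<le> K"
  using assms by (auto simp: bdd_measurable_def bounded_pos)

lemma bdd_measurable_continuous: "continuous_on {0..T} g \<Longrightarrow> bdd_measurable T g"
  unfolding bdd_measurable_def
  by (auto intro!: continuous_imp_measurable_on_sets_lebesgue compact_imp_bounded compact_continuous_image)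

lemma bdd_measurable_mult:
  assumes "bdd_measurable T a" "bdd_measurable T b"
  shows "bdd_measurable T (\<lambda>t. a t * b t)"
proof -
  obtain K L where "K > 0" "\<And>t. t \<in> {0..T} \<Longrightarrow> \<bar>a t\<bar> \<le> K" "L > 0" "\<And>t. t \<in> {0..T} \<Longrightarrow> \<bar>b t\<bar> \<le> L"
    by (metis assms bdd_measurableE)
  then have "\<bar>a t * b t\<bar> \<le> K * L" if "t \<in> {0..T}" for t
    unfolding abs_mult using that by (intro mult_mono) (auto intro: less_imp_le)
  then have "bounded ((\<lambda>t. a t * b t) ` {0..T})" by (auto simp: bounded_iff intro!: exI[of _ "K * L"])
  then show ?thesis using assms unfolding bdd_measurable_def by (auto intro: borel_measurable_times)
qed

lemma bdd_measurable_add: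
  assumes "bdd_measurable T a" "bdd_measurable T b"
  shows "bdd_measurable T (\<lambda>t. a t + b t)"
proof -
  obtain K L where "K > 0" "\<And>t. t \<in> {0..T} \<Longrightarrow> \<bar>a t\<bar> \<le> K" "L > 0" "\<And>t. t \<in> {0..T} \<Longrightarrow> \<bar>b t\<bar> \<le> L"
    by (metis assms bdd_measurableE)
  then have "\<bar>a t + b t\<bar> \<le> K + L" if "t \<in> {0..T}" for t
    by (meson abs_triangle_ineq add_mono order_trans that)
  then have "bounded ((\<lambda>t. a t + b t) ` {0..T})" by (auto simp: bounded_iff intro!: exI[of _ "K + L"])
  then show ?thesis using assms unfolding bdd_measurable_def by (auto intro: borel_measurable_add)
qed

lemma bdd_measurable_integrable:
  assumes a: "bdd_measurable T a" and st: "0 \<le> s" "t \<le> T"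
  shows "a integrable_on {s..t}"
proof -
  obtain K where "K > 0" "\<And>t. t \<in> {0..T} \<Longrightarrow> \<bar>a t\<bar> \<le> K" by (metis a bdd_measurableE)
  then have "a integrable_on {0..T}"
    using measurable_bounded_by_integrable_imp_integrable[of a "{0..T}" "\<lambda>_. K"] a
    by (simp add: bdd_measurable_def integrable_const_ivl)
  then show ?thesis by (rule integrable_on_subinterval) (use st in auto)
qed

lemma integral_bound_real:
  fixes f :: "real \<Rightarrow> real"
  assumes "f integrable_on {s..t}" "\<And>u. u \<in> {s..t} \<Longrightarrow> \<bar>f u\<bar> \<le> B" "s \<le> t"
  shows "\<bar>integral {s..t} f\<bar> \<le> B * (t - s)"
proof -
  have "0 \<le> B" using assms(2)[of s] assms(3) by auto
  then show ?thesis
    using has_integral_bound[of B f "integral {s..t} f" s t] assms by (auto intro: integrable_integral)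
qed

lemma integral_lipschitz:
  assumes a: "bdd_measurable T a"
  obtains K where "K-lipschitz_on {0..T} (\<lambda>t. integral {0..t} a)"
proof -
  obtain K where K: "K > 0" "\<And>t. t \<in> {0..T} \<Longrightarrow> \<bar>a t\<bar> \<le> K" by (metis a bdd_measurableE)
  have le: "\<bar>integral {0..t} a - integral {0..s} a\<bar> \<le> K * (t - s)" if "0 \<le> s" "s \<le> t" "t \<le> T" for s t
  proof -
    have "integral {0..s} a + integral {s..t} a = integral {0..t} a"
      using that by (intro Henstock_Kurzweil_Integration.integral_combine bdd_measurable_integrable[OF a]) auto
    moreover have "\<bar>integral {s..t} a\<bar> \<le> K * (t - s)"
      using that by (intro integral_bound_real bdd_measurable_integrable[OF a] K) auto
    ultimately show ?thesis by simp
  qed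
  have "K-lipschitz_on {0..T} (\<lambda>t. integral {0..t} a)"
  proof (rule lipschitz_onI)
    fix s t assume "s \<in> {0..T}" "t \<in> {0..T}"
    then show "dist (integral {0..s} a) (integral {0..t} a) \<le> K * dist s t"
      using le[of s t] le[of t s] by (cases "s \<le> t") (auto simp: dist_real_def abs_minus_commute)
  qed (use K in auto)
  then show ?thesis using that by blast
qed

lemma integral_continuous_bdd:
  assumes "bdd_measurable T a" shows "continuous_on {0..T} (\<lambda>t. integral {0..t} a)"
  using integral_lipschitz[OF assms] lipschitz_on_continuous_on by metis

text \<open>Continuity of \<open>g\<close> is uniform, so on short intervals \<open>g\<close> may be
  frozen at one end. With \<open>K\<close> a bound of \<open>a\<close>, the tolerance
  \<open>e / K\<close> for \<open>g\<close> becomes an error of \<open>e\<close> per unit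
  length.\<close>

lemma stieltjes_diff_integral:
  assumes a: "bdd_measurable T a" and g: "continuous_on {0..T} g"
  shows "stieltjes_diff {0..T} (\<lambda>t. integral {0..t} (\<lambda>u. a u * g u)) g (\<lambda>t. integral {0..t} a)"
proof (rule stieltjes_diffI)
  fix e :: real assume e: "e > 0"
  obtain K where K: "K > 0" "\<And>t. t \<in> {0..T} \<Longrightarrow> \<bar>a t\<bar> \<le> K" by (metis a bdd_measurableE)
  have ag: "bdd_measurable T (\<lambda>u. a u * g u)" by (intro bdd_measurable_mult a bdd_measurable_continuous g)
  have "uniformly_continuous_on {0..T} g" using g by (intro compact_uniformly_continuous) auto
  then obtain d where d: "d > 0" "\<And>s t. \<lbrakk>s \<in> {0..T}; t \<in> {0..T}; dist t s < d\<rbrakk> \<Longrightarrow> dist (g t) (g s) < e / K"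
    unfolding uniformly_continuous_on_def using e K by (metis divide_pos_pos)
  have comb: "integral {0..t} f - integral {0..s} f = integral {s..t} f"
    if "bdd_measurable T f" "0 \<le> s" "s \<le> t" "t \<le> T" for f s t
    using Henstock_Kurzweil_Integration.integral_combine[of 0 s t f] that bdd_measurable_integrable[OF that(1), of 0 t] by simp
  have le: "\<bar>integral {s..t} (\<lambda>u. a u * g u) - c * integral {s..t} a\<bar> \<le> e * (t - s)"
    if st: "0 \<le> s" "s \<le> t" "t \<le> T" and c: "\<And>u. u \<in> {s..t} \<Longrightarrow> \<bar>g u - c\<bar> \<le> e / K" for s t c
  proof -
    have i: "(\<lambda>u. a u * g u) integrable_on {s..t}" "a integrable_on {s..t}"
      using st by (auto intro: bdd_measurable_integrable ag a)
    have ic: "(\<lambda>u. c * a u) integrable_on {s..t}" using i(2) by (rule integrable_on_mult_right)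
    have "integral {s..t} (\<lambda>u. a u * g u) - c * integral {s..t} a = integral {s..t} (\<lambda>u. a u * g u - c * a u)"
      by (simp add: Henstock_Kurzweil_Integration.integral_diff[OF i(1) ic])
    moreover have "\<bar>integral {s..t} (\<lambda>u. a u * g u - c * a u)\<bar> \<le> e * (t - s)"
    proof (rule integral_bound_real)
      fix u assume u: "u \<in> {s..t}"
      have "a u * g u - c * a u = a u * (g u - c)" by (simp add: algebra_simps)
      also have "\<bar>\<dots>\<bar> \<le> K * (e / K)" unfolding abs_mult using K(2)[of u] c[OF u] u st K(1) by (intro mult_mono) auto
      finally show "\<bar>a u * g u - c * a u\<bar> \<le> e" using K by simp
    qed (use i ic st in \<open>auto intro!: integrable_diff\<close>)
    ultimately show ?thesis by simp
  qed
  show "\<exists>d>0. \<forall>s\<in>{0..T}. \<forall>t\<in>{0..T}. \<bar>t - s\<bar> < d \<longrightarrow>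
     \<bar>integral {0..t} (\<lambda>u. a u * g u) - integral {0..s} (\<lambda>u. a u * g u) - g s * (integral {0..t} a - integral {0..s} a)\<bar>
       \<le> e * \<bar>t - s\<bar>"
  proof (intro exI[of _ d] conjI ballI impI)
    fix s t assume st: "s \<in> {0..T}" "t \<in> {0..T}" "\<bar>t - s\<bar> < d"
    show "\<bar>integral {0..t} (\<lambda>u. a u * g u) - integral {0..s} (\<lambda>u. a u * g u) - g s * (integral {0..t} a - integral {0..s} a)\<bar>
       \<le> e * \<bar>t - s\<bar>"
    proof (cases "s \<le> t")
      case True
      have "\<bar>integral {s..t} (\<lambda>u. a u * g u) - g s * integral {s..t} a\<bar> \<le> e * (t - s)"
        by (rule le) (use st True d(2)[of s] in \<open>auto simp: dist_real_def intro!: less_imp_le\<close>)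
      then show ?thesis using comb[OF ag, of s t] comb[OF a, of s t] st True by simp
    next
      case False
      have "\<bar>integral {t..s} (\<lambda>u. a u * g u) - g s * integral {t..s} a\<bar> \<le> e * (s - t)"
        by (rule le) (use st False d(2)[of s] in \<open>auto simp: dist_real_def intro!: less_imp_le\<close>)
      moreover have "integral {0..t} (\<lambda>u. a u * g u) - integral {0..s} (\<lambda>u. a u * g u) - g s * (integral {0..t} a - integral {0..s} a)
        = - (integral {t..s} (\<lambda>u. a u * g u) - g s * integral {t..s} a)"
        proof -
        have "integral {0..t} (\<lambda>u. a u * g u) - integral {0..s} (\<lambda>u. a u * g u) = - integral {t..s} (\<lambda>u. a u * g u)"
          "integral {0..t} a - integral {0..s} a = - integral {t..s} a"
          using comb[OF ag, of t s] comb[OF a, of t s] st False by auto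
        then show ?thesis by simp
      qed
      ultimately show ?thesis using False by simp
    qed
  qed (fact d)
qed

text \<open>A density \<open>a\<close> of \<open>x\<close> turns the wanted primitive into the
  indefinite integral of \<open>a * g\<close>.\<close>

lemma stieltjes_diff_exists:
  assumes x: "L-lipschitz_on {0..1} x" and g: "continuous_on {0..1} g"
  obtains F where "stieltjes_diff {0..1} F g x" "F 0 = c" "continuous_on {0..1} F"
proof -
  obtain a where a: "a \<in> borel_measurable borel" "\<And>t. \<bar>a t\<bar> \<le> L + 1"
    "\<And>t. t \<in> {0..1} \<Longrightarrow> (a has_integral (x t - x 0)) {0..t}" by (rule lipschitz_density[OF x zero_le_one]) blast
  have "a \<in> borel_measurable (lebesgue_on {0..1})"
    using a(1) by (intro measurable_restrict_space1 measurable_completion) simp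
  then have bm: "bdd_measurable 1 a" unfolding bdd_measurable_def using a(2) by (auto simp: bounded_iff)
  let ?F = "\<lambda>t. integral {0..t} (\<lambda>u. a u * g u)"
  have "stieltjes_diff {0..1} ?F g x"
  proof -
    have "stieltjes_diff {0..1} ?F g (\<lambda>t. x t - x 0)"
      by (rule stieltjes_diff_cong[OF stieltjes_diff_integral[OF bm g]]) (use a(3)[THEN integral_unique] in auto)
    then show ?thesis by (simp add: stieltjes_diff_def)
  qed
  moreover have "continuous_on {0..1} ?F"
    by (intro integral_continuous_bdd bdd_measurable_mult bm bdd_measurable_continuous g)
  ultimately show ?thesis
    by (intro that[of "\<lambda>t. ?F t + c"] stieltjes_diff_add_const continuous_intros) auto
qed

lemma bdd_measurable_integrable_extension:
  assumes "bdd_measurable T g"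
  shows "(\<lambda>x. if x \<in> {0..T} then g x else 0) integrable_on cbox a b"
proof -
  have "(\<lambda>x. if x \<in> {0..T} then g x else 0) integrable_on UNIV"
    using bdd_measurable_integrable[OF assms order_refl order_refl] by (simp only: integrable_restrict_UNIV)
  then show ?thesis by (rule integrable_on_subcbox) simp
qed

section \<open>Absolutely continuous functions\<close>

text \<open>Averages over \<open>[x, x + h]\<close> converge to the integrand off a negligible set.
  The same applied to the reflected function gives the averages over \<open>[x - h, x]\<close>, and
  both one-sided difference quotients follow.\<close>

lemma integral_has_derivative_AE:
  fixes g :: "real \<Rightarrow> real"
  assumes g: "bdd_measurable T g"
  shows "AE t in lebesgue_on {0..T}. ((\<lambda>t. integral {0..t} g) has_real_derivative g t) (at t within {0..T})"
proof -
  define f where "f x = (if x \<in> {0..T} then g x else 0)" for x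
  have fi: "f integrable_on cbox a b" for a b
    unfolding f_def by (rule bdd_measurable_integrable_extension[OF g])
  have fr: "(\<lambda>x. f (- x)) integrable_on cbox a b" for a b
    using fi[of "-b" "-a"] integrable_reflect[of f "-a" "-b"] by simp
  obtain N1 where N1: "negligible N1" "\<And>x e. \<lbrakk>x \<notin> N1; 0 < e\<rbrakk> \<Longrightarrow>
       \<exists>d>0. \<forall>h. 0 < h \<and> h < d \<longrightarrow> norm (integral (cbox x (x + h *\<^sub>R One)) f /\<^sub>R h ^ DIM(real) - f x) < e"
    using integrable_ccontinuous_explicit[OF fi] by blast
  obtain N2 where N2: "negligible N2" "\<And>x e. \<lbrakk>x \<notin> N2; 0 < e\<rbrakk> \<Longrightarrow>
       \<exists>d>0. \<forall>h. 0 < h \<and> h < d \<longrightarrow> norm (integral (cbox x (x + h *\<^sub>R One)) (\<lambda>x. f (- x)) /\<^sub>R h ^ DIM(real) - f (- x)) < e"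
    using integrable_ccontinuous_explicit[OF fr] by blast
  define N where "N = N1 \<union> uminus ` N2"
  have "negligible (uminus ` N2)"
    by (rule negligible_differentiable_image_negligible[OF _ N2(1)]) (auto intro!: derivative_intros)
  then have N: "negligible N" using N1 by (simp add: N_def)
  have comb: "integral {0..t} g - integral {0..s} g = integral {s..t} f" if "0 \<le> s" "s \<le> t" "t \<le> T" for s t
  proof -
    have "integral {s..t} f = integral {s..t} g"
      by (rule integral_cong) (use that in \<open>auto simp: f_def\<close>)
    moreover have "integral {0..s} g + integral {s..t} g = integral {0..t} g"
      using that by (intro Henstock_Kurzweil_Integration.integral_combine bdd_measurable_integrable[OF g]) auto
    ultimately show ?thesis by simp
  qed
  have deriv: "((\<lambda>t. integral {0..t} g) has_real_derivative g x) (at x within {0..T})"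
    if x: "x \<in> {0..T}" "x \<notin> N" for x
    unfolding has_field_derivative_iff Lim_within
  proof (intro allI impI)
    fix e :: real assume e: "e > 0"
    have gf: "g x = f x" using x by (simp add: f_def)
    obtain d1 where d1: "d1 > 0" "\<And>h. 0 < h \<Longrightarrow> h < d1 \<Longrightarrow> \<bar>integral {x..x+h} f / h - f x\<bar> < e"
      using N1(2)[of x e] x e by (auto simp: N_def divide_inverse_commute)
    have "- x \<notin> N2" using x by (force simp: N_def)
    then obtain d2 where d2: "d2 > 0" "\<And>h. 0 < h \<Longrightarrow> h < d2 \<Longrightarrow> \<bar>integral {-x..-x+h} (\<lambda>x. f (- x)) / h - f x\<bar> < e"
      using N2(2)[of "-x" e] e by (auto simp: divide_inverse_commute)
    show "\<exists>d>0. \<forall>y\<in>{0..T}. 0 < dist y x \<and> dist y x < d \<longrightarrow>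
       dist ((integral {0..y} g - integral {0..x} g) / (y - x)) (g x) < e"
    proof (intro exI[of _ "min d1 d2"] conjI ballI impI)
      fix y assume y: "y \<in> {0..T}" "0 < dist y x \<and> dist y x < min d1 d2"
      show "dist ((integral {0..y} g - integral {0..x} g) / (y - x)) (g x) < e"
      proof (cases "x < y")
        case True
        then show ?thesis using d1(2)[of "y - x"] y x comb[of x y] by (simp add: dist_real_def gf)
      next
        case False
        then have yx: "y < x" using y by auto
        have "integral {-x..-x+(x-y)} (\<lambda>x. f (- x)) = integral {y..x} f"
          using integral_reflect_real[of x y f] by simp
        then have "\<bar>integral {y..x} f / (x - y) - f x\<bar> < e" using d2(2)[of "x - y"] y yx by (simp add: dist_real_def)
        moreover have "(integral {0..y} g - integral {0..x} g) / (y - x) = integral {y..x} f / (x - y)"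
        proof -
          have "integral {0..y} g - integral {0..x} g = - integral {y..x} f"
            using comb[of y x] y yx x by simp
          then show ?thesis by (metis minus_diff_eq minus_divide_divide)
        qed
        ultimately show ?thesis by (simp add: dist_real_def gf)
      qed
    qed (use d1 d2 in auto)
  qed
  have "AE x in lebesgue. x \<in> {0..T} \<longrightarrow> ((\<lambda>t. integral {0..t} g) has_real_derivative g x) (at x within {0..T})"
    by (rule AE_I'[of N]) (use N deriv in \<open>auto simp: negligible_iff_null_sets\<close>)
  then show ?thesis by (subst AE_restrict_space_iff) auto
qed

lemma lipschitz_imp_abs_continuous:
  assumes "K-lipschitz_on {a..b} f"
  shows "abs_continuous_on a b f"
  unfolding abs_continuous_on_def
proof (intro allI impI)
  fix e :: real assume e: "e > 0"
  have K: "K \<ge> 0" using assms by (rule lipschitz_on_nonneg)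
  show "\<exists>d>0. \<forall>(n::nat) u w. (\<forall>i<n. a \<le> u i \<and> u i \<le> w i \<and> w i \<le> b) \<and> disjoint_family_on (\<lambda>i. {u i<..<w i}) {..<n} \<and>
       (\<Sum>i<n. w i - u i) < d \<longrightarrow> (\<Sum>i<n. \<bar>f (w i) - f (u i)\<bar>) < e"
  proof (intro exI[of _ "e / (K + 1)"] conjI allI impI)
    show "e / (K + 1) > 0" using e K by simp
    fix n :: nat and u w :: "nat \<Rightarrow> real"
    assume H: "(\<forall>i<n. a \<le> u i \<and> u i \<le> w i \<and> w i \<le> b) \<and> disjoint_family_on (\<lambda>i. {u i<..<w i}) {..<n} \<and> (\<Sum>i<n. w i - u i) < e / (K + 1)"
    have "(\<Sum>i<n. \<bar>f (w i) - f (u i)\<bar>) \<le> (\<Sum>i<n. (K + 1) * (w i - u i))"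
    proof (rule sum_mono)
      fix i assume "i \<in> {..<n}"
      then have i: "a \<le> u i" "u i \<le> w i" "w i \<le> b" using H by auto
      have "\<bar>f (w i) - f (u i)\<bar> \<le> K * \<bar>w i - u i\<bar>"
        using lipschitz_onD[OF assms, of "w i" "u i"] i by (simp add: dist_real_def)
      also have "\<dots> \<le> (K + 1) * (w i - u i)" using i K by (simp add: algebra_simps)
      finally show "\<bar>f (w i) - f (u i)\<bar> \<le> (K + 1) * (w i - u i)" .
    qed
    also have "\<dots> = (K + 1) * (\<Sum>i<n. w i - u i)" by (simp add: sum_distrib_left)
    also have "\<dots> < (K + 1) * (e / (K + 1))" using H K by (intro mult_strict_left_mono) auto
    finally show "(\<Sum>i<n. \<bar>f (w i) - f (u i)\<bar>) < e" using K by simp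
  qed
qed

lemma abs_continuous_on_diff:
  assumes f: "abs_continuous_on a b f" and g: "abs_continuous_on a b g"
  shows "abs_continuous_on a b (\<lambda>x. f x - g x)"
  unfolding abs_continuous_on_def
proof (intro allI impI)
  fix e :: real assume e: "e > 0"
  then have e2: "e/2 > 0" by simp
  obtain d1 where d1: "d1 > 0" "\<And>n::nat. \<And>u w. (\<forall>i<n. a \<le> u i \<and> u i \<le> w i \<and> w i \<le> b) \<and> disjoint_family_on (\<lambda>i. {u i<..<w i}) {..<n} \<and>
       (\<Sum>i<n. w i - u i) < d1 \<Longrightarrow> (\<Sum>i<n. \<bar>f (w i) - f (u i)\<bar>) < e/2"
    using f[unfolded abs_continuous_on_def, rule_format, OF e2] by blast
  obtain d2 where d2: "d2 > 0" "\<And>n::nat. \<And>u w. (\<forall>i<n. a \<le> u i \<and> u i \<le> w i \<and> w i \<le> b) \<and> disjoint_family_on (\<lambda>i. {u i<..<w i}) {..<n} \<and>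
       (\<Sum>i<n. w i - u i) < d2 \<Longrightarrow> (\<Sum>i<n. \<bar>g (w i) - g (u i)\<bar>) < e/2"
    using g[unfolded abs_continuous_on_def, rule_format, OF e2] by blast
  show "\<exists>d>0. \<forall>(n::nat) u w. (\<forall>i<n. a \<le> u i \<and> u i \<le> w i \<and> w i \<le> b) \<and> disjoint_family_on (\<lambda>i. {u i<..<w i}) {..<n} \<and>
       (\<Sum>i<n. w i - u i) < d \<longrightarrow> (\<Sum>i<n. \<bar>f (w i) - g (w i) - (f (u i) - g (u i))\<bar>) < e"
  proof (intro exI[of _ "min d1 d2"] conjI allI impI)
    fix n :: nat and u w :: "nat \<Rightarrow> real"
    assume H: "(\<forall>i<n. a \<le> u i \<and> u i \<le> w i \<and> w i \<le> b) \<and> disjoint_family_on (\<lambda>i. {u i<..<w i}) {..<n} \<and> (\<Sum>i<n. w i - u i) < min d1 d2"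
    have "(\<Sum>i<n. \<bar>f (w i) - g (w i) - (f (u i) - g (u i))\<bar>) \<le> (\<Sum>i<n. \<bar>f (w i) - f (u i)\<bar> + \<bar>g (w i) - g (u i)\<bar>)"
      by (rule sum_mono) linarith
    also have "\<dots> < e" using d1(2)[of n u w] d2(2)[of n u w] H by (simp add: sum.distrib)
    finally show "(\<Sum>i<n. \<bar>f (w i) - g (w i) - (f (u i) - g (u i))\<bar>) < e" .
  qed (use d1 d2 in auto)
qed

lemma abs_continuous_on_imp_continuous:
  assumes "abs_continuous_on a b f"
  shows "continuous_on {a..b} f"
  unfolding continuous_on_iff
proof (intro ballI allI impI)
  fix x e :: real assume x: "x \<in> {a..b}" and e: "e > 0"
  obtain d where d: "d > 0" "\<And>n::nat. \<And>u w. (\<forall>i<n. a \<le> u i \<and> u i \<le> w i \<and> w i \<le> b) \<and> disjoint_family_on (\<lambda>i. {u i<..<w i}) {..<n} \<and>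
       (\<Sum>i<n. w i - u i) < d \<Longrightarrow> (\<Sum>i<n. \<bar>f (w i) - f (u i)\<bar>) < e"
    using assms[unfolded abs_continuous_on_def, rule_format, OF e] by blast
  have one: "\<bar>f w - f u\<bar> < e" if "a \<le> u" "u \<le> w" "w \<le> b" "w - u < d" for u w
    using d(2)[of 1 "\<lambda>_. u" "\<lambda>_. w"] that by (simp add: disjoint_family_on_def lessThan_Suc)
  show "\<exists>d>0. \<forall>x'\<in>{a..b}. dist x' x < d \<longrightarrow> dist (f x') (f x) < e"
  proof (intro exI[of _ d] conjI ballI impI)
    fix y assume "y \<in> {a..b}" "dist y x < d"
    then show "dist (f y) (f x) < e" using one[of x y] one[of y x] x
      by (cases "x \<le> y") (auto simp: dist_real_def abs_minus_commute)
  qed (fact d)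
qed

text \<open>The exceptional set is put into an open set \<open>U\<close> of measure less than the
  \<open>d\<close> of absolute continuity. Increments near good points are small relative to the
  length; those near bad points are charged to intervals inside \<open>U\<close>. Bisection takes
  the place of a Vitali covering.\<close>

lemma abs_continuous_zero_derivative:
  assumes ac: "abs_continuous_on a b D"
    and N: "negligible N" and der: "\<And>x. x \<in> {a..b} - N \<Longrightarrow> (D has_real_derivative 0) (at x within {a..b})"
    and ab: "a \<le> b"
  shows "D b = D a"
proof -
  have small: "\<bar>D b - D a\<bar> \<le> e * (b - a) + e" if e: "e > 0" for e
  proof -
    obtain d where d: "d > 0" "\<And>n::nat. \<And>u w. (\<forall>i<n. a \<le> u i \<and> u i \<le> w i \<and> w i \<le> b) \<and> disjoint_family_on (\<lambda>i. {u i<..<w i}) {..<n} \<and>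
         (\<Sum>i<n. w i - u i) < d \<Longrightarrow> (\<Sum>i<n. \<bar>D (w i) - D (u i)\<bar>) < e"
      using ac[unfolded abs_continuous_on_def, rule_format, OF e] by blast
    have "N \<in> null_sets lebesgue" using N by (simp add: negligible_iff_null_sets)
    then have Nset: "N \<in> sets lebesgue" "emeasure lebesgue N = 0" by auto
    obtain U where U: "open U" "N \<subseteq> U" "emeasure lebesgue (U - N) < ennreal d"
      using sets_lebesgue_outer_open[OF Nset(1) d(1)] by metis
    have "emeasure lebesgue U \<le> emeasure lebesgue (U - N) + emeasure lebesgue N"
    proof -
      have "U - N \<in> sets lebesgue" using U(1) Nset by auto
      then have "emeasure lebesgue ((U - N) \<union> N) \<le> emeasure lebesgue (U - N) + emeasure lebesgue N"
        using Nset by (intro emeasure_subadditive) auto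
      moreover have "(U - N) \<union> N = U" using U by auto
      ultimately show ?thesis by simp
    qed
    then have Ud: "emeasure lborel U < ennreal d" using U Nset by simp
    \<comment> \<open>The increment over \<open>[x, y]\<close> is paid for by \<open>e\<close> times
      the length and by the increments over finitely many disjoint intervals inside
      \<open>U\<close>. This survives concatenation, as bisection requires.\<close>
    define P where "P x y \<longleftrightarrow> (a \<le> x \<and> x \<le> y \<and> y \<le> b \<longrightarrow> (\<exists>(n::nat) u w.
        (\<forall>i<n. x \<le> u i \<and> u i \<le> w i \<and> w i \<le> y \<and> {u i<..<w i} \<subseteq> U) \<and> disjoint_family_on (\<lambda>i. {u i<..<w i}) {..<n} \<and>
        \<bar>D y - D x\<bar> \<le> e * (y - x) + (\<Sum>i<n. \<bar>D (w i) - D (u i)\<bar>)))" for x y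
    have "P a b"
    proof (rule Bolzano[OF ab])
      fix x y z assume xy: "P x y" and yz: "P y z" and le: "x \<le> y" "y \<le> z"
      show "P x z" unfolding P_def
      proof
        assume xz: "a \<le> x \<and> x \<le> z \<and> z \<le> b"
        obtain n :: nat and u w where n: "\<forall>i<n. x \<le> u i \<and> u i \<le> w i \<and> w i \<le> y \<and> {u i<..<w i} \<subseteq> U"
            "disjoint_family_on (\<lambda>i. {u i<..<w i}) {..<n}" "\<bar>D y - D x\<bar> \<le> e * (y - x) + (\<Sum>i<n. \<bar>D (w i) - D (u i)\<bar>)"
          using xy xz le unfolding P_def by auto
        obtain m :: nat and u' w' where m: "\<forall>i<m. y \<le> u' i \<and> u' i \<le> w' i \<and> w' i \<le> z \<and> {u' i<..<w' i} \<subseteq> U"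
            "disjoint_family_on (\<lambda>i. {u' i<..<w' i}) {..<m}" "\<bar>D z - D y\<bar> \<le> e * (z - y) + (\<Sum>i<m. \<bar>D (w' i) - D (u' i)\<bar>)"
          using yz xz le unfolding P_def by auto
        define u'' where "u'' i = (if i < n then u i else u' (i - n))" for i
        define w'' where "w'' i = (if i < n then w i else w' (i - n))" for i
        show "\<exists>(n::nat) u w. (\<forall>i<n. x \<le> u i \<and> u i \<le> w i \<and> w i \<le> z \<and> {u i<..<w i} \<subseteq> U) \<and> disjoint_family_on (\<lambda>i. {u i<..<w i}) {..<n} \<and>
          \<bar>D z - D x\<bar> \<le> e * (z - x) + (\<Sum>i<n. \<bar>D (w i) - D (u i)\<bar>)"
        proof (rule exI[of _ "n + m"], rule exI[of _ u''], rule exI[of _ w''], intro conjI)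
          show "\<forall>i<n+m. x \<le> u'' i \<and> u'' i \<le> w'' i \<and> w'' i \<le> z \<and> {u'' i<..<w'' i} \<subseteq> U"
          proof (intro allI impI)
            fix i assume i: "i < n + m"
            show "x \<le> u'' i \<and> u'' i \<le> w'' i \<and> w'' i \<le> z \<and> {u'' i<..<w'' i} \<subseteq> U"
            proof (cases "i < n")
              case True then show ?thesis using n(1) le by (force simp: u''_def w''_def)
            next
              case False
              then have "i - n < m" using i by auto
              then show ?thesis using m(1) le False by (force simp: u''_def w''_def)
            qed
          qed
          show "disjoint_family_on (\<lambda>i. {u'' i<..<w'' i}) {..<n+m}"
            unfolding disjoint_family_on_def
          proof (intro ballI impI)
            fix i j assume ij: "i \<in> {..<n+m}" "j \<in> {..<n+m}" "i \<noteq> j"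
            have cross: "{u k<..<w k} \<inter> {u' l<..<w' l} = {}" if "k < n" "l < m" for k l
              using n(1)[rule_format, OF that(1)] m(1)[rule_format, OF that(2)] by fastforce
            consider "i < n \<and> j < n" | "i < n \<and> \<not> j < n" | "\<not> i < n \<and> j < n" | "\<not> i < n \<and> \<not> j < n" by blast
            then show "{u'' i<..<w'' i} \<inter> {u'' j<..<w'' j} = {}"
            proof cases
              case 1 then show ?thesis using n(2) ij unfolding disjoint_family_on_def u''_def w''_def by auto
            next
              case 2 then show ?thesis using cross[of i "j - n"] ij unfolding u''_def w''_def by auto
            next
              case 3
              then have "{u j<..<w j} \<inter> {u' (i - n)<..<w' (i - n)} = {}" using ij by (intro cross) auto
              then show ?thesis using 3 by (simp add: u''_def w''_def Int_commute)
            next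
              case 4
              then have "i - n \<in> {..<m}" "j - n \<in> {..<m}" "i - n \<noteq> j - n" using ij by auto
              then have "{u' (i-n)<..<w' (i-n)} \<inter> {u' (j-n)<..<w' (j-n)} = {}"
                using m(2) unfolding disjoint_family_on_def by blast
              then show ?thesis using 4 unfolding u''_def w''_def by auto
            qed
          qed
          have "(\<Sum>i<n+m. \<bar>D (w'' i) - D (u'' i)\<bar>) = (\<Sum>i<n. \<bar>D (w'' i) - D (u'' i)\<bar>) + (\<Sum>i<m. \<bar>D (w'' (n + i)) - D (u'' (n + i))\<bar>)"
            by (induction m) auto
          also have "\<dots> = (\<Sum>i<n. \<bar>D (w i) - D (u i)\<bar>) + (\<Sum>i<m. \<bar>D (w' i) - D (u' i)\<bar>)"
            by (simp add: u''_def w''_def)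
          finally show "\<bar>D z - D x\<bar> \<le> e * (z - x) + (\<Sum>i<n+m. \<bar>D (w'' i) - D (u'' i)\<bar>)"
            using n(3) m(3) by (simp add: algebra_simps)
        qed
      qed
    next
      fix x assume x: "a \<le> x" "x \<le> b"
      show "\<exists>d>0. \<forall>y z. y \<le> x \<and> x \<le> z \<and> z - y < d \<longrightarrow> P y z"
      proof (cases "x \<in> N")
        case True
        \<comment> \<open>Around a bad point the whole interval is a single piece inside
          \<open>U\<close>.\<close>
        then obtain r where r: "r > 0" "ball x r \<subseteq> U" using U openE by blast
        show ?thesis
        proof (intro exI[of _ r] conjI allI impI)
          fix y z assume yz: "y \<le> x \<and> x \<le> z \<and> z - y < r"
          have "{y<..<z} \<subseteq> ball x r" using yz by (auto simp: dist_real_def)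
          then show "P y z" unfolding P_def using r yz e
            by - (intro impI, rule exI[of _ "1::nat"], rule exI[of _ "\<lambda>_. y"], rule exI[of _ "\<lambda>_. z"], auto simp: disjoint_family_on_def lessThan_Suc)
        qed (fact r)
      next
        case False
        then have "(D has_real_derivative 0) (at x within {a..b})" using der x by auto
        then obtain r where r: "r > 0" "\<And>y. y \<in> {a..b} \<Longrightarrow> 0 < dist y x \<Longrightarrow> dist y x < r \<Longrightarrow> \<bar>(D y - D x) / (y - x)\<bar> < e"
          unfolding has_field_derivative_iff Lim_within using e by (metis dist_0_norm dist_commute real_norm_def)
        have r': "\<bar>D y - D x\<bar> \<le> e * \<bar>y - x\<bar>" if "y \<in> {a..b}" "\<bar>y - x\<bar> < r" for y
        proof (cases "y = x")
          case False
          then have "\<bar>(D y - D x) / (y - x)\<bar> < e" using r(2)[of y] that by (simp add: dist_real_def)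
          then show ?thesis using False by (simp add: field_simps)
        qed simp
        show ?thesis
        proof (intro exI[of _ r] conjI allI impI)
          fix y z assume yz: "y \<le> x \<and> x \<le> z \<and> z - y < r"
          have "\<bar>D z - D y\<bar> \<le> e * (z - y)" if "a \<le> y" "z \<le> b"
          proof -
            have "\<bar>D y - D x\<bar> \<le> e * (x - y)" using r'[of y] yz that x by auto
            moreover have "\<bar>D z - D x\<bar> \<le> e * (z - x)" using r'[of z] yz that x by auto
            ultimately have "\<bar>D z - D y\<bar> \<le> e * (x - y) + e * (z - x)" by linarith
            then show ?thesis by (simp add: algebra_simps)
          qed
          then show "P y z" unfolding P_def
            by - (intro impI, rule exI[of _ "0::nat"], rule exI[of _ "\<lambda>_. y"], rule exI[of _ "\<lambda>_. z"], auto simp: disjoint_family_on_def)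
        qed (fact r)
      qed
    qed
    then obtain n :: nat and u w where n: "\<forall>i<n. a \<le> u i \<and> u i \<le> w i \<and> w i \<le> b \<and> {u i<..<w i} \<subseteq> U"
            "disjoint_family_on (\<lambda>i. {u i<..<w i}) {..<n}" "\<bar>D b - D a\<bar> \<le> e * (b - a) + (\<Sum>i<n. \<bar>D (w i) - D (u i)\<bar>)"
      using ab unfolding P_def by auto
    \<comment> \<open>Disjointness bounds the total length of the pieces by the measure of
      \<open>U\<close>, so absolute continuity makes their total increment less than
      \<open>e\<close>.\<close>
    have "ennreal (\<Sum>i<n. w i - u i) = (\<Sum>i<n. emeasure lborel {u i<..<w i})"
      using n(1) by (subst sum_ennreal[symmetric]) (auto intro!: sum.cong)
    also have "\<dots> = emeasure lborel (\<Union>i<n. {u i<..<w i})"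
      by (rule sum_emeasure) (use n(2) in auto)
    also have "\<dots> \<le> emeasure lborel U" by (rule emeasure_mono) (use n(1) U(1) in \<open>auto intro: borel_open\<close>)
    also have "\<dots> < ennreal d" by fact
    finally have *: "ennreal (\<Sum>i<n. w i - u i) < ennreal d" .
    have "(\<Sum>i<n. w i - u i) < d"
    proof -
      have "0 \<le> (\<Sum>i<n. w i - u i)" by (rule sum_nonneg) (use n(1) in auto)
      then show ?thesis using * ennreal_less_iff by blast
    qed
    then have "(\<Sum>i<n. \<bar>D (w i) - D (u i)\<bar>) < e" by (intro d(2)) (use n in auto)
    then show ?thesis using n(3) by simp
  qed
  have "\<bar>D b - D a\<bar> \<le> 0 + e" if "e > 0" for e
  proof -
    have "e / (b - a + 1) * (b - a) + e / (b - a + 1) = e / (b - a + 1) * (b - a + 1)" by (simp only: distrib_left mult_1_right)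
    also have "\<dots> = e" using ab by simp
    finally show ?thesis using small[of "e / (b - a + 1)"] that ab by simp
  qed
  then have "\<bar>D b - D a\<bar> \<le> 0" by (rule field_le_epsilon)
  then show ?thesis by simp
qed

lemma abs_continuous_imp_integral:
  assumes ac: "abs_continuous_on 0 T v" and g: "bdd_measurable T g"
    and der: "AE t in lebesgue_on {0..T}. (v has_real_derivative g t) (at t within {0..T})"
    and t: "t \<in> {0..T}"
  shows "v t = v 0 + integral {0..t} g"
proof -
  let ?G = "\<lambda>t. integral {0..t} g"
  obtain K where K: "K-lipschitz_on {0..T} ?G" using integral_lipschitz[OF g] by blast
  let ?D = "\<lambda>t. v t - ?G t"
  have acD: "abs_continuous_on 0 T ?D"
    by (intro abs_continuous_on_diff ac lipschitz_imp_abs_continuous[OF K])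
  then have acD': "abs_continuous_on 0 t ?D"
    unfolding abs_continuous_on_def using t by (smt (verit) atLeastAtMost_iff)
  have "AE x in lebesgue_on {0..T}. (?D has_real_derivative 0) (at x within {0..T})"
    using der integral_has_derivative_AE[OF g]
  proof eventually_elim
    case (elim x)
    then show ?case using DERIV_diff[OF elim] by simp
  qed
  then have "AE x in lebesgue. x \<in> {0..T} \<longrightarrow> (?D has_real_derivative 0) (at x within {0..T})"
    by (subst (asm) AE_restrict_space_iff) auto
  then obtain N where N: "N \<in> null_sets lebesgue" "{x. \<not> (x \<in> {0..T} \<longrightarrow> (?D has_real_derivative 0) (at x within {0..T}))} \<subseteq> N"
    unfolding eventually_ae_filter by auto
  have "?D t = ?D 0"
  proof (rule abs_continuous_zero_derivative[OF acD'])
    show "negligible N" using N by (simp add: negligible_iff_null_sets)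
    fix x assume "x \<in> {0..t} - N"
    then have "(?D has_real_derivative 0) (at x within {0..T})" using N(2) t by auto
    then show "(?D has_real_derivative 0) (at x within {0..t})"
      by (rule has_field_derivative_subset) (use t in auto)
  qed (use t in auto)
  then show ?thesis by simp
qed

section \<open>The Abel equation and its first return map\<close>

text \<open>Absolute continuity with a bounded derivative almost everywhere, in integrated form.
  Sums, products and powers can then be handled without exceptional sets.\<close>

definition primitive_on :: "real \<Rightarrow> (real \<Rightarrow> real) \<Rightarrow> (real \<Rightarrow> real) \<Rightarrow> bool"
  where "primitive_on T F f \<longleftrightarrow> bdd_measurable T f \<and> (\<forall>t\<in>{0..T}. F t = F 0 + integral {0..t} f)"

lemma primitive_onD:
  assumes "primitive_on T F f"
  shows "bdd_measurable T f" "t \<in> {0..T} \<Longrightarrow> integral {0..t} f = F t - F 0"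
proof -
  show "bdd_measurable T f" using assms unfolding primitive_on_def by blast
  assume "t \<in> {0..T}"
  then have "F t = F 0 + integral {0..t} f" using assms unfolding primitive_on_def by blast
  then show "integral {0..t} f = F t - F 0" by linarith
qed

lemma primitive_onI:
  assumes "bdd_measurable T f" "\<And>t. t \<in> {0..T} \<Longrightarrow> F t = F 0 + integral {0..t} f"
  shows "primitive_on T F f"
  using assms unfolding primitive_on_def by blast

lemma primitive_on_lipschitz:
  assumes "primitive_on T F f"
  obtains K where "K-lipschitz_on {0..T} F"
proof -
  obtain K where K: "K-lipschitz_on {0..T} (\<lambda>t. integral {0..t} f)"
    using assms integral_lipschitz unfolding primitive_on_def by blast
  have "K-lipschitz_on {0..T} F"
  proof (rule lipschitz_onI)
    fix s t assume "s \<in> {0..T}" "t \<in> {0..T}"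
    then show "dist (F s) (F t) \<le> K * dist s t"
      using lipschitz_onD[OF K, of s t] assms unfolding primitive_on_def dist_real_def
      by (metis add_diff_cancel_left)
  qed (use K lipschitz_on_nonneg in blast)
  then show ?thesis using that by blast
qed

lemma primitive_on_continuous: "primitive_on T F f \<Longrightarrow> continuous_on {0..T} F"
  by (metis lipschitz_on_continuous_on primitive_on_lipschitz)

lemma primitive_on_cong:
  assumes "primitive_on T F f" "\<And>t. t \<in> {0..T} \<Longrightarrow> F t = G t" "\<And>t. t \<in> {0..T} \<Longrightarrow> f t = g t"
  shows "primitive_on T G g"
proof -
  have "integral {0..t} f = integral {0..t} g" if "t \<in> {0..T}" for t
    by (rule integral_cong) (use that assms(3) in auto)
  moreover have "f \<in> borel_measurable (lebesgue_on {0..T}) \<longleftrightarrow> g \<in> borel_measurable (lebesgue_on {0..T})"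
    by (rule measurable_cong) (use assms(3) in auto)
  moreover have "f ` {0..T} = g ` {0..T}" using assms(3) by (rule image_cong[OF refl])
  ultimately show ?thesis
    using assms(1,2) unfolding primitive_on_def bdd_measurable_def by (metis atLeastAtMost_iff order_refl order_trans)
qed

lemma primitive_on_const: "primitive_on T (\<lambda>_. c) (\<lambda>_. 0)"
  by (auto simp: primitive_on_def intro!: bdd_measurable_continuous)

lemma primitive_on_add:
  assumes "primitive_on T F f" "primitive_on T G g"
  shows "primitive_on T (\<lambda>t. F t + G t) (\<lambda>t. f t + g t)"
proof -
  note b = primitive_onD(1)[OF assms(1)] primitive_onD(1)[OF assms(2)]
  have "integral {0..t} (\<lambda>t. f t + g t) = integral {0..t} f + integral {0..t} g" if "t \<in> {0..T}" for t
    using that by (intro Henstock_Kurzweil_Integration.integral_add bdd_measurable_integrable[OF b(1)] bdd_measurable_integrable[OF b(2)]) auto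
  then show ?thesis
    by (intro primitive_onI bdd_measurable_add b) (simp add: primitive_onD(2)[OF assms(1)] primitive_onD(2)[OF assms(2)])
qed

lemma stieltjes_diff_primitive:
  assumes F: "primitive_on T F f" and g: "continuous_on {0..T} g"
  shows "stieltjes_diff {0..T} (\<lambda>t. integral {0..t} (\<lambda>u. f u * g u)) g F"
proof -
  have "stieltjes_diff {0..T} (\<lambda>t. integral {0..t} (\<lambda>u. f u * g u)) g (\<lambda>t. F t - F 0)"
    by (rule stieltjes_diff_cong[OF stieltjes_diff_integral[OF primitive_onD(1)[OF F] g]])
      (simp_all add: primitive_onD(2)[OF F])
  then show ?thesis by (simp add: stieltjes_diff_def)
qed

text \<open>In the increment of the product, what remains after the two first-order terms is
  \<open>(F t - F s) * (G t - G s)\<close>, which is quadratic in \<open>t - s\<close> because both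
  factors are Lipschitz.\<close>

lemma primitive_on_mult:
  assumes F: "primitive_on T F f" and G: "primitive_on T G g"
  shows "primitive_on T (\<lambda>t. F t * G t) (\<lambda>t. f t * G t + g t * F t)"
proof -
  have cF: "continuous_on {0..T} F" and cG: "continuous_on {0..T} G" using assms primitive_on_continuous by auto
  have b1: "bdd_measurable T (\<lambda>t. f t * G t)" and b2: "bdd_measurable T (\<lambda>t. g t * F t)"
    by (intro bdd_measurable_mult[OF _ bdd_measurable_continuous] cF cG primitive_onD(1)[OF F] primitive_onD(1)[OF G])+
  obtain K where K: "K-lipschitz_on {0..T} F" using F by (rule primitive_on_lipschitz)
  obtain L where L: "L-lipschitz_on {0..T} G" using G by (rule primitive_on_lipschitz)
  let ?A = "\<lambda>t. integral {0..t} (\<lambda>u. f u * G u)" and ?B = "\<lambda>t. integral {0..t} (\<lambda>u. g u * F u)"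
  have KL: "K \<ge> 0" "L \<ge> 0" using K L lipschitz_on_nonneg by auto
  have const: "F s * G s - ?A s - ?B s = F t * G t - ?A t - ?B t" if "s \<in> {0..T}" "t \<in> {0..T}" for s t
  proof (rule small_increments_imp_const[OF _ that])
    fix e :: real assume e: "e > 0"
    then have e4: "e/4 > 0" by simp
    obtain d1 where d1: "d1 > 0" "\<And>s t. \<lbrakk>s \<in> {0..T}; t \<in> {0..T}; \<bar>t - s\<bar> < d1\<rbrakk> \<Longrightarrow>
       \<bar>?A t - ?A s - G s * (F t - F s)\<bar> \<le> e/4 * \<bar>t - s\<bar>"
      using stieltjes_diffE[OF stieltjes_diff_primitive[OF F cG] e4] by blast
    obtain d2 where d2: "d2 > 0" "\<And>s t. \<lbrakk>s \<in> {0..T}; t \<in> {0..T}; \<bar>t - s\<bar> < d2\<rbrakk> \<Longrightarrow>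
       \<bar>?B t - ?B s - F s * (G t - G s)\<bar> \<le> e/4 * \<bar>t - s\<bar>"
      using stieltjes_diffE[OF stieltjes_diff_primitive[OF G cF] e4] by blast
    show "\<exists>d>0. \<forall>s\<in>{0..T}. \<forall>t\<in>{0..T}. \<bar>t - s\<bar> < d \<longrightarrow>
       \<bar>F t * G t - ?A t - ?B t - (F s * G s - ?A s - ?B s)\<bar> \<le> e * \<bar>t - s\<bar>"
    proof (intro exI[of _ "min d1 (min d2 (e / (4 * (K * L + 1))))"] conjI ballI impI)
      show "0 < min d1 (min d2 (e / (4 * (K * L + 1))))" using d1 d2 e KL by (auto intro!: divide_pos_pos add_nonneg_pos)
      fix s t assume st: "s \<in> {0..T}" "t \<in> {0..T}" "\<bar>t - s\<bar> < min d1 (min d2 (e / (4 * (K * L + 1))))"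
      have "\<bar>F t - F s\<bar> \<le> K * \<bar>t - s\<bar>" "\<bar>G t - G s\<bar> \<le> L * \<bar>t - s\<bar>"
        using lipschitz_onD[OF K, of t s] lipschitz_onD[OF L, of t s] st by (auto simp: dist_real_def)
      then have "\<bar>(F t - F s) * (G t - G s)\<bar> \<le> (K * \<bar>t - s\<bar>) * (L * \<bar>t - s\<bar>)"
        unfolding abs_mult using KL by (intro mult_mono) auto
      also have "\<dots> = (K * L * \<bar>t - s\<bar>) * \<bar>t - s\<bar>" by simp
      also have "\<dots> \<le> e/4 * \<bar>t - s\<bar>"
      proof (intro mult_right_mono)
        have "0 \<le> K * L" using KL by simp
        then have "K * L * \<bar>t - s\<bar> \<le> (K * L + 1) * (e / (4 * (K * L + 1)))"
          using st(3) by (intro mult_mono) auto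
        also have "\<dots> = e / 4" using \<open>0 \<le> K * L\<close> by (simp add: field_simps)
        finally show "K * L * \<bar>t - s\<bar> \<le> e / 4" .
      qed simp
      finally have 3: "\<bar>(F t - F s) * (G t - G s)\<bar> \<le> e/4 * \<bar>t - s\<bar>" .
      have eq: "F t * G t - ?A t - ?B t - (F s * G s - ?A s - ?B s) =
        (F t - F s) * (G t - G s) - (?A t - ?A s - G s * (F t - F s)) - (?B t - ?B s - F s * (G t - G s))"
        by (simp add: algebra_simps)
      have "\<bar>F t * G t - ?A t - ?B t - (F s * G s - ?A s - ?B s)\<bar> \<le> e/4 * \<bar>t - s\<bar> + e/4 * \<bar>t - s\<bar> + e/4 * \<bar>t - s\<bar>"
      proof -
        have "\<bar>?A t - ?A s - G s * (F t - F s)\<bar> \<le> e/4 * \<bar>t - s\<bar>" "\<bar>?B t - ?B s - F s * (G t - G s)\<bar> \<le> e/4 * \<bar>t - s\<bar>"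
          using d1(2)[of s t] d2(2)[of s t] st by auto
        then show ?thesis unfolding eq using 3 by linarith
      qed
      also have "\<dots> \<le> e * \<bar>t - s\<bar>" using e by (simp add: algebra_simps)
      finally show "\<bar>F t * G t - ?A t - ?B t - (F s * G s - ?A s - ?B s)\<bar> \<le> e * \<bar>t - s\<bar>" .
    qed
  qed
  show ?thesis unfolding primitive_on_def
  proof (intro conjI ballI bdd_measurable_add b1 b2)
    fix t assume t: "t \<in> {0..T}"
    have "integral {0..t} (\<lambda>t. f t * G t + g t * F t) = ?A t + ?B t"
      using t by (intro Henstock_Kurzweil_Integration.integral_add bdd_measurable_integrable[OF b1] bdd_measurable_integrable[OF b2]) auto
    then show "F t * G t = F 0 * G 0 + integral {0..t} (\<lambda>t. f t * G t + g t * F t)"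
      using const[of 0 t] t by simp
  qed
qed

lemma primitive_on_power:
  assumes F: "primitive_on T F f"
  shows "primitive_on T (\<lambda>t. F t ^ n) (\<lambda>t. real n * F t ^ (n - 1) * f t)"
proof (induction n)
  case 0
  then show ?case using primitive_on_const[of T 1] by simp
next
  case (Suc n)
  show ?case
    by (rule primitive_on_cong[OF primitive_on_mult[OF F Suc]])
      (auto simp: algebra_simps, cases n, auto simp: algebra_simps)
qed

section \<open>The Abel equation as an integral equation\<close>

definition abel_rhs :: "coeff_pair \<Rightarrow> (real \<Rightarrow> real) \<Rightarrow> real \<Rightarrow> real"
  where "abel_rhs a v t = fst a t * v t ^ 2 + snd a t * v t ^ 3"

lemma abel_coeffs_bdd_measurable: "a \<in> abel_coeffs T \<longleftrightarrow> bdd_measurable T (fst a) \<and> bdd_measurable T (snd a)"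
  by (auto simp: abel_coeffs_def bdd_measurable_def)

lemma bdd_measurable_abel_rhs:
  assumes "a \<in> abel_coeffs T" "continuous_on {0..T} v"
  shows "bdd_measurable T (abel_rhs a v)"
proof -
  have "bdd_measurable T (fst a)" "bdd_measurable T (snd a)"
    using assms(1) by (auto simp: abel_coeffs_bdd_measurable)
  then show ?thesis unfolding abel_rhs_def
    by (intro bdd_measurable_add bdd_measurable_mult[OF _ bdd_measurable_continuous] continuous_intros assms(2))
qed

text \<open>Absolute continuity recovers a solution from its derivative; conversely an indefinite
  integral of a bounded function is Lipschitz and differentiable almost everywhere.\<close>

lemma abel_solution_iff_primitive_on:
  assumes a: "a \<in> abel_coeffs T"
  shows "abel_solution T a v \<longleftrightarrow> primitive_on T v (abel_rhs a v)"
proof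
  assume s: "abel_solution T a v"
  then have ac: "abs_continuous_on 0 T v" by (simp add: abel_solution_def)
  have b: "bdd_measurable T (abel_rhs a v)"
    by (rule bdd_measurable_abel_rhs[OF a abs_continuous_on_imp_continuous[OF ac]])
  show "primitive_on T v (abel_rhs a v)" unfolding primitive_on_def
    using s by (auto intro!: b abs_continuous_imp_integral[OF ac b] simp: abel_solution_def abel_rhs_def)
next
  assume p: "primitive_on T v (abel_rhs a v)"
  then have b: "bdd_measurable T (abel_rhs a v)" by (simp add: primitive_on_def)
  have "AE t in lebesgue_on {0..T}. t \<in> {0..T}" by (rule AE_I2) simp
  with integral_has_derivative_AE[OF b]
  have "AE t in lebesgue_on {0..T}. (v has_real_derivative abel_rhs a v t) (at t within {0..T})"
  proof eventually_elim
    case (elim t)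
    have "((\<lambda>t. v 0 + integral {0..t} (abel_rhs a v)) has_real_derivative 0 + abel_rhs a v t) (at t within {0..T})"
      by (intro DERIV_add DERIV_const elim)
    then show ?case
      by (rule has_field_derivative_transform_within[where d=1, THEN DERIV_cong]) (use elim in \<open>simp_all add: primitive_onD(2)[OF p]\<close>)
  qed
  then show "abel_solution T a v" unfolding abel_solution_def
    using primitive_on_lipschitz[OF p] lipschitz_imp_abs_continuous by (auto simp: abel_rhs_def) metis
qed

section \<open>Uniqueness of solutions, and existence for small initial values\<close>

text \<open>Gronwall with zero initial term: feeding the inequality into itself \<open>n\<close>
  times bounds the function by \<open>B (M t)^n / n!\<close>, which tends to 0.\<close>

lemma integral_inequality_zero:
  fixes \<delta> :: "real \<Rightarrow> real"
  assumes cont: "continuous_on {0..T} \<delta>" and nn: "\<And>t. t \<in> {0..T} \<Longrightarrow> 0 \<le> \<delta> t"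
    and le: "\<And>t. t \<in> {0..T} \<Longrightarrow> \<delta> t \<le> M * integral {0..t} \<delta>" and M: "M \<ge> 0" and t: "t \<in> {0..T}"
  shows "\<delta> t = 0"
proof -
  obtain B where B: "\<And>t. t \<in> {0..T} \<Longrightarrow> \<delta> t \<le> B"
    using bounded_imp_bdd_above[OF compact_imp_bounded[OF compact_continuous_image[OF cont compact_Icc]]]
    unfolding bdd_above_def by blast
  have bound: "\<delta> t \<le> B * (M * t) ^ n / fact n" if "t \<in> {0..T}" for t n
    using that
  proof (induction n arbitrary: t)
    case 0
    then show ?case using B by simp
  next
    case (Suc n)
    have 1: "((\<lambda>u. B * (M * u) ^ n / fact n) has_integral (B * M ^ n * t ^ Suc n / fact (Suc n) - B * M ^ n * 0 ^ Suc n / fact (Suc n))) {0..t}"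
    proof (rule fundamental_theorem_of_calculus)
      fix x assume "x \<in> {0..t}"
      have "((\<lambda>u. B * M ^ n * u ^ Suc n / fact (Suc n)) has_real_derivative B * M ^ n * (real (Suc n) * x ^ n) / fact (Suc n)) (at x within {0..t})"
        by (intro DERIV_cdivide DERIV_cmult) (use DERIV_pow[of "Suc n" x "{0..t}"] in simp)
      moreover have "B * M ^ n * (real (Suc n) * x ^ n) / fact (Suc n) = B * (M * x) ^ n / fact n"
      proof -
        have "B * M ^ n * (real (Suc n) * x ^ n) / fact (Suc n) = (real (Suc n) * (B * (M ^ n * x ^ n))) / (real (Suc n) * fact n)"
          by (simp add: mult_ac)
        also have "\<dots> = B * (M ^ n * x ^ n) / fact n" by (rule mult_divide_mult_cancel_left) simp
        finally show ?thesis by (simp add: power_mult_distrib)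
      qed
      ultimately show "((\<lambda>u. B * M ^ n * u ^ Suc n / fact (Suc n)) has_vector_derivative B * (M * x) ^ n / fact n) (at x within {0..t})"
        by (simp only: has_real_derivative_iff_has_vector_derivative)
    qed (use Suc.prems in auto)
    have 2: "(\<delta> has_integral integral {0..t} \<delta>) {0..t}"
      using Suc.prems by (intro integrable_integral integrable_continuous_real continuous_on_subset[OF cont]) auto
    have "integral {0..t} \<delta> \<le> B * M ^ n * t ^ Suc n / fact (Suc n) - B * M ^ n * 0 ^ Suc n / fact (Suc n)"
      by (rule has_integral_le[OF 2 1]) (use Suc in auto)
    then have "M * integral {0..t} \<delta> \<le> M * (B * M ^ n * t ^ Suc n / fact (Suc n))"
      by (intro mult_left_mono M) simp
    then show ?case using le[OF Suc.prems] by (simp add: power_mult_distrib algebra_simps)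
  qed
  have "(\<lambda>n. B * ((M * t) ^ n / fact n)) \<longlonglongrightarrow> B * 0"
  proof (intro tendsto_mult_left)
    have "summable (\<lambda>n. (M * t) ^ n / fact n)" using summable_exp[of "M * t"] by (simp add: field_simps)
    then show "(\<lambda>n. (M * t) ^ n / fact n) \<longlonglongrightarrow> 0" by (rule summable_LIMSEQ_zero)
  qed
  then have "\<delta> t \<le> B * 0" by (rule LIMSEQ_le_const) (use bound[OF t] in auto)
  then show ?thesis using nn[OF t] by simp
qed

lemma abel_solution_unique:
  assumes a: "a \<in> abel_coeffs T" and v: "abel_solution T a v" and w: "abel_solution T a w" and "v 0 = w 0"
    and t: "t \<in> {0..T}"
  shows "v t = w t"
proof -
  note pv = v[unfolded abel_solution_iff_primitive_on[OF a]] and pw = w[unfolded abel_solution_iff_primitive_on[OF a]]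
  note cv = primitive_on_continuous[OF pv] and cw = primitive_on_continuous[OF pw]
  obtain K1 K2 where K12: "K1 > 0" "\<And>t. t \<in> {0..T} \<Longrightarrow> \<bar>fst a t\<bar> \<le> K1" "K2 > 0" "\<And>t. t \<in> {0..T} \<Longrightarrow> \<bar>snd a t\<bar> \<le> K2"
    by (metis a abel_coeffs_bdd_measurable bdd_measurableE)
  obtain B1 B2 where B12: "B1 > 0" "\<And>t. t \<in> {0..T} \<Longrightarrow> \<bar>v t\<bar> \<le> B1" "B2 > 0" "\<And>t. t \<in> {0..T} \<Longrightarrow> \<bar>w t\<bar> \<le> B2"
    by (metis bdd_measurable_continuous bdd_measurableE cv cw)
  define B where "B = max B1 B2"
  have B: "B > 0" "\<And>t. t \<in> {0..T} \<Longrightarrow> \<bar>v t\<bar> \<le> B" "\<And>t. t \<in> {0..T} \<Longrightarrow> \<bar>w t\<bar> \<le> B" using B12 by (fastforce simp: B_def)+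
  \<comment> \<open>The right-hand sides differ by \<open>v - w\<close> times
    \<open>a1 (v + w) + a2 (v^2 + v w + w^2)\<close>; \<open>M\<close> bounds the second factor as
    long as both solutions stay within \<open>B\<close>.\<close>
  define M where "M = K1 * (2 * B) + K2 * (3 * B^2)"
  have M: "M \<ge> 0" using K12 B by (auto simp: M_def intro!: add_nonneg_nonneg mult_nonneg_nonneg)
  have lip: "\<bar>abel_rhs a v u - abel_rhs a w u\<bar> \<le> M * \<bar>v u - w u\<bar>" if u: "u \<in> {0..T}" for u
  proof -
    have 1: "\<bar>v u + w u\<bar> \<le> 2 * B" using B(2,3)[OF u] by linarith
    have "\<bar>v u * v u + v u * w u + w u * w u\<bar> \<le> \<bar>v u\<bar> * \<bar>v u\<bar> + \<bar>v u\<bar> * \<bar>w u\<bar> + \<bar>w u\<bar> * \<bar>w u\<bar>"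
      unfolding abs_mult[symmetric] by linarith
    also have "\<dots> \<le> B * B + B * B + B * B" using B(1) B(2,3)[OF u] by (intro add_mono mult_mono) auto
    finally have 2: "\<bar>v u * v u + v u * w u + w u * w u\<bar> \<le> 3 * B^2" by (simp add: power2_eq_square)
    have "abel_rhs a v u - abel_rhs a w u = (fst a u * (v u + w u) + snd a u * (v u * v u + v u * w u + w u * w u)) * (v u - w u)"
      by (simp add: abel_rhs_def power2_eq_square power3_eq_cube algebra_simps)
    also have "\<bar>\<dots>\<bar> \<le> M * \<bar>v u - w u\<bar>" unfolding abs_mult[of _ "v u - w u"] M_def
    proof (intro mult_right_mono)
      have "\<bar>fst a u * (v u + w u)\<bar> \<le> K1 * (2 * B)" unfolding abs_mult using K12 1 u by (intro mult_mono) auto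
      moreover have "\<bar>snd a u * (v u * v u + v u * w u + w u * w u)\<bar> \<le> K2 * (3 * B^2)"
        unfolding abs_mult[of "snd a u"] using K12 2 u by (intro mult_mono) auto
      ultimately show "\<bar>fst a u * (v u + w u) + snd a u * (v u * v u + v u * w u + w u * w u)\<bar> \<le> K1 * (2 * B) + K2 * (3 * B^2)"
        by linarith
    qed simp
    finally show ?thesis .
  qed
  have "\<bar>v t - w t\<bar> = 0"
  proof (rule integral_inequality_zero[where \<delta> = "\<lambda>t. \<bar>v t - w t\<bar>" and M = M and T = T])
    show "continuous_on {0..T} (\<lambda>t. \<bar>v t - w t\<bar>)" by (intro continuous_intros cv cw)
    fix t assume t: "t \<in> {0..T}"
    have iv: "abel_rhs a v integrable_on {0..t}" "abel_rhs a w integrable_on {0..t}"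
      using t by (auto intro!: bdd_measurable_integrable[OF primitive_onD(1)[OF pv]] bdd_measurable_integrable[OF primitive_onD(1)[OF pw]])
    have i: "(\<lambda>u. M * \<bar>v u - w u\<bar>) integrable_on {0..t}"
      using t by (intro integrable_continuous_real continuous_intros continuous_on_subset[OF cv] continuous_on_subset[OF cw]) auto
    have "v t - w t = integral {0..t} (\<lambda>u. abel_rhs a v u - abel_rhs a w u)"
      using primitive_onD(2)[OF pv t] primitive_onD(2)[OF pw t] assms(4)
      by (subst Henstock_Kurzweil_Integration.integral_diff[OF iv]) simp
    also have "norm \<dots> \<le> integral {0..t} (\<lambda>u. M * \<bar>v u - w u\<bar>)"
      by (rule integral_norm_bound_integral[OF integrable_diff[OF iv] i]) (use lip t in auto)
    finally show "\<bar>v t - w t\<bar> \<le> M * integral {0..t} (\<lambda>u. \<bar>v u - w u\<bar>)" by simp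
  qed (use t M in auto)
  then show ?thesis by simp
qed

text \<open>The Picard operator contracts the ball of radius \<open>2 |r|\<close> in the space of
  bounded continuous functions. The bound \<open>2 |r|\<close> is recorded because the convergence
  of the return series is estimated with it.\<close>

lemma abel_solution_exists:
  assumes a: "a \<in> abel_coeffs T" and T: "T > 0"
  obtains \<rho> where "\<rho> > 0" "\<rho> \<le> 1"
    "\<And>r. \<bar>r\<bar> < \<rho> \<Longrightarrow> \<exists>v. abel_solution T a v \<and> v 0 = r \<and> (\<forall>t\<in>{0..T}. \<bar>v t\<bar> \<le> 2 * \<bar>r\<bar>)"
proof -
  obtain K1 K2 where K12: "K1 > 0" "\<And>t. t \<in> {0..T} \<Longrightarrow> \<bar>fst a t\<bar> \<le> K1" "K2 > 0" "\<And>t. t \<in> {0..T} \<Longrightarrow> \<bar>snd a t\<bar> \<le> K2"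
    by (metis a abel_coeffs_bdd_measurable bdd_measurableE)
  define K where "K = max K1 K2"
  have K: "K > 0" "\<And>t. t \<in> {0..T} \<Longrightarrow> \<bar>fst a t\<bar> \<le> K" "\<And>t. t \<in> {0..T} \<Longrightarrow> \<bar>snd a t\<bar> \<le> K"
    using K12 by (fastforce simp: K_def)+
  \<comment> \<open>The ball is mapped into itself when \<open>12 K T \<rho> \<le> 1\<close>, and
    distances are halved when \<open>16 K T \<rho> \<le> 1/2\<close>; 32 serves both. The summand 1
    gives \<open>\<rho> \<le> 1\<close>, so that cubes of \<open>|r|\<close> are bounded by
    squares.\<close>
  define \<rho> where "\<rho> = 1 / (32 * (K * T + 1))"
  have KT: "K * T > 0" using K T by simp
  have \<rho>: "\<rho> > 0" "\<rho> \<le> 1" "32 * (K * T) * \<rho> \<le> 1" using KT by (auto simp: \<rho>_def field_simps)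
  \<comment> \<open>Clamping the time makes every Picard iterate a function on the whole line, where
    the bounded continuous functions form a complete space.\<close>
  define c where "c t = max 0 (min T t)" for t
  have cT: "c t \<in> {0..T}" for t using T by (auto simp: c_def)
  have c_id: "c t = t" if "t \<in> {0..T}" for t using that by (auto simp: c_def)
  have cc: "continuous_on UNIV c" unfolding c_def by (intro continuous_intros)
  have "\<exists>v. abel_solution T a v \<and> v 0 = r \<and> (\<forall>t\<in>{0..T}. \<bar>v t\<bar> \<le> 2 * \<bar>r\<bar>)" if r: "\<bar>r\<bar> < \<rho>" for r
  proof -
    define S where "S = {f :: real \<Rightarrow>\<^sub>C real. \<forall>t. \<bar>apply_bcontfun f t\<bar> \<le> 2 * \<bar>r\<bar>}"
    have Seq: "S = PiC UNIV (\<lambda>_. {- (2 * \<bar>r\<bar>)..2 * \<bar>r\<bar>})"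
      by (simp add: set_eq_iff S_def mem_PiC_iff Pi_iff abs_le_iff) (metis minus_le_iff)
    have "closed S" unfolding Seq by (rule closed_PiC) simp
    then have cS: "complete S" by (simp add: complete_eq_closed)
    have S0: "S \<noteq> {}" by (auto simp: S_def intro!: exI[of _ 0])
    define \<Phi> where "\<Phi> f t = r + integral {0..c t} (abel_rhs a f)" for f t
    have bm: "bdd_measurable T (abel_rhs a (apply_bcontfun f))" for f :: "real \<Rightarrow>\<^sub>C real"
      by (rule bdd_measurable_abel_rhs[OF a]) (rule continuous_on_subset[OF _ subset_UNIV], rule continuous_on_apply_bcontfun)
    have int: "abel_rhs a (apply_bcontfun f) integrable_on {0..c t}" for f :: "real \<Rightarrow>\<^sub>C real" and t
      using cT[of t] by (intro bdd_measurable_integrable[OF bm]) auto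
    have \<Phi>c: "\<Phi> (apply_bcontfun f) \<in> bcontfun" for f :: "real \<Rightarrow>\<^sub>C real"
    proof -
      have G: "continuous_on {0..T} (\<lambda>t. integral {0..t} (abel_rhs a f))" by (rule integral_continuous_bdd[OF bm])
      have cont: "continuous_on UNIV (\<Phi> f)" unfolding \<Phi>_def
        by (intro continuous_intros continuous_on_compose2[OF G cc]) (use cT in auto)
      obtain B where B: "\<And>t. t \<in> {0..T} \<Longrightarrow> \<bar>integral {0..t} (abel_rhs a f)\<bar> \<le> B"
        by (metis bdd_measurable_continuous[OF G] bdd_measurableE)
      show ?thesis
        by (rule bcontfun_normI[OF cont, of "\<bar>r\<bar> + B"])
          (use B[OF cT] in \<open>auto simp: \<Phi>_def intro: order_trans[OF abs_triangle_ineq]\<close>)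
    qed
    have rr: "\<bar>r\<bar> \<le> 1" "\<bar>r\<bar>^2 \<le> \<rho> * \<bar>r\<bar>" 
    proof -
      have "\<bar>r\<bar> * \<bar>r\<bar> \<le> \<rho> * \<bar>r\<bar>" using r by (intro mult_right_mono) auto
      then show "\<bar>r\<bar>^2 \<le> \<rho> * \<bar>r\<bar>" by (simp only: power2_eq_square)
      show "\<bar>r\<bar> \<le> 1" using r \<rho> by linarith
    qed
    have maps: "Bcontfun (\<Phi> f) \<in> S" if "f \<in> S" for f
    proof -
      have "\<bar>\<Phi> f t\<bar> \<le> 2 * \<bar>r\<bar>" for t
      proof -
        have "\<bar>integral {0..c t} (abel_rhs a f)\<bar> \<le> K * (12 * \<bar>r\<bar>^2) * (c t - 0)"
        proof (rule integral_bound_real[OF int])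
          fix u assume u: "u \<in> {0..c t}"
          then have uT: "u \<in> {0..T}" using cT[of t] by auto
          have f: "\<bar>apply_bcontfun f u\<bar> \<le> 2 * \<bar>r\<bar>" using that by (simp add: S_def)
          have "\<bar>apply_bcontfun f u\<bar> ^ 2 \<le> (2 * \<bar>r\<bar>)^2" using f by (intro power_mono) auto
          then have 2: "\<bar>apply_bcontfun f u\<bar> ^ 2 \<le> 4 * \<bar>r\<bar>^2" by (simp add: power_mult_distrib)
          have "\<bar>apply_bcontfun f u\<bar> ^ 3 \<le> (2 * \<bar>r\<bar>)^3" using f by (intro power_mono) auto
          also have "\<dots> = 8 * \<bar>r\<bar>^2 * \<bar>r\<bar>" by (simp add: power3_eq_cube power2_eq_square)
          also have "\<dots> \<le> 8 * \<bar>r\<bar>^2 * 1" using rr by (intro mult_left_mono) auto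
          finally have 3: "\<bar>apply_bcontfun f u\<bar> ^ 3 \<le> 8 * \<bar>r\<bar>^2" by simp
          have "\<bar>abel_rhs a f u\<bar> \<le> \<bar>fst a u\<bar> * \<bar>apply_bcontfun f u\<bar>^2 + \<bar>snd a u\<bar> * \<bar>apply_bcontfun f u\<bar>^3"
            unfolding abel_rhs_def by (rule order_trans[OF abs_triangle_ineq]) (simp add: abs_mult power_abs)
          also have "\<dots> \<le> K * (4 * \<bar>r\<bar>^2) + K * (8 * \<bar>r\<bar>^2)"
            using K uT 2 3 by (intro add_mono mult_mono) auto
          finally show "\<bar>abel_rhs a f u\<bar> \<le> K * (12 * \<bar>r\<bar>^2)" by simp
        qed (use cT in auto)
        also have "\<dots> \<le> K * (12 * (\<rho> * \<bar>r\<bar>)) * T"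
          using rr K cT[of t] \<rho> by (intro mult_mono mult_left_mono) auto
        also have "\<dots> = (12 * (K * T) * \<rho>) * \<bar>r\<bar>" by simp
        also have "\<dots> \<le> 1 * \<bar>r\<bar>" using \<rho> KT by (intro mult_right_mono) (auto intro: order_trans[OF _ \<rho>(3)])
        finally show ?thesis unfolding \<Phi>_def by linarith
      qed
      then show ?thesis by (simp add: S_def Bcontfun_inverse[OF \<Phi>c])
    qed
    have contr: "dist (Bcontfun (\<Phi> f)) (Bcontfun (\<Phi> g)) \<le> 1/2 * dist f g" if fg: "f \<in> S" "g \<in> S" for f g
    proof (rule dist_bound)
      fix t
      have lip: "\<bar>abel_rhs a f u - abel_rhs a g u\<bar> \<le> K * (16 * \<rho>) * dist f g" if u: "u \<in> {0..c t}" for u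
      proof -
        have uT: "u \<in> {0..T}" using cT[of t] u by auto
        let ?v = "apply_bcontfun f u" and ?w = "apply_bcontfun g u"
        have B: "\<bar>?v\<bar> \<le> 2 * \<bar>r\<bar>" "\<bar>?w\<bar> \<le> 2 * \<bar>r\<bar>" using fg by (auto simp: S_def)
        then have 1: "\<bar>?v + ?w\<bar> \<le> 4 * \<rho>" using r by linarith
        have "\<bar>?v * ?v + ?v * ?w + ?w * ?w\<bar> \<le> \<bar>?v\<bar> * \<bar>?v\<bar> + \<bar>?v\<bar> * \<bar>?w\<bar> + \<bar>?w\<bar> * \<bar>?w\<bar>"
          unfolding abs_mult[symmetric] by linarith
        also have "\<dots> \<le> (2 * \<bar>r\<bar>) * (2 * \<bar>r\<bar>) + (2 * \<bar>r\<bar>) * (2 * \<bar>r\<bar>) + (2 * \<bar>r\<bar>) * (2 * \<bar>r\<bar>)"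
          using B by (intro add_mono mult_mono) auto
        also have "\<dots> = 12 * \<bar>r\<bar> * \<bar>r\<bar>" by simp
        also have "\<dots> \<le> 12 * \<bar>r\<bar> * 1" using rr by (intro mult_left_mono) auto
        finally have 2: "\<bar>?v * ?v + ?v * ?w + ?w * ?w\<bar> \<le> 12 * \<rho>" using r by simp
        have "abel_rhs a f u - abel_rhs a g u = (fst a u * (?v + ?w) + snd a u * (?v * ?v + ?v * ?w + ?w * ?w)) * (?v - ?w)"
          by (simp add: abel_rhs_def power2_eq_square power3_eq_cube algebra_simps)
        also have "\<bar>\<dots>\<bar> \<le> K * (16 * \<rho>) * dist f g" unfolding abs_mult[of _ "?v - ?w"]
        proof (intro mult_mono)
          have "\<bar>fst a u * (?v + ?w)\<bar> \<le> K * (4 * \<rho>)" unfolding abs_mult using K 1 uT by (intro mult_mono) auto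
          moreover have "\<bar>snd a u * (?v * ?v + ?v * ?w + ?w * ?w)\<bar> \<le> K * (12 * \<rho>)"
            unfolding abs_mult[of "snd a u"] using K 2 uT by (intro mult_mono) auto
          ultimately show "\<bar>fst a u * (?v + ?w) + snd a u * (?v * ?v + ?v * ?w + ?w * ?w)\<bar> \<le> K * (16 * \<rho>)"
            by linarith
          show "\<bar>?v - ?w\<bar> \<le> dist f g" using dist_bounded[of f u g] by (simp add: dist_real_def)
        qed (use K \<rho> in auto)
        finally show ?thesis .
      qed
      have "dist (\<Phi> f t) (\<Phi> g t) = \<bar>integral {0..c t} (\<lambda>u. abel_rhs a f u - abel_rhs a g u)\<bar>"
        unfolding \<Phi>_def dist_real_def by (subst Henstock_Kurzweil_Integration.integral_diff[OF int int]) simp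
      also have "\<dots> \<le> K * (16 * \<rho>) * dist f g * (c t - 0)"
        by (rule integral_bound_real[OF integrable_diff[OF int int]]) (use lip cT in auto)
      also have "\<dots> \<le> K * (16 * \<rho>) * dist f g * T" using cT[of t] K \<rho> by (intro mult_left_mono) auto
      also have "\<dots> = (16 * (K * T) * \<rho>) * dist f g" by simp
      also have "\<dots> \<le> 1/2 * dist f g" using \<rho>(3) by (intro mult_right_mono) auto
      finally show "dist (apply_bcontfun (Bcontfun (\<Phi> f)) t) (apply_bcontfun (Bcontfun (\<Phi> g)) t) \<le> 1/2 * dist f g"
        by (simp add: Bcontfun_inverse[OF \<Phi>c])
    qed
    have "\<exists>!f\<in>S. Bcontfun (\<Phi> f) = f"
      by (rule Banach_fix[OF cS S0, of "1/2"]) (use maps contr in auto)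
    then obtain f where f: "f \<in> S" "Bcontfun (\<Phi> f) = f" by blast
    have fp: "apply_bcontfun f t = \<Phi> f t" for t using f(2) Bcontfun_inverse[OF \<Phi>c, of f] by metis
    have f0: "apply_bcontfun f 0 = r" using fp[of 0] T by (simp add: \<Phi>_def c_def)
    have "primitive_on T (apply_bcontfun f) (abel_rhs a f)"
      by (rule primitive_onI[OF bm]) (metis fp f0 c_id \<Phi>_def)
    then show ?thesis using f(1) f0 unfolding abel_solution_iff_primitive_on[OF a, symmetric] S_def by auto
  qed
  then show ?thesis using \<rho> that by blast
qed

section \<open>The power series of the first return map\<close>

text \<open>\<open>flow_coeff T a n s\<close> is the coefficient of \<open>r\<^sup>n\<close> in the value at time \<open>T\<close> of the solution with
  value \<open>r\<close> at time \<open>s\<close>. As a function of \<open>(s, r)\<close> this value is constant along solutions, which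
  gives the recursion.\<close>

fun flow_coeff :: "real \<Rightarrow> coeff_pair \<Rightarrow> nat \<Rightarrow> real \<Rightarrow> real" where
  "flow_coeff T a 0 s = 0"
| "flow_coeff T a (Suc 0) s = 1"
| "flow_coeff T a (Suc (Suc n)) s = integral {s..T} (\<lambda>u.
     fst a u * (real (Suc n) * flow_coeff T a (Suc n) u) + snd a u * (real n * flow_coeff T a n u))"

fun flow_coeff_deriv :: "real \<Rightarrow> coeff_pair \<Rightarrow> nat \<Rightarrow> real \<Rightarrow> real" where
  "flow_coeff_deriv T a 0 s = 0"
| "flow_coeff_deriv T a (Suc 0) s = 0"
| "flow_coeff_deriv T a (Suc (Suc n)) s = -
     (fst a s * (real (Suc n) * flow_coeff T a (Suc n) s) + snd a s * (real n * flow_coeff T a n s))"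

lemma primitive_on_tail:
  assumes g: "bdd_measurable T g"
  shows "primitive_on T (\<lambda>s. integral {s..T} g) (\<lambda>s. - g s)"
proof (rule primitive_onI)
  show "bdd_measurable T (\<lambda>s. - g s)"
    using bdd_measurable_mult[OF bdd_measurable_continuous[of T "\<lambda>_. -1"] g] by simp
  fix t assume "t \<in> {0..T}"
  then have "integral {0..t} g + integral {t..T} g = integral {0..T} g"
    by (intro Henstock_Kurzweil_Integration.integral_combine bdd_measurable_integrable[OF g]) auto
  then show "integral {t..T} g = integral {0..T} g + integral {0..t} (\<lambda>s. - g s)" by simp
qed

lemma flow_coeff_primitive:
  assumes a: "a \<in> abel_coeffs T"
  shows "primitive_on T (flow_coeff T a n) (flow_coeff_deriv T a n)"
proof (induction n rule: less_induct)
  case (less n)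
  consider "n = 0" | "n = 1" | m where "n = Suc (Suc m)" by (metis One_nat_def not0_implies_Suc)
  then show ?case
  proof cases
    case 1 then show ?thesis using primitive_on_const[of T 0] primitive_on_cong by fastforce
  next
    case 2 then show ?thesis using primitive_on_const[of T 1] primitive_on_cong by fastforce
  next
    case 3
    have c: "continuous_on {0..T} (flow_coeff T a (Suc m))" "continuous_on {0..T} (flow_coeff T a m)"
      by (intro primitive_on_continuous[OF less.IH]; simp add: 3)+
    have "bdd_measurable T (fst a)" "bdd_measurable T (snd a)"
      using a by (auto simp: abel_coeffs_bdd_measurable)
    then have "bdd_measurable T (\<lambda>u. fst a u * (real (Suc m) * flow_coeff T a (Suc m) u) + snd a u * (real m * flow_coeff T a m u))"
      by (intro bdd_measurable_add bdd_measurable_mult[OF _ bdd_measurable_continuous] continuous_intros c)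
    from primitive_on_tail[OF this] show ?thesis unfolding 3 by (rule primitive_on_cong) simp_all
  qed
qed

text \<open>With \<open>q u = 1 + K (T - u)\<close>, each of the two terms of the recursion is at
  most \<open>K (m + 2) (2 q)^(m + 1)\<close>. Their sum is exactly minus the derivative of
  \<open>(2 q)^(m + 2)\<close>; the base 2 absorbs the fact that there are two terms.\<close>

lemma flow_coeff_bound:
  assumes a: "a \<in> abel_coeffs T" and K: "K > 0" "\<And>t. t \<in> {0..T} \<Longrightarrow> \<bar>fst a t\<bar> \<le> K" "\<And>t. t \<in> {0..T} \<Longrightarrow> \<bar>snd a t\<bar> \<le> K"
  shows "s \<in> {0..T} \<Longrightarrow> \<bar>flow_coeff T a n s\<bar> \<le> (2 * (1 + K * (T - s))) ^ n"
proof (induction n arbitrary: s rule: less_induct)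
  case (less n)
  define q where "q u = 1 + K * (T - u)" for u
  have q1: "q u \<ge> 1" if "u \<in> {0..T}" for u using that K by (simp add: q_def)
  consider "n = 0" | "n = 1" | m where "n = Suc (Suc m)" by (metis One_nat_def not0_implies_Suc)
  then show ?case
  proof cases
    case 1 then show ?thesis by simp
  next
    case 2 then show ?thesis using q1[OF less.prems] by (simp add: q_def)
  next
    case 3
    let ?g = "\<lambda>u. fst a u * (real (Suc m) * flow_coeff T a (Suc m) u) + snd a u * (real m * flow_coeff T a m u)"
    have c: "continuous_on {0..T} (flow_coeff T a (Suc m))" "continuous_on {0..T} (flow_coeff T a m)"
      by (intro primitive_on_continuous[OF flow_coeff_primitive[OF a]])+
    have "bdd_measurable T (fst a)" "bdd_measurable T (snd a)"
      using a by (auto simp: abel_coeffs_bdd_measurable)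
    then have "bdd_measurable T ?g"
      by (intro bdd_measurable_add bdd_measurable_mult[OF _ bdd_measurable_continuous] continuous_intros c)
    then have gi: "?g integrable_on {s..T}" by (rule bdd_measurable_integrable) (use less.prems in auto)
    have "((\<lambda>u. 2 ^ (m+2) * (K * (real (m+2) * q u ^ (m+1)))) has_integral
        (- (2 ^ (m+2) * q T ^ (m+2)) - - (2 ^ (m+2) * q s ^ (m+2)))) {s..T}"
    proof (rule fundamental_theorem_of_calculus)
      fix u assume "u \<in> {s..T}"
      have "((\<lambda>u. - (2 ^ (m+2) * q u ^ (m+2))) has_real_derivative - (2 ^ (m+2) * (real (m+2) * q u ^ (m+1) * (- K)))) (at u within {s..T})"
        unfolding q_def by (rule derivative_eq_intros refl | simp)+
      then show "((\<lambda>u. - (2 ^ (m+2) * q u ^ (m+2))) has_vector_derivative 2 ^ (m+2) * (K * (real (m+2) * q u ^ (m+1)))) (at u within {s..T})"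
        by (simp add: has_real_derivative_iff_has_vector_derivative algebra_simps)
    qed (use less.prems in auto)
    then have hi: "((\<lambda>u. 2 ^ (m+2) * (K * (real (m+2) * q u ^ (m+1)))) has_integral 2 ^ (m+2) * (q s ^ (m+2) - 1)) {s..T}"
      by (simp add: q_def algebra_simps)
    have "norm (integral {s..T} ?g) \<le> integral {s..T} (\<lambda>u. 2 ^ (m+2) * (K * (real (m+2) * q u ^ (m+1))))"
    proof (rule integral_norm_bound_integral[OF gi])
      show "(\<lambda>u. 2 ^ (m+2) * (K * (real (m+2) * q u ^ (m+1)))) integrable_on {s..T}" using hi by blast
      fix u assume u: "u \<in> {s..T}"
      then have uT: "u \<in> {0..T}" using less.prems by auto
      have 1: "\<bar>flow_coeff T a (Suc m) u\<bar> \<le> (2 * q u) ^ (m+1)" using less.IH[of "Suc m" u] uT 3 by (simp add: q_def)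
      have "\<bar>flow_coeff T a m u\<bar> \<le> (2 * q u) ^ m" using less.IH[of m u] uT 3 by (simp add: q_def)
      also have "\<dots> \<le> (2 * q u) ^ (m+1)" using q1[OF uT] by (intro power_increasing) auto
      finally have 2: "\<bar>flow_coeff T a m u\<bar> \<le> (2 * q u) ^ (m+1)" .
      have "norm (?g u) \<le> \<bar>fst a u\<bar> * (real (Suc m) * \<bar>flow_coeff T a (Suc m) u\<bar>) + \<bar>snd a u\<bar> * (real m * \<bar>flow_coeff T a m u\<bar>)"
        unfolding real_norm_def by (rule order_trans[OF abs_triangle_ineq]) (simp add: abs_mult)
      also have "\<dots> \<le> K * (real (m+2) * (2 * q u) ^ (m+1)) + K * (real (m+2) * (2 * q u) ^ (m+1))"
        using K uT 1 2 by (intro add_mono mult_mono) auto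
      also have "\<dots> = 2 ^ (m+2) * (K * (real (m+2) * q u ^ (m+1)))" by (simp add: power_mult_distrib)
      finally show "norm (?g u) \<le> 2 ^ (m+2) * (K * (real (m+2) * q u ^ (m+1)))" .
    qed
    also have "\<dots> = 2 ^ (m+2) * (q s ^ (m+2) - 1)" using hi by (rule integral_unique)
    also have "\<dots> \<le> (2 * q s) ^ (m+2)" by (simp add: power_mult_distrib)
    finally show ?thesis using 3 by (simp add: q_def)
  qed
qed

text \<open>Differentiated along a solution, the partial sum telescopes by the recursion: every
  power of \<open>v\<close> below \<open>N + 2\<close> cancels and only the boundary terms
  remain.\<close>

lemma flow_sum_primitive:
  assumes a: "a \<in> abel_coeffs T" and v: "primitive_on T v (abel_rhs a v)"
  shows "primitive_on T (\<lambda>t. \<Sum>n<N+2. flow_coeff T a n t * v t ^ n)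
    (\<lambda>t. fst a t * (real (N+1) * flow_coeff T a (N+1) t * v t ^ (N+2)) +
      snd a t * (real N * flow_coeff T a N t * v t ^ (N+2) + real (N+1) * flow_coeff T a (N+1) t * v t ^ (N+3)))"
proof (induction N)
  case 0
  show ?case
    by (rule primitive_on_cong[OF v]) (simp_all add: numeral_2_eq_2 abel_rhs_def numeral_3_eq_3)
next
  case (Suc N)
  let ?c = "flow_coeff T a"
  have "primitive_on T (\<lambda>t. ?c (N+2) t * v t ^ (N+2))
    (\<lambda>t. flow_coeff_deriv T a (N+2) t * v t ^ (N+2) + (real (N+2) * v t ^ (N+2-1) * abel_rhs a v t) * ?c (N+2) t)"
    by (rule primitive_on_mult[OF flow_coeff_primitive[OF a] primitive_on_power[OF v]])
  from primitive_on_add[OF Suc this] show ?case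
    by (rule primitive_on_cong)
      (simp_all add: abel_rhs_def algebra_simps numeral_2_eq_2 numeral_3_eq_3 add_divide_distrib)
qed

lemma flow_coeff_end: "n \<noteq> 1 \<Longrightarrow> flow_coeff T a n T = 0"
proof (cases n)
  case (Suc m)
  then show "n \<noteq> 1 \<Longrightarrow> ?thesis" by (cases m) auto
qed simp

definition return_series :: "real \<Rightarrow> coeff_pair \<Rightarrow> real fps"
  where "return_series T a = Abs_fps (\<lambda>n. flow_coeff T a n 0)"

lemma abel_coeffs_bound:
  assumes "a \<in> abel_coeffs T"
  obtains K where "K > 0" "\<And>t. t \<in> {0..T} \<Longrightarrow> \<bar>fst a t\<bar> \<le> K" "\<And>t. t \<in> {0..T} \<Longrightarrow> \<bar>snd a t\<bar> \<le> K"
proof -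
  obtain K1 K2 where K12: "K1 > 0" "\<And>t. t \<in> {0..T} \<Longrightarrow> \<bar>fst a t\<bar> \<le> K1" "K2 > 0" "\<And>t. t \<in> {0..T} \<Longrightarrow> \<bar>snd a t\<bar> \<le> K2"
    by (metis assms abel_coeffs_bdd_measurable bdd_measurableE)
  show ?thesis by (rule that[of "max K1 K2"]) (use K12 in \<open>fastforce+\<close>)
qed

text \<open>The coefficients at time 0 grow at most like \<open>Q ^ n\<close>, which leaves a
  positive radius of convergence.\<close>

lemma return_series_in_group:
  assumes a: "a \<in> abel_coeffs T" and T: "T > 0"
  shows "return_series T a \<in> carrier return_group"
proof -
  obtain K where K: "K > 0" "\<And>t. t \<in> {0..T} \<Longrightarrow> \<bar>fst a t\<bar> \<le> K" "\<And>t. t \<in> {0..T} \<Longrightarrow> \<bar>snd a t\<bar> \<le> K"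
    using a by (rule abel_coeffs_bound) blast
  define Q where "Q = 2 * (1 + K * T)"
  have Q: "Q > 0" using K T by (simp add: Q_def add_pos_pos)
  have "summable (\<lambda>n. flow_coeff T a n 0 * (1 / (2 * Q)) ^ n)"
  proof (rule summable_comparison_test')
    show "summable (\<lambda>n. (1/2 :: real) ^ n)" by (rule summable_geometric) simp
    fix n :: nat
    have "\<bar>flow_coeff T a n 0\<bar> \<le> Q ^ n" using flow_coeff_bound[OF a K, of 0 n] T by (simp add: Q_def)
    then have "\<bar>flow_coeff T a n 0\<bar> * (1 / (2 * Q)) ^ n \<le> Q ^ n * (1 / (2 * Q)) ^ n" using Q by (intro mult_right_mono) auto
    also have "\<dots> = (1/2) ^ n" using Q by (simp add: power_mult_distrib[symmetric])
    finally show "norm (flow_coeff T a n 0 * (1 / (2 * Q)) ^ n) \<le> (1/2) ^ n" using Q by (simp add: abs_mult power_abs)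
  qed
  from conv_radius_geI[OF this] have "fps_conv_radius (return_series T a) \<ge> norm (1 / (2 * Q))"
    by (simp add: fps_conv_radius_def return_series_def)
  moreover have "(0::ereal) < ereal (norm (1 / (2 * Q)))" using Q by simp
  ultimately have "fps_conv_radius (return_series T a) > 0" by (rule less_le_trans[rotated])
  then show ?thesis by (simp add: return_group_def return_series_def)
qed

text \<open>The partial sum along a solution is almost constant in time. At time \<open>T\<close> it
  equals \<open>v T\<close>, at time 0 it is a partial sum of the series at \<open>r\<close>; the
  difference tends to 0.\<close>

lemma return_series_value:
  assumes a: "a \<in> abel_coeffs T" and T: "T > 0"
  shows "\<forall>\<^sub>F r in nhds 0. \<exists>v. abel_solution T a v \<and> v 0 = r \<and> v T = eval_fps (return_series T a) r"
proof -
  obtain K where K: "K > 0" "\<And>t. t \<in> {0..T} \<Longrightarrow> \<bar>fst a t\<bar> \<le> K" "\<And>t. t \<in> {0..T} \<Longrightarrow> \<bar>snd a t\<bar> \<le> K"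
    using a by (rule abel_coeffs_bound) blast
  define Q where "Q = 2 * (1 + K * T)"
  have Q: "Q \<ge> 1" using K T by (simp add: Q_def)
  obtain \<rho> where \<rho>: "\<rho> > 0" "\<rho> \<le> 1"
    "\<And>r. \<bar>r\<bar> < \<rho> \<Longrightarrow> \<exists>v. abel_solution T a v \<and> v 0 = r \<and> (\<forall>t\<in>{0..T}. \<bar>v t\<bar> \<le> 2 * \<bar>r\<bar>)"
    using abel_solution_exists[OF a T] by metis
  have main: "\<exists>v. abel_solution T a v \<and> v 0 = r \<and> v T = eval_fps (return_series T a) r"
    \<comment> \<open>The solution stays within \<open>2 |r| \<le> 1 / (2 Q)\<close>, so the growth
      \<open>Q ^ n\<close> of the coefficients is beaten by a geometric series of ratio 1/2.\<close>
    if r: "\<bar>r\<bar> < min \<rho> (1 / (4 * Q))" for r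
  proof -
    obtain v where v: "abel_solution T a v" "v 0 = r" "\<And>t. t \<in> {0..T} \<Longrightarrow> \<bar>v t\<bar> \<le> 2 * \<bar>r\<bar>"
      using \<rho>(3)[of r] r by auto
    define y where "y = 2 * \<bar>r\<bar>"
    have y: "y \<ge> 0" "Q * y \<le> 1/2" using r Q by (auto simp: y_def field_simps)
    have y1: "y \<le> 1" using y Q mult_right_mono[of 1 Q y] by linarith
    note pv = v(1)[unfolded abel_solution_iff_primitive_on[OF a]]
    let ?S = "\<lambda>N t. \<Sum>n<N+2. flow_coeff T a n t * v t ^ n"
    have cb: "\<bar>flow_coeff T a n t\<bar> \<le> Q ^ n" if "t \<in> {0..T}" for n t
    proof -
      have "\<bar>flow_coeff T a n t\<bar> \<le> (2 * (1 + K * (T - t))) ^ n" by (rule flow_coeff_bound[OF a K that])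
      also have "\<dots> \<le> Q ^ n" using that K by (intro power_mono) (auto simp: Q_def intro!: mult_left_mono)
      finally show ?thesis .
    qed
    have diff: "\<bar>?S N T - ?S N 0\<bar> \<le> 3 * K * T * (real (N+1) * (1/2) ^ (N+1))" for N
    proof -
      let ?g = "\<lambda>t. fst a t * (real (N+1) * flow_coeff T a (N+1) t * v t ^ (N+2)) +
        snd a t * (real N * flow_coeff T a N t * v t ^ (N+2) + real (N+1) * flow_coeff T a (N+1) t * v t ^ (N+3))"
      define B where "B = real (N+1) * (1/2) ^ (N+1)"
      note p = flow_sum_primitive[OF a pv, of N]
      have tm: "\<bar>real k * flow_coeff T a n t * v t ^ m\<bar> \<le> B" if "t \<in> {0..T}" "k \<le> N+1" "n \<le> N+1" "N+1 \<le> m" for k n m t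
      proof -
        have "\<bar>v t\<bar> ^ m \<le> y ^ m" using v(3)[OF that(1)] by (intro power_mono) (auto simp: y_def)
        also have "\<dots> \<le> y ^ (N+1)" using y y1 that by (intro power_decreasing) auto
        finally have 1: "\<bar>v t\<bar> ^ m \<le> y ^ (N+1)" .
        have "Q ^ n \<le> Q ^ (N+1)" using Q that by (intro power_increasing) auto
        then have 2: "\<bar>flow_coeff T a n t\<bar> \<le> Q ^ (N+1)" using cb[OF that(1), of n] by linarith
        have "\<bar>real k * flow_coeff T a n t * v t ^ m\<bar> = real k * (\<bar>flow_coeff T a n t\<bar> * \<bar>v t\<bar> ^ m)"
          by (simp add: abs_mult power_abs)
        also have "\<dots> \<le> real (N+1) * (Q ^ (N+1) * y ^ (N+1))"
          using 1 2 that Q y by (intro mult_mono) auto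
        also have "\<dots> = real (N+1) * (Q * y) ^ (N+1)" by (simp add: power_mult_distrib)
        also have "\<dots> \<le> B" unfolding B_def using y Q by (intro mult_left_mono power_mono) auto
        finally show ?thesis .
      qed
      have B0: "B \<ge> 0" by (simp add: B_def)
      have I1: "\<bar>integral {0..T} ?g\<bar> \<le> 3 * K * B * (T - 0)"
      proof (rule integral_bound_real)
        show "?g integrable_on {0..T}" by (rule bdd_measurable_integrable[OF primitive_onD(1)[OF p]]) auto
        fix t assume t: "t \<in> {0..T}"
        have "\<bar>fst a t * (real (N+1) * flow_coeff T a (N+1) t * v t ^ (N+2))\<bar> \<le> K * B"
          unfolding abs_mult[of "fst a t"] using K t B0 by (intro mult_mono tm) auto
        moreover have "\<bar>snd a t * (real N * flow_coeff T a N t * v t ^ (N+2) + real (N+1) * flow_coeff T a (N+1) t * v t ^ (N+3))\<bar> \<le> K * (B + B)"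
          unfolding abs_mult[of "snd a t"] using K t B0
          by (intro mult_mono order_trans[OF abs_triangle_ineq] add_mono tm) auto
        ultimately show "\<bar>?g t\<bar> \<le> 3 * K * B" by (simp add: algebra_simps)
      qed (use T in auto)
      have I2: "integral {0..T} ?g = ?S N T - ?S N 0" by (rule primitive_onD(2)[OF p]) (use T in auto)
      have "3 * K * B * (T - 0) = 3 * K * T * (real (N+1) * (1/2) ^ (N+1))" by (simp only: B_def diff_zero mult_ac)
      then show ?thesis using I1 unfolding I2 by (simp only:)
    qed
    \<comment> \<open>At the final time the flow is the identity, so all coefficients but the linear
      one vanish there.\<close>
    have ST: "?S N T = v T" for N
    proof -
      have "?S N T = (\<Sum>n<N+2. if n = 1 then v T else 0)"
        by (rule sum.cong) (auto simp: flow_coeff_end)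
      also have "\<dots> = v T" by (simp add: sum.delta)
      finally show ?thesis .
    qed
    have "(\<lambda>N. 3 * K * T * (real N * (1/2) ^ N)) \<longlonglongrightarrow> 3 * K * T * 0"
      by (intro tendsto_mult_left powser_times_n_limit_0) simp
    then have "(\<lambda>N. 3 * K * T * (real (N+1) * (1/2) ^ (N+1))) \<longlonglongrightarrow> 0"
      using LIMSEQ_ignore_initial_segment[of _ _ 1] by fastforce
    then have "(\<lambda>N. ?S N T - ?S N 0) \<longlonglongrightarrow> 0"
      by (rule Lim_null_comparison[rotated]) (use diff in auto)
    then have "(\<lambda>N. v T - (?S N T - ?S N 0)) \<longlonglongrightarrow> v T - 0" by (intro tendsto_diff tendsto_const)
    moreover have "v T - (?S N T - ?S N 0) = ?S N 0" for N using ST[of N] by linarith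
    ultimately have lim: "(\<lambda>N. ?S N 0) \<longlonglongrightarrow> v T" by (simp only: diff_zero)
    have "(\<lambda>n. flow_coeff T a n 0 * r ^ n) sums v T"
      unfolding sums_def by (rule LIMSEQ_offset[where k=2]) (use lim in \<open>simp only: v(2)\<close>)
    then have "v T = eval_fps (return_series T a) r"
      by (simp add: eval_fps_def return_series_def sums_iff)
    then show ?thesis using v by blast
  qed
  have "0 < min \<rho> (1 / (4 * Q))" using \<rho> Q by simp
  then show ?thesis unfolding eventually_nhds_metric using main
    by (intro exI[of _ "min \<rho> (1 / (4 * Q))"]) (auto simp: dist_real_def)
qed

text \<open>A nonzero power series with vanishing constant term has an isolated zero at the origin;
  this is applied to the difference.\<close>

lemma eval_fps_real_eqD:
  fixes F G :: "real fps"
  assumes "fps_conv_radius F > 0" "fps_conv_radius G > 0" and nth0: "fps_nth F 0 = fps_nth G 0"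
    and ev: "\<forall>\<^sub>F r in nhds 0. eval_fps F r = eval_fps G r"
  shows "F = G"
proof (rule ccontr)
  assume "F \<noteq> G"
  then obtain m where m: "fps_nth (F - G) m \<noteq> 0" by (metis eq_iff_diff_eq_0 fps_nonzero_nth)
  then have m0: "m > 0" using nth0 by (cases m) auto
  define R where "R = min (fps_conv_radius F) (fps_conv_radius G)"
  have R: "R > 0" using assms by (simp add: R_def)
  obtain \<rho> where \<rho>: "\<rho> > 0" "ereal \<rho> < R" using R ereal_dense2[OF R] by (metis ereal_less(2) less_ereal.simps(1) zero_ereal_def)
  have sm: "(\<lambda>n. fps_nth (F - G) n * (x - 0) ^ n) sums (eval_fps F x - eval_fps G x)" if "norm (x - 0) < \<rho>" for x
  proof -
    have x: "ereal (norm x) < fps_conv_radius F" "ereal (norm x) < fps_conv_radius G"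
      using that \<rho> unfolding R_def by (auto intro: less_trans[OF _ less_le_trans[OF \<rho>(2)[unfolded R_def]]])
    show ?thesis using sums_diff[OF sums_eval_fps[OF x(1)] sums_eval_fps[OF x(2)]] by (simp add: algebra_simps)
  qed
  obtain s where s: "s > 0" "\<And>z. z \<in> cball 0 s - {0} \<Longrightarrow> eval_fps F z - eval_fps G z \<noteq> 0"
    by (rule powser_0_nonzero[OF \<rho>(1) sm _ m m0]) (auto simp: eval_fps_at_0 nth0)
  obtain d where d: "d > 0" "\<And>r. dist r 0 < d \<Longrightarrow> eval_fps F r = eval_fps G r"
    using ev unfolding eventually_nhds_metric by blast
  define z where "z = min s (d/2)"
  have "z > 0" "z \<le> s" "z < d" using s(1) d(1) by (auto simp: z_def)
  then show False using d(2)[of z] s(2)[of z] by (auto simp: dist_real_def)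
qed

text \<open>Discharges the definite description: by uniqueness of solutions two candidate series
  agree near 0, hence coefficientwise.\<close>

lemma first_return_eqI:
  assumes a: "a \<in> abel_coeffs T" and T: "T > 0" and F: "F \<in> carrier return_group"
    and ev: "\<forall>\<^sub>F r in nhds 0. \<exists>v. abel_solution T a v \<and> v 0 = r \<and> v T = eval_fps F r"
  shows "first_return T a = F"
  unfolding first_return_def
proof (rule the_equality)
  show "F \<in> carrier return_group \<and> (\<forall>\<^sub>F r in nhds 0. \<exists>v. abel_solution T a v \<and> v 0 = r \<and> v T = eval_fps F r)"
    using F ev by blast
  fix G assume G: "G \<in> carrier return_group \<and> (\<forall>\<^sub>F r in nhds 0. \<exists>v. abel_solution T a v \<and> v 0 = r \<and> v T = eval_fps G r)"
  have "\<forall>\<^sub>F r in nhds 0. eval_fps G r = eval_fps F r"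
    using ev conjunct2[OF G]
  proof eventually_elim
    case (elim r)
    then obtain v w where "abel_solution T a v" "v 0 = r" "v T = eval_fps F r" "abel_solution T a w" "w 0 = r" "w T = eval_fps G r"
      by blast
    then show ?case using abel_solution_unique[OF a, of v w T] T by auto
  qed
  then show "G = F" using F G by (intro eval_fps_real_eqD) (auto simp: return_group_def)
qed

lemma first_return_eq_series:
  "a \<in> abel_coeffs T \<Longrightarrow> T > 0 \<Longrightarrow> first_return T a = return_series T a"
  by (intro first_return_eqI return_series_in_group return_series_value)

lemma fps_X_in_return_group: "fps_X \<in> carrier return_group"
  by (simp add: return_group_def)

lemma has_center_iff_first_return:
  assumes a: "a \<in> abel_coeffs T" and T: "T > 0"
  shows "has_center T a \<longleftrightarrow> first_return T a = fps_X"
proof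
  assume "has_center T a"
  then show "first_return T a = fps_X" unfolding has_center_def
    by (intro first_return_eqI a T fps_X_in_return_group) simp
next
  assume "first_return T a = fps_X"
  then have "return_series T a = fps_X" using first_return_eq_series[OF a T] by simp
  then show "has_center T a" using return_series_value[OF a T] by (simp add: has_center_def)
qed

text \<open>The coefficient of \<open>r^2\<close> of the return map is the integral of the first
  component. The coefficient of \<open>r^3\<close> is the integral of the second one plus the square
  of the first integral, so both integrals vanish in turn.\<close>

lemma has_center_imp_closed:
  assumes a: "a \<in> abel_coeffs T" and T: "T > 0" and c: "has_center T a"
  shows "primitive_path a T = 0"
proof -
  have b: "bdd_measurable T (fst a)" "bdd_measurable T (snd a)" using a by (auto simp: abel_coeffs_bdd_measurable)
  have X: "return_series T a = fps_X" using c has_center_iff_first_return[OF a T] first_return_eq_series[OF a T] by simp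
  have c0: "flow_coeff T a n 0 = 0" if "n > 1" for n
    using arg_cong[OF X, of "\<lambda>F. fps_nth F n"] that by (simp add: return_series_def fps_X_def)
  have c2: "flow_coeff T a (Suc (Suc 0)) = (\<lambda>s. integral {s..T} (fst a))" by (simp add: fun_eq_iff)
  have 1: "integral {0..T} (fst a) = 0" using c0[of "Suc (Suc 0)"] by simp
  let ?h = "\<lambda>s. integral {s..T} (fst a)"
  have p: "primitive_on T ?h (\<lambda>s. - fst a s)" by (rule primitive_on_tail[OF b(1)])
  from primitive_on_mult[OF p p] have q: "primitive_on T (\<lambda>s. ?h s * ?h s) (\<lambda>s. - (2 * (fst a s * ?h s)))"
    by (rule primitive_on_cong) auto
  have "integral {0..T} (\<lambda>s. - (2 * (fst a s * ?h s))) = 0" using primitive_onD(2)[OF q, of T] 1 T by simp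
  then have 2: "integral {0..T} (\<lambda>s. fst a s * ?h s) = 0" by simp
  have i1: "(\<lambda>s. fst a s * (2 * ?h s)) integrable_on {0..T}"
  proof -
    have "continuous_on {0..T} (\<lambda>s. 2 * ?h s)" by (intro continuous_intros primitive_on_continuous[OF p])
    from bdd_measurable_mult[OF b(1) bdd_measurable_continuous[OF this]] show ?thesis
      by (rule bdd_measurable_integrable) auto
  qed
  have i2: "snd a integrable_on {0..T}" by (rule bdd_measurable_integrable[OF b(2)]) auto
  have "0 = integral {0..T} (\<lambda>s. fst a s * (2 * ?h s) + snd a s)" using c0[of "Suc (Suc (Suc 0))"] by simp
  also have "\<dots> = integral {0..T} (\<lambda>s. fst a s * (2 * ?h s)) + integral {0..T} (snd a)"
    by (rule Henstock_Kurzweil_Integration.integral_add[OF i1 i2])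
  also have "integral {0..T} (\<lambda>s. fst a s * (2 * ?h s)) = 2 * integral {0..T} (\<lambda>s. fst a s * ?h s)"
    by (subst integral_mult_right[symmetric]) (simp add: algebra_simps)
  finally show ?thesis using 1 2 by (simp add: primitive_path_def zero_prod_def)
qed

section \<open>Lipschitz graphs\<close>

text \<open>An oriented edge is named by the ordered pair of its ends, both orientations being
  present; this encoding presupposes a graph without loops and multiple edges. Bi-Lipschitz control
  is local in the open edge, which is all that the arcs of a triangulable curve offer.\<close>

locale lipschitz_graph =
  fixes \<Gamma> V :: "'a::euclidean_space set"
    and adj :: "'a \<Rightarrow> 'a \<Rightarrow> bool"
    and ed :: "'a \<Rightarrow> 'a \<Rightarrow> real \<Rightarrow> 'a"
  assumes fin_V: "finite V"
    and adj_V: "adj v w \<Longrightarrow> v \<in> V"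
    and adj_sym: "adj v w \<Longrightarrow> adj w v"
    and ed_rev: "adj v w \<Longrightarrow> ed w v = reversepath (ed v w)"
    and ed_lipschitz: "adj v w \<Longrightarrow> \<exists>L. L-lipschitz_on {0..1} (ed v w)"
    and ed_inj: "adj v w \<Longrightarrow> inj_on (ed v w) {0..1}"
    and ed_bilipschitz: "adj v w \<Longrightarrow> locally_bilipschitz_on {0<..<1} (ed v w)"
    and ed_0: "adj v w \<Longrightarrow> ed v w 0 = v"
    and ed_notin_V: "adj v w \<Longrightarrow> u \<in> {0<..<1} \<Longrightarrow> ed v w u \<notin> V"
    and ed_disjoint: "\<lbrakk>adj v w; adj v' w'; u \<in> {0<..<1}; u' \<in> {0<..<1}; ed v w u = ed v' w' u'\<rbrakk>
      \<Longrightarrow> v = v' \<and> w = w' \<or> v = w' \<and> w = v'"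
    and \<Gamma>_eq: "\<Gamma> = V \<union> (\<Union>(v, w)\<in>{(v, w). adj v w}. ed v w ` {0..1})"
begin

definition star :: "'a \<Rightarrow> 'a set"
  where "star v = insert v (\<Union>w\<in>{w. adj v w}. ed v w ` {0..<1})"

text \<open>The open stars cover the curve; the closed ones are finite unions of compact edges,
  which gives gluing of continuous functions and contractibility.\<close>

definition closed_star :: "'a \<Rightarrow> 'a set"
  where "closed_star v = insert v (\<Union>w\<in>{w. adj v w}. ed v w ` {0..1})"

lemma adj_V2: "adj v w \<Longrightarrow> w \<in> V" using adj_sym adj_V by blast

lemma ed_1: "adj v w \<Longrightarrow> ed v w 1 = w"
  using ed_rev[of w v] ed_0[of w v] adj_sym by (auto simp: reversepath_def)

lemma ed_rev': "adj v w \<Longrightarrow> ed w v u = ed v w (1 - u)"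
  by (simp add: ed_rev reversepath_def)

lemma adj_neq: "adj v w \<Longrightarrow> v \<noteq> w"
  using ed_inj[of v w] ed_0[of v w] ed_1[of v w] inj_onD[of "ed v w" "{0..1}" 0 1] by auto

lemma continuous_on_ed: "adj v w \<Longrightarrow> continuous_on {0..1} (ed v w)"
  using ed_lipschitz lipschitz_on_continuous_on by blast

lemma path_ed: "adj v w \<Longrightarrow> path (ed v w)"
  by (simp add: path_def continuous_on_ed)

lemma finite_adj: "finite {(v, w). adj v w}" "finite {w. adj v w}"
proof -
  show "finite {(v, w). adj v w}"
    by (rule finite_subset[of _ "V \<times> V"]) (use adj_V adj_V2 fin_V in auto)
  show "finite {w. adj v w}" by (rule finite_subset[OF _ fin_V]) (use adj_V2 in auto)
qed

lemma compact_ed: "adj v w \<Longrightarrow> compact (ed v w ` {0..1})"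
  by (intro compact_continuous_image continuous_on_ed) auto

lemma compact_\<Gamma>: "compact \<Gamma>"
  unfolding \<Gamma>_eq by (intro compact_Un[OF finite_imp_compact[OF fin_V] compact_UN] finite_adj) (auto intro: compact_ed)

lemma ed_in_\<Gamma>: "adj v w \<Longrightarrow> u \<in> {0..1} \<Longrightarrow> ed v w u \<in> \<Gamma>"
  unfolding \<Gamma>_eq by blast

lemma closed_star_subset: "v \<in> V \<Longrightarrow> closed_star v \<subseteq> \<Gamma>"
  unfolding closed_star_def using ed_in_\<Gamma> \<Gamma>_eq by auto

lemma star_subset_closed_star: "star v \<subseteq> closed_star v"
  unfolding closed_star_def star_def by fastforce

lemma ed_cases:
  assumes "p \<in> \<Gamma>"
  obtains "p \<in> V" | v w u where "adj v w" "u \<in> {0<..<1}" "p = ed v w u"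
proof (cases "p \<in> V")
  case False
  then obtain v w u where vw: "adj v w" "u \<in> {0..1}" "p = ed v w u" using assms unfolding \<Gamma>_eq by auto
  then have "u \<noteq> 0" "u \<noteq> 1" using False ed_0 ed_1 adj_V adj_V2 by metis+
  then show ?thesis using vw by (intro that(2)[OF vw(1) _ vw(3)]) auto
qed (use that in blast)

lemma ed_coord_unique:
  assumes "adj v w" "adj v w'" "u \<in> {0..1}" "u' \<in> {0..1}" "ed v w u = ed v w' u'"
  shows "u = u' \<and> (u = 0 \<or> w = w')"
proof -
  have V01: "ed a b x \<in> V \<longleftrightarrow> x = 0 \<or> x = 1" if "adj a b" "x \<in> {0..1}" for a b x
    using that ed_notin_V[of a b x] ed_0[of a b] ed_1[of a b] adj_V adj_V2 by (cases "x = 0 \<or> x = 1") auto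
  have e: "ed v w 0 = v" "ed v w' 0 = v" "ed v w 1 = w" "ed v w' 1 = w'" "v \<noteq> w" "v \<noteq> w'"
    using assms ed_0 ed_1 adj_neq by auto
  show ?thesis
  proof (cases "ed v w u \<in> V")
    case True
    then have "u = 0 \<or> u = 1" "u' = 0 \<or> u' = 1" using V01 assms by metis+
    then show ?thesis using e assms(5) by auto
  next
    case False
    then have u: "u \<in> {0<..<1}" "u' \<in> {0<..<1}" using V01[OF assms(1,3)] V01[OF assms(2,4)] assms by auto
    then have "w = w'" using ed_disjoint[OF assms(1,2) u assms(5)] e by auto
    then show ?thesis using ed_inj[OF assms(1)] assms by (auto dest: inj_onD)
  qed
qed

lemma star_cover: "\<Gamma> \<subseteq> (\<Union>v\<in>V. star v)"
proof
  fix p assume "p \<in> \<Gamma>"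
  then show "p \<in> (\<Union>v\<in>V. star v)"
  proof (cases rule: ed_cases)
    case 1 then show ?thesis by (auto simp: star_def)
  next
    case (2 v w u)
    then have "p \<in> star v" by (auto simp: star_def)
    then show ?thesis using adj_V[OF 2(1)] by blast
  qed
qed

text \<open>What the star leaves out of the curve consists of the other vertices and the edges
  avoiding \<open>v\<close>, a finite union of compact sets.\<close>

lemma star_open:
  assumes "v \<in> V"
  obtains U where "open U" "star v = \<Gamma> \<inter> U"
proof -
  define C where "C = (V - {v}) \<union> (\<Union>(a, b)\<in>{(a, b). adj a b \<and> a \<noteq> v \<and> b \<noteq> v}. ed a b ` {0..1})"
  have "finite {(a, b). adj a b \<and> a \<noteq> v \<and> b \<noteq> v}" by (rule finite_subset[OF _ finite_adj(1)]) auto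
  then have "compact C" unfolding C_def
    using fin_V by (intro compact_Un[OF finite_imp_compact compact_UN]) (auto intro: compact_ed)
  then have "closed C" by (rule compact_imp_closed)
  have 1: "p \<in> C" if "p \<in> \<Gamma>" "p \<notin> star v" for p
    using that(1)
  proof (cases rule: ed_cases)
    case 1 then show ?thesis using that by (auto simp: C_def star_def)
  next
    case (2 a b u)
    have "a \<noteq> v" using that 2 by (auto simp: star_def)
    moreover have "b \<noteq> v"
    proof
      assume b: "b = v"
      have "p = ed v a (1 - u)" using ed_rev'[of v a] adj_sym 2 b by (metis diff_diff_eq2 add_diff_cancel_left')
      then have "p \<in> ed v a ` {0..<1}" using 2 by auto
      moreover have "adj v a" using 2(1) b adj_sym by blast
      ultimately show False using that unfolding star_def by blast
    qed
    ultimately show ?thesis unfolding C_def using 2 by fastforce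
  qed
  have 2: "p \<notin> C" if pst: "p \<in> star v" for p
  proof
    assume pC: "p \<in> C"
    show False
    proof (cases "p \<in> V")
      case True
      have pv: "p = v"
      proof (rule ccontr)
        assume "p \<noteq> v"
        then obtain w u where "adj v w" "u \<in> {0..<1}" "p = ed v w u" using pst by (auto simp: star_def)
        then show False using True \<open>p \<noteq> v\<close> ed_0[of v w] ed_notin_V[of v w u] by (cases "u = 0") auto
      qed
      then obtain a b u where ab: "adj a b" "a \<noteq> v" "b \<noteq> v" "u \<in> {0..1}" "v = ed a b u"
        using pC by (auto simp: C_def)
      then show False using ed_notin_V[of a b u] assms ed_0[of a b] ed_1[of a b] by (cases "u = 0 \<or> u = 1") auto
    next
      case False
      then obtain a b u where ab: "adj a b" "a \<noteq> v" "b \<noteq> v" "u \<in> {0..1}" "p = ed a b u"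
        using pC by (auto simp: C_def)
      obtain w u' where w: "adj v w" "u' \<in> {0..<1}" "p = ed v w u'" using pst False assms by (auto simp: star_def)
      have "u \<noteq> 0" "u \<noteq> 1" "u' \<noteq> 0" using ab w False ed_0 ed_1 adj_V adj_V2 by metis+
      then show False using ed_disjoint[OF ab(1) w(1), of u u'] ab w by auto
    qed
  qed
  have "star v = \<Gamma> \<inter> - C" using 1 2 star_subset_closed_star closed_star_subset[OF assms] by blast
  then show ?thesis using that[of "- C"] \<open>closed C\<close> by auto
qed

lemma AR_edge: "adj v w \<Longrightarrow> AR (ed v w ` {0..1})"
proof -
  assume vw: "adj v w"
  have "{0..1::real} homeomorphic ed v w ` {0..1}"
    by (rule homeomorphic_compact[OF _ continuous_on_ed[OF vw] refl ed_inj[OF vw]]) auto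
  moreover have "AR {0..1::real}" by (rule convex_imp_AR) auto
  ultimately show ?thesis using homeomorphic_AR_iff_AR by blast
qed

lemma edges_meet:
  assumes "adj v w" "adj v w'" "w \<noteq> w'"
  shows "ed v w ` {0..1} \<inter> ed v w' ` {0..1} = {v}"
  using ed_coord_unique[OF assms(1,2)] assms(3) ed_0[OF assms(1)] ed_0[OF assms(2)]
  by (auto 0 3 simp: image_iff) (metis atLeastAtMost_iff zero_le_one order_refl)+

text \<open>The edges are attached one at a time, each meeting the earlier ones in the single point
  \<open>v\<close>; a union of two closed absolute retracts along an absolute retract is again one.
  Contractibility of the star is read off from this.\<close>

lemma AR_closed_star: "AR (closed_star v)"
proof -
  have "finite W \<Longrightarrow> W \<subseteq> {w. adj v w} \<Longrightarrow> AR (insert v (\<Union>w\<in>W. ed v w ` {0..1})) \<and> compact (insert v (\<Union>w\<in>W. ed v w ` {0..1}))" for W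
  proof (induction W rule: finite_induct)
    case empty
    show ?case by (auto intro!: convex_imp_AR)
  next
    case (insert w W)
    let ?X = "insert v (\<Union>w\<in>W. ed v w ` {0..1})" and ?Y = "ed v w ` {0..1}"
    have w: "adj v w" and W: "\<And>w'. w' \<in> W \<Longrightarrow> adj v w' \<and> w \<noteq> w'" using insert by auto
    have "v \<in> ?Y" using ed_0[OF w] by (metis atLeastAtMost_iff imageI order_refl zero_le_one)
    then have "?X \<inter> ?Y = {v}" using edges_meet[OF _ w] W by blast
    then have "AR (?X \<inter> ?Y)" by (simp add: convex_imp_AR)
    then have "AR (?X \<union> ?Y)" using insert compact_ed[OF w] AR_edge[OF w]
      by (intro AR_closed_Un) (auto intro: compact_imp_closed)
    moreover have "compact (?X \<union> ?Y)" using insert compact_ed[OF w] by (intro compact_Un) auto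
    moreover have "insert v (\<Union>w\<in>insert w W. ed v w ` {0..1}) = ?X \<union> ?Y" by auto
    ultimately show ?case by simp
  qed
  from this[OF finite_adj(2) order_refl] show ?thesis by (simp add: closed_star_def)
qed

lemma homotopic_paths_in_closed_star:
  assumes "v \<in> V" "path p" "path q" "path_image p \<subseteq> closed_star v" "path_image q \<subseteq> closed_star v"
    "pathstart p = pathstart q" "pathfinish p = pathfinish q"
  shows "homotopic_paths \<Gamma> p q"
proof -
  have "simply_connected (closed_star v)"
    by (intro contractible_imp_simply_connected AR_imp_contractible AR_closed_star)
  then have "homotopic_paths (closed_star v) p q"
    using assms unfolding simply_connected_eq_homotopic_paths by auto
  then show ?thesis by (rule homotopic_paths_subset) (rule closed_star_subset[OF assms(1)])
qed

lemma star_lebesgue_number: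
  obtains \<delta> where "\<delta> > 0" "\<And>S. S \<subseteq> \<Gamma> \<Longrightarrow> S \<noteq> {} \<Longrightarrow> (\<And>x y. x \<in> S \<Longrightarrow> y \<in> S \<Longrightarrow> dist x y < \<delta>) \<Longrightarrow> \<exists>v\<in>V. S \<subseteq> star v"
proof (cases "V = {}")
  case True
  then have "\<Gamma> = {}" using star_cover by auto
  then show ?thesis by (intro that[of 1]) auto
next
  case False
  define U where "U v = (SOME U. open U \<and> star v = \<Gamma> \<inter> U)" for v
  have U: "open (U v) \<and> star v = \<Gamma> \<inter> U v" if "v \<in> V" for v
    unfolding U_def by (rule someI_ex) (use star_open[OF that] in metis)
  obtain \<delta> where \<delta>: "\<delta> > 0" "\<And>S. S \<subseteq> \<Gamma> \<Longrightarrow> diameter S < \<delta> \<Longrightarrow> \<exists>B\<in>U ` V. S \<subseteq> B"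
  proof (rule Lebesgue_number_lemma[OF compact_\<Gamma>, of "U ` V"])
    show "\<Gamma> \<subseteq> \<Union> (U ` V)" using star_cover U by blast
  qed (use False U in auto)
  show ?thesis
  \<comment> \<open>Strict bounds on pairwise distances bound the diameter only weakly, so half of
    the Lebesgue number is taken.\<close>
  proof (rule that[of "\<delta>/2"])
    fix S assume S: "S \<subseteq> \<Gamma>" "S \<noteq> {}" "\<And>x y. x \<in> S \<Longrightarrow> y \<in> S \<Longrightarrow> dist x y < \<delta>/2"
    have "diameter S \<le> \<delta>/2" 
    proof (rule diameter_le)
      show "S \<noteq> {} \<or> 0 \<le> \<delta>/2" using S(2) by blast
      show "norm (x - y) \<le> \<delta>/2" if "x \<in> S" "y \<in> S" for x y using S(3)[OF that] by (simp add: dist_norm)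
    qed
    then obtain v where "v \<in> V" "S \<subseteq> U v" using \<delta>(2)[OF S(1)] \<delta>(1) by auto
    then show "\<exists>v\<in>V. S \<subseteq> star v" using U[of v] S(1) by blast
  qed (use \<delta> in auto)
qed

text \<open>Near an interior point of an edge the curve is just that edge, because everything else
  forms a compact set \<open>C\<close>. There the edge coordinate of the path is continuous, so it
  enters the neighbourhood where the edge is bi-Lipschitz with lower constant \<open>c\<close>, and
  is Lipschitz with constant \<open>L / c\<close>.\<close>

lemma lift_to_edge:
  fixes \<gamma> :: "real \<Rightarrow> 'a"
  assumes \<gamma>: "L-lipschitz_on {a..b} \<gamma>" "\<gamma> ` {a..b} \<subseteq> \<Gamma>" and t0: "t0 \<in> {a..b}"
    and vw: "adj v w" and u0: "u0 \<in> {0<..<1}" "\<gamma> t0 = ed v w u0"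
  obtains e u M where "e > 0" "\<And>t. t \<in> {a..b} \<Longrightarrow> \<bar>t - t0\<bar> < e \<Longrightarrow> u t \<in> {0<..<1} \<and> \<gamma> t = ed v w (u t)"
    "M-lipschitz_on ({a..b} \<inter> {t. \<bar>t - t0\<bar> < e}) u"
proof -
  define C where "C = V \<union> (\<Union>(a, b)\<in>{(a, b). adj a b \<and> {a, b} \<noteq> {v, w}}. ed a b ` {0..1})"
  have "finite {(a, b). adj a b \<and> {a, b} \<noteq> {v, w}}" by (rule finite_subset[OF _ finite_adj(1)]) auto
  then have "compact C" unfolding C_def
    using fin_V by (intro compact_Un[OF finite_imp_compact compact_UN]) (auto intro: compact_ed)
  then have oC: "open (- C)" by (simp add: compact_imp_closed open_Compl)
  have inC: "p \<in> ed v w ` {0<..<1}" if "p \<in> \<Gamma>" "p \<notin> C" for p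
    using that(1)
  proof (cases rule: ed_cases)
    case 1 then show ?thesis using that by (auto simp: C_def)
  next
    case (2 a b u)
    have "{a, b} = {v, w}"
    proof (rule ccontr)
      assume "{a, b} \<noteq> {v, w}"
      then have "p \<in> C" unfolding C_def using 2 by fastforce
      then show False using that by simp
    qed
    then have "a = v \<and> b = w \<or> a = w \<and> b = v" by (auto simp: doubleton_eq_iff)
    then have "p = ed v w u \<or> p = ed v w (1 - u)" using 2 ed_rev'[OF vw] by auto
    then show ?thesis using 2(2) by auto
  qed
  have t0C: "\<gamma> t0 \<notin> C"
  proof
    assume "\<gamma> t0 \<in> C"
    moreover have nV: "\<gamma> t0 \<notin> V" using ed_notin_V[OF vw u0(1)] u0(2) by simp
    ultimately have "\<gamma> t0 \<in> (\<Union>(a, b)\<in>{(a, b). adj a b \<and> {a, b} \<noteq> {v, w}}. ed a b ` {0..1})"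
      unfolding C_def by blast
    then obtain z where "z \<in> {(a, b). adj a b \<and> {a, b} \<noteq> {v, w}}" "\<gamma> t0 \<in> (case z of (a, b) \<Rightarrow> ed a b ` {0..1})"
      by (rule UN_E)
    then obtain a b x where ab: "adj a b" "{a, b} \<noteq> {v, w}" "x \<in> {0..1}" "\<gamma> t0 = ed a b x"
      by (cases z) blast
    then have "x \<noteq> 0" "x \<noteq> 1" using nV ed_0 ed_1 adj_V adj_V2 by metis+
    then show False using ed_disjoint[OF vw ab(1) u0(1), of x] ab u0 by auto
  qed
  have cont: "continuous_on {a..b} \<gamma>" using \<gamma>(1) by (rule lipschitz_on_continuous_on)
  obtain r where r: "r > 0" "ball (\<gamma> t0) r \<subseteq> - C" using oC t0C openE by (metis ComplI)
  obtain e1 where e1: "e1 > 0" "\<And>t. t \<in> {a..b} \<Longrightarrow> dist t t0 < e1 \<Longrightarrow> dist (\<gamma> t) (\<gamma> t0) < r"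
    using cont t0 r(1) unfolding continuous_on_iff by metis
  have near: "\<gamma> t \<in> ed v w ` {0<..<1}" if "t \<in> {a..b}" "\<bar>t - t0\<bar> < e1" for t
  proof -
    have "\<gamma> t \<in> ball (\<gamma> t0) r" using e1(2)[of t] that by (simp add: dist_real_def dist_commute)
    then show ?thesis using r \<gamma>(2) that by (intro inC) auto
  qed
  define u where "u t = inv_into {0..1} (ed v w) (\<gamma> t)" for t
  have u: "u t \<in> {0<..<1} \<and> \<gamma> t = ed v w (u t)" if tt: "t \<in> {a..b}" "\<bar>t - t0\<bar> < e1" for t
  proof -
    obtain x where "x \<in> {0<..<1}" "\<gamma> t = ed v w x" using near[OF tt] by auto
    then show ?thesis unfolding u_def using inv_into_f_f[OF ed_inj[OF vw], of x] by auto
  qed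
  have ut0: "u t0 = u0" unfolding u_def u0(2) using u0(1) by (intro inv_into_f_f ed_inj[OF vw]) auto
  let ?I = "{a..b} \<inter> {t. \<bar>t - t0\<bar> < e1}"
  have "continuous_on (ed v w ` {0..1}) (inv_into {0..1} (ed v w))"
    by (rule continuous_on_inv[OF continuous_on_ed[OF vw]]) (use ed_inj[OF vw] in auto)
  then have cu: "continuous_on ?I u" unfolding u_def
    by (rule continuous_on_compose2) (use near in \<open>auto intro!: continuous_on_subset[OF cont]\<close>, use near in fastforce)
  obtain e' c C' where e': "e' > 0" "c > 0" "\<And>s t. s \<in> ball u0 e' \<inter> {0<..<1} \<Longrightarrow> t \<in> ball u0 e' \<inter> {0<..<1} \<Longrightarrow>
       c * dist s t \<le> dist (ed v w s) (ed v w t) \<and> dist (ed v w s) (ed v w t) \<le> C' * dist s t"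
    using ed_bilipschitz[OF vw] u0(1) unfolding locally_bilipschitz_on_def by metis
  have "t0 \<in> ?I" using t0 e1 by auto
  then obtain e2 where e2: "e2 > 0" "\<And>t. t \<in> ?I \<Longrightarrow> dist t t0 < e2 \<Longrightarrow> dist (u t) (u t0) < e'"
    using cu e'(1) unfolding continuous_on_iff by metis
  have L: "L \<ge> 0" using \<gamma>(1) by (rule lipschitz_on_nonneg)
  show ?thesis
  proof (rule that[of "min e1 e2" u "L / c"])
    show "(L / c)-lipschitz_on ({a..b} \<inter> {t. \<bar>t - t0\<bar> < min e1 e2}) u"
    proof (rule lipschitz_onI)
      fix s t assume s: "s \<in> {a..b} \<inter> {t. \<bar>t - t0\<bar> < min e1 e2}" and t: "t \<in> {a..b} \<inter> {t. \<bar>t - t0\<bar> < min e1 e2}"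
      have "u s \<in> ball u0 e' \<inter> {0<..<1}" "u t \<in> ball u0 e' \<inter> {0<..<1}"
        using u[of s] u[of t] e2(2)[of s] e2(2)[of t] s t by (auto simp: ut0 dist_commute dist_real_def)
      then have "c * dist (u s) (u t) \<le> dist (\<gamma> s) (\<gamma> t)" using e'(3) u[of s] u[of t] s t by auto
      also have "\<dots> \<le> L * dist s t" using lipschitz_onD[OF \<gamma>(1)] s t by auto
      finally show "dist (u s) (u t) \<le> L / c * dist s t" using e' by (simp add: field_simps)
    qed (use L e' in auto)
  qed (use u e1 e2 in auto)
qed

end

text \<open>Local constancy is asked inside the interval only: at its ends the path will sit at a
  vertex, and there continuity takes over.\<close>

lemma locally_constant_imp_eq:
  fixes D :: "real \<Rightarrow> real"
  assumes cont: "continuous_on {s..t} D" and st: "s < t"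
    and loc: "\<And>x. s < x \<Longrightarrow> x < t \<Longrightarrow> \<exists>d>0. \<forall>y z. s < y \<and> z < t \<and> y \<le> x \<and> x \<le> z \<and> z - y < d \<longrightarrow> D y = D z"
  shows "D s = D t"
proof -
  have eq: "D x = D y" if "s < x" "x \<le> y" "y < t" for x y
  proof -
    have "s < x \<and> y < t \<longrightarrow> D x = D y"
    proof (rule Bolzano[where P = "\<lambda>p q. x \<le> p \<and> q \<le> y \<longrightarrow> D p = D q", rule_format, THEN impI, rotated 3])
      fix p assume "x \<le> p" "p \<le> y"
      then show "\<exists>d>0. \<forall>a b. a \<le> p \<and> p \<le> b \<and> b - a < d \<longrightarrow> x \<le> a \<and> b \<le> y \<longrightarrow> D a = D b"
        using loc[of p] that by (meson less_le_trans le_less_trans)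
    qed (use that in auto)
    then show ?thesis using that by simp
  qed
  define m where "m = (s + t) / 2"
  have m: "s < m" "m < t" using st by (auto simp: m_def)
  have c: "closure {s<..<t} = {s..t}" using st by simp
  have all: "D x = D m" if "x \<in> {s..t}" for x
    by (rule continuous_constant_on_closure[of "{s<..<t}" D]) (use cont that c eq m in \<open>auto, metis le_cases\<close>)
  show ?thesis using all[of s] all[of t] st by simp
qed

lemma stieltjes_diff_exists_interval:
  assumes x: "L-lipschitz_on {a..b} x" and g: "continuous_on {a..b} g" and ab: "a \<le> b"
  obtains F where "stieltjes_diff {a..b} F g x" "continuous_on {a..b} F" "F a = c"
proof (cases "a = b")
  case True
  then show ?thesis by (intro that[of "\<lambda>_. c"]) (auto simp: stieltjes_diff_def intro!: exI[of _ 1])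
next
  case False
  then have ab: "a < b" using ab by simp
  let ?h = "\<lambda>s. a + s * (b - a)" and ?k = "\<lambda>t. (t - a) / (b - a)"
  have h: "?h s \<in> {a..b}" if "s \<in> {0..1}" for s
  proof -
    have "s * (b - a) \<le> 1 * (b - a)" "0 \<le> s * (b - a)" using that ab by (intro mult_right_mono mult_nonneg_nonneg; auto)+
    then show ?thesis by simp
  qed
  have hl: "(b - a)-lipschitz_on {0..1} ?h"
    by (rule lipschitz_onI) (use ab in \<open>auto simp: dist_real_def left_diff_distrib[symmetric] abs_mult\<close>)
  have kl: "(1 / (b - a))-lipschitz_on {a..b} ?k"
    by (rule lipschitz_onI) (use ab in \<open>auto simp: dist_real_def diff_divide_distrib[symmetric]\<close>)
  have k: "?k t \<in> {0..1}" "?h (?k t) = t" if "t \<in> {a..b}" for t using that ab by (auto simp: field_simps)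
  have "(L * (b - a))-lipschitz_on {0..1} (\<lambda>s. x (?h s))"
    by (rule lipschitz_on_compose2[OF hl lipschitz_on_subset[OF x]]) (use h in blast)
  then obtain F where F: "stieltjes_diff {0..1} F (\<lambda>s. g (?h s)) (\<lambda>s. x (?h s))" "F 0 = c" "continuous_on {0..1} F"
  proof (rule stieltjes_diff_exists)
    show "continuous_on {0..1} (\<lambda>s. g (?h s))"
      by (rule continuous_on_compose2[OF g]) (use h in \<open>auto intro!: continuous_intros\<close>)
  qed blast
  show ?thesis
  proof (rule that[of "\<lambda>t. F (?k t)"])
    have "stieltjes_diff {a..b} (\<lambda>t. F (?k t)) (\<lambda>t. g (?h (?k t))) (\<lambda>t. x (?h (?k t)))"
      by (rule stieltjes_diff_comp[OF F(1) kl]) (use k in blast)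
    then show "stieltjes_diff {a..b} (\<lambda>t. F (?k t)) g x" by (rule stieltjes_diff_cong) (use k in auto)
    show "continuous_on {a..b} (\<lambda>t. F (?k t))"
      by (rule continuous_on_compose2[OF F(3)]) (use k ab in \<open>auto intro!: continuous_intros\<close>)
  qed (use F in simp)
qed

section \<open>Primitives of one-forms on stars\<close>

context lipschitz_graph begin

text \<open>The relation \<open>dg = f dc\<close>, tested along every Lipschitz path since the star
  carries no derivative of its own. Continuity up to the closed star allows \<open>g\<close> to
  enter the integrand of the next component of a system.\<close>

definition local_primitive :: "'a \<Rightarrow> ('a \<Rightarrow> real) \<Rightarrow> ('a \<Rightarrow> real) \<Rightarrow> ('a \<Rightarrow> real) \<Rightarrow> bool"
  where "local_primitive v f c g \<longleftrightarrow> continuous_on (closed_star v) g \<and>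
    (\<forall>a b L \<gamma>. L-lipschitz_on {a..b} \<gamma> \<and> \<gamma> ` {a..b} \<subseteq> star v \<longrightarrow>
      stieltjes_diff {a..b} (\<lambda>t. g (\<gamma> t)) (\<lambda>t. f (\<gamma> t)) (\<lambda>t. c (\<gamma> t)))"

text \<open>A star has no cycles, so integrating outwards along each edge from the value 0 at
  \<open>v\<close> gives a well-defined function, continuous by gluing along finitely many compact
  edges.\<close>

lemma local_primitive_exists_edgewise:
  assumes v: "v \<in> V" and f: "continuous_on (closed_star v) f" and c: "1-lipschitz_on UNIV c"
  obtains g where "continuous_on (closed_star v) g"
    "\<And>w. adj v w \<Longrightarrow> stieltjes_diff {0..1} (\<lambda>u. g (ed v w u)) (\<lambda>u. f (ed v w u)) (\<lambda>u. c (ed v w u))"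
proof -
  have "\<exists>G. stieltjes_diff {0..1} G (\<lambda>u. f (ed v w u)) (\<lambda>u. c (ed v w u)) \<and> G 0 = 0 \<and> continuous_on {0..1} G"
    if w: "adj v w" for w
  proof -
    obtain L where L: "L-lipschitz_on {0..1} (ed v w)" using ed_lipschitz[OF w] by blast
    have "(1 * L)-lipschitz_on {0..1} (\<lambda>u. c (ed v w u))"
      by (rule lipschitz_on_compose2[OF L lipschitz_on_subset[OF c]]) simp
    moreover have "continuous_on {0..1} (\<lambda>u. f (ed v w u))"
      by (rule continuous_on_compose2[OF f continuous_on_ed[OF w]]) (use w in \<open>auto simp: closed_star_def\<close>)
    ultimately show ?thesis by (metis stieltjes_diff_exists)
  qed
  then obtain G where G: "\<And>w. adj v w \<Longrightarrow> stieltjes_diff {0..1} (G w) (\<lambda>u. f (ed v w u)) (\<lambda>u. c (ed v w u))"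
    "\<And>w. adj v w \<Longrightarrow> G w 0 = 0" "\<And>w. adj v w \<Longrightarrow> continuous_on {0..1} (G w)" by metis
  \<comment> \<open>Off \<open>v\<close> the edge and the coordinate of a point are unique, so the
    choice is harmless; at \<open>v\<close>, which lies on all edges, the value is fixed
    separately.\<close>
  define g where "g p = (if p = v then 0 else (let (w, u) = (SOME (w, u). adj v w \<and> u \<in> {0..1} \<and> p = ed v w u) in G w u))" for p
  have g: "g (ed v w u) = G w u" if w: "adj v w" and u: "u \<in> {0..1}" for w u
  proof (cases "ed v w u = v")
    case True
    then have "u = 0" using ed_coord_unique[OF w w u, of 0] ed_0[OF w] by simp
    then show ?thesis using True G(2)[OF w] by (simp add: g_def)
  next
    case False
    define x where "x = (SOME (w', u'). adj v w' \<and> u' \<in> {0..1} \<and> ed v w u = ed v w' u')"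
    have "case x of (w', u') \<Rightarrow> adj v w' \<and> u' \<in> {0..1} \<and> ed v w u = ed v w' u'"
      unfolding x_def by (rule someI[of _ "(w, u)"]) (use w u in auto)
    then obtain w' u' where x: "x = (w', u')" "adj v w'" "u' \<in> {0..1}" "ed v w u = ed v w' u'" by (cases x) auto
    have "u = u'" "u = 0 \<or> w = w'" using ed_coord_unique[OF w x(2) u x(3,4)] by auto
    moreover have "u \<noteq> 0" using False ed_0[OF w] by auto
    ultimately show ?thesis using False x(1) unfolding g_def x_def[symmetric] by simp
  qed
  have gc: "continuous_on (ed v w ` {0..1}) g" if w: "adj v w" for w
  proof -
    have inv: "continuous_on (ed v w ` {0..1}) (inv_into {0..1} (ed v w))"
      by (rule continuous_on_inv[OF continuous_on_ed[OF w]]) (use ed_inj[OF w] in auto)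
    have "continuous_on (ed v w ` {0..1}) (\<lambda>p. G w (inv_into {0..1} (ed v w) p))"
      by (rule continuous_on_compose2[OF G(3)[OF w] inv]) (auto simp: inv_into_f_f[OF ed_inj[OF w]])
    then show ?thesis
      by (rule continuous_on_cong[THEN iffD1, rotated -1]) (use g[OF w] in \<open>auto simp: inv_into_f_f[OF ed_inj[OF w]]\<close>)
  qed
  have "continuous_on (\<Union>w\<in>{w. adj v w}. ed v w ` {0..1}) g"
    by (rule continuous_on_closed_Union) (use finite_adj(2) compact_ed gc in \<open>auto intro: compact_imp_closed\<close>)
  moreover have "closed (\<Union>w\<in>{w. adj v w}. ed v w ` {0..1})"
    by (rule closed_UN) (use finite_adj(2) compact_ed in \<open>auto intro: compact_imp_closed\<close>)
  ultimately have "continuous_on ({v} \<union> (\<Union>w\<in>{w. adj v w}. ed v w ` {0..1})) g"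
    by (intro continuous_on_closed_Un) auto
  then have "continuous_on (closed_star v) g" by (simp add: closed_star_def)
  moreover have "stieltjes_diff {0..1} (\<lambda>u. g (ed v w u)) (\<lambda>u. f (ed v w u)) (\<lambda>u. c (ed v w u))" if "adj v w" for w
    by (rule stieltjes_diff_cong[OF G(1)[OF that]]) (use g that in auto)
  ultimately show ?thesis using that by blast
qed

text \<open>Along a path in a star, \<open>g \<circ> \<gamma>\<close> and the genuine primitive differ by a function \<open>D\<close> which is
  locally constant where \<open>\<gamma> \<noteq> v\<close>, and which satisfies \<open>D t - D s = o(t - s)\<close> when
  \<open>\<gamma> s = \<gamma> t = v\<close>; no control of \<open>g\<close> near \<open>v\<close> beyond continuity is needed.\<close>

lemma edgewise_imp_local_primitive:
  assumes v: "v \<in> V" and f: "continuous_on (closed_star v) f" and c: "1-lipschitz_on UNIV c"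
    and g: "continuous_on (closed_star v) g"
    and gG: "\<And>w. adj v w \<Longrightarrow> stieltjes_diff {0..1} (\<lambda>u. g (ed v w u)) (\<lambda>u. f (ed v w u)) (\<lambda>u. c (ed v w u))"
    and \<gamma>: "L-lipschitz_on {a..b} \<gamma>" "\<gamma> ` {a..b} \<subseteq> star v"
  shows "stieltjes_diff {a..b} (\<lambda>t. g (\<gamma> t)) (\<lambda>t. f (\<gamma> t)) (\<lambda>t. c (\<gamma> t))"
proof (cases "a \<le> b")
  case False
  then show ?thesis by (auto simp: stieltjes_diff_def intro: exI[of _ 1])
next
  case ab: True
  have \<gamma>c: "continuous_on {a..b} \<gamma>" using \<gamma>(1) by (rule lipschitz_on_continuous_on)
  have cs: "\<gamma> ` {a..b} \<subseteq> closed_star v" using \<gamma>(2) star_subset_closed_star by blast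
  have fc: "continuous_on {a..b} (\<lambda>t. f (\<gamma> t))" by (rule continuous_on_compose2[OF f \<gamma>c cs])
  have gc: "continuous_on {a..b} (\<lambda>t. g (\<gamma> t))" by (rule continuous_on_compose2[OF g \<gamma>c cs])
  have cl: "(1 * L)-lipschitz_on {a..b} (\<lambda>t. c (\<gamma> t))"
    by (rule lipschitz_on_compose2[OF \<gamma>(1) lipschitz_on_subset[OF c]]) simp
  obtain F where F: "stieltjes_diff {a..b} F (\<lambda>t. f (\<gamma> t)) (\<lambda>t. c (\<gamma> t))" "continuous_on {a..b} F"
    using stieltjes_diff_exists_interval[OF cl fc ab] by metis
  define D where "D t = g (\<gamma> t) - F t" for t
  have Dc: "continuous_on {a..b} D" unfolding D_def by (intro continuous_intros gc F)
  have loc: "\<exists>d>0. \<forall>y z. a \<le> y \<and> z \<le> b \<and> y \<le> x \<and> x \<le> z \<and> z - y < d \<longrightarrow> D y = D z"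
    if x: "x \<in> {a..b}" "\<gamma> x \<noteq> v" for x
  proof -
    obtain w u0 where w: "adj v w" "u0 \<in> {0..<1}" "\<gamma> x = ed v w u0" 
    proof -
      have "\<gamma> x \<in> star v" using \<gamma>(2) x(1) by blast
      then show thesis using x(2) that by (auto simp: star_def)
    qed
    have u0: "u0 \<in> {0<..<1}" using w x ed_0[OF w(1)] by (cases "u0 = 0") auto
    have \<gamma>\<Gamma>: "\<gamma> ` {a..b} \<subseteq> \<Gamma>" using cs closed_star_subset[OF v] by blast
    obtain e u M where e: "e > 0" "\<And>t. t \<in> {a..b} \<Longrightarrow> \<bar>t - x\<bar> < e \<Longrightarrow> u t \<in> {0<..<1} \<and> \<gamma> t = ed v w (u t)"
      "M-lipschitz_on ({a..b} \<inter> {t. \<bar>t - x\<bar> < e}) u"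
      using lift_to_edge[OF \<gamma>(1) \<gamma>\<Gamma> x(1) w(1) u0 w(3)] by metis
    have "D y = D z" if yz: "a \<le> y" "z \<le> b" "y \<le> x" "x \<le> z" "z - y < e" for y z
    proof -
      have sub: "{y..z} \<subseteq> {a..b} \<inter> {t. \<bar>t - x\<bar> < e}" using yz by auto
      have u: "u t \<in> {0<..<1} \<and> \<gamma> t = ed v w (u t)" if "t \<in> {y..z}" for t using e(2)[of t] sub that by blast
      then have "u ` {y..z} \<subseteq> {0..1}" by fastforce
      with gG[OF w(1)] lipschitz_on_subset[OF e(3) sub]
      have "stieltjes_diff {y..z} (\<lambda>t. g (ed v w (u t))) (\<lambda>t. f (ed v w (u t))) (\<lambda>t. c (ed v w (u t)))"
        by (rule stieltjes_diff_comp)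
      then have "stieltjes_diff {y..z} (\<lambda>t. g (\<gamma> t)) (\<lambda>t. f (\<gamma> t)) (\<lambda>t. c (\<gamma> t))"
        by (rule stieltjes_diff_cong) (simp_all add: u)
      moreover have "stieltjes_diff {y..z} F (\<lambda>t. f (\<gamma> t)) (\<lambda>t. c (\<gamma> t))"
        by (rule stieltjes_diff_subset[OF F(1)]) (use yz in auto)
      ultimately have "g (\<gamma> z) - g (\<gamma> y) = F z - F y"
        by (rule stieltjes_diff_unique) (use yz in auto)
      then show ?thesis by (simp add: D_def)
    qed
    then show ?thesis using e(1) by (intro exI[of _ e]) auto
  qed
  \<comment> \<open>Between two consecutive visits to \<open>v\<close> the difference
    \<open>D\<close> is constant, the visits themselves being covered by continuity.\<close>
  have noV: "D s = D t" if stb: "a \<le> s" "s \<le> t" "t \<le> b" "\<And>x. s < x \<Longrightarrow> x < t \<Longrightarrow> \<gamma> x \<noteq> v" for s t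
  proof (cases "s = t")
    case False
    show ?thesis
    proof (rule locally_constant_imp_eq[where D = D and s = s and t = t])
      show "continuous_on {s..t} D" by (rule continuous_on_subset[OF Dc]) (use stb in auto)
      show "s < t" using False stb by simp
      fix x assume x: "s < x" "x < t"
      obtain d where "d > 0" "\<And>y z. a \<le> y \<and> z \<le> b \<and> y \<le> x \<and> x \<le> z \<and> z - y < d \<Longrightarrow> D y = D z"
        using loc[of x] stb(4)[OF x] x stb(1-3) by auto
      then show "\<exists>d>0. \<forall>y z. s < y \<and> z < t \<and> y \<le> x \<and> x \<le> z \<and> z - y < d \<longrightarrow> D y = D z"
        using stb(1-3) by (intro exI[of _ d]) auto
    qed
  qed simp
  have small: "\<exists>d>0. \<forall>s\<in>{a..b}. \<forall>t\<in>{a..b}. \<bar>t - s\<bar> < d \<longrightarrow> \<bar>D t - D s\<bar> \<le> e * \<bar>t - s\<bar>" if e: "e > 0" for e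
  proof -
    obtain d where d: "d > 0" "\<And>s t. \<lbrakk>s \<in> {a..b}; t \<in> {a..b}; \<bar>t - s\<bar> < d\<rbrakk> \<Longrightarrow>
       \<bar>F t - F s - f (\<gamma> s) * (c (\<gamma> t) - c (\<gamma> s))\<bar> \<le> e * \<bar>t - s\<bar>" using stieltjes_diffE[OF F(1) e] by blast
    have le: "\<bar>D t - D s\<bar> \<le> e * (t - s)" if st: "a \<le> s" "s \<le> t" "t \<le> b" "t - s < d" for s t
    proof (cases "\<exists>x\<in>{s..t}. \<gamma> x = v")
      case False
      then have "D s = D t" by (intro noV) (use st in auto)
      then show ?thesis using e st by simp
    next
      case True
      \<comment> \<open>The first and the last visit to \<open>v\<close> in \<open>[s, t]\<close>
        are singled out. Outside them \<open>D\<close> is constant; between them \<open>g\<close>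
        and \<open>c\<close> return to their values at \<open>v\<close>, so only the error term of
        \<open>F\<close> is left.\<close>
      define H where "H = {x \<in> {s..t}. \<gamma> x = v}"
      have "closed H"
        using continuous_closed_preimage_constant[OF continuous_on_subset[OF \<gamma>c, of "{s..t}"], of v] st
        by (auto simp: H_def)
      moreover have "bounded H" unfolding H_def by (rule bounded_subset[of "{s..t}"]) auto
      ultimately have H: "compact H" "H \<noteq> {}" using True by (auto simp: compact_eq_bounded_closed H_def)
      obtain p where p: "p \<in> H" "\<And>x. x \<in> H \<Longrightarrow> p \<le> x" using compact_attains_inf[OF H] by blast
      obtain q where q: "q \<in> H" "\<And>x. x \<in> H \<Longrightarrow> x \<le> q" using compact_attains_sup[OF H] by blast
      have pq: "s \<le> p" "p \<le> q" "q \<le> t" "\<gamma> p = v" "\<gamma> q = v" using p q by (auto simp: H_def)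
      have before: "\<gamma> x \<noteq> v" if "s < x" "x < p" for x
        using p(2)[of x] that pq by (auto simp: H_def)
      have after: "\<gamma> x \<noteq> v" if "q < x" "x < t" for x
        using q(2)[of x] that pq by (auto simp: H_def)
      have "D s = D p" by (rule noV) (use pq st before in auto)
      moreover have "D q = D t" by (rule noV) (use pq st after in auto)
      moreover have "\<bar>D q - D p\<bar> \<le> e * (q - p)" using d(2)[of p q] pq st by (simp add: D_def abs_minus_commute)
      moreover have "e * (q - p) \<le> e * (t - s)" using pq e by (intro mult_left_mono) auto
      ultimately show ?thesis by simp
    qed
    show ?thesis
    proof (intro exI[of _ d] conjI ballI impI)
      fix s t assume "s \<in> {a..b}" "t \<in> {a..b}" "\<bar>t - s\<bar> < d"
      then show "\<bar>D t - D s\<bar> \<le> e * \<bar>t - s\<bar>" using le[of s t] le[of t s] by (cases "s \<le> t") (auto simp: abs_minus_commute)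
    qed (fact d)
  qed
  have "D t = D a" if "t \<in> {a..b}" for t
    by (rule small_increments_imp_const[OF small that]) (use ab in auto)
  then have "F t + D a = g (\<gamma> t)" if "t \<in> {a..b}" for t using that by (simp add: D_def algebra_simps)
  then show ?thesis using stieltjes_diff_cong[OF stieltjes_diff_add_const[OF F(1), of "D a"]] by auto
qed

lemma local_primitive_add_const:
  "local_primitive v f c g \<Longrightarrow> local_primitive v f c (\<lambda>p. g p + k)"
  unfolding local_primitive_def by (auto intro!: continuous_intros stieltjes_diff_add_const)

lemma local_primitive_exists:
  assumes v: "v \<in> V" and f: "continuous_on (closed_star v) f" and c: "1-lipschitz_on UNIV c"
  obtains g where "local_primitive v f c g" "g p = k"
proof -
  obtain g where "local_primitive v f c g"
  proof (rule local_primitive_exists_edgewise[OF v f c])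
    fix g assume g: "continuous_on (closed_star v) g"
      "\<And>w. adj v w \<Longrightarrow> stieltjes_diff {0..1} (\<lambda>u. g (ed v w u)) (\<lambda>u. f (ed v w u)) (\<lambda>u. c (ed v w u))"
    then show thesis using edgewise_imp_local_primitive[OF v f c g] by (intro that) (auto simp: local_primitive_def)
  qed
  from local_primitive_add_const[OF this, of "k - g p"] show ?thesis by (rule that) simp
qed

end

section \<open>Lipschitz paths in stars and in their overlaps\<close>

context lipschitz_graph begin

lemma star_path_from_vertex:
  assumes "v \<in> V" "p \<in> star v"
  obtains \<gamma> L where "L-lipschitz_on {0..1::real} \<gamma>" "\<gamma> ` {0..1} \<subseteq> star v" "\<gamma> 0 = v" "\<gamma> 1 = p"
proof (cases "p = v")
  case True
  have "0-lipschitz_on {0..1::real} (\<lambda>_. v)" by (rule lipschitz_on_constant)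
  then show ?thesis by (rule that) (use True in \<open>auto simp: star_def\<close>)
next
  case False
  then obtain w u where w: "adj v w" "u \<in> {0..<1}" "p = ed v w u" using assms(2) by (auto simp: star_def)
  obtain L where L: "L-lipschitz_on {0..1} (ed v w)" using ed_lipschitz[OF w(1)] by blast
  have tu: "t * u \<in> {0..<1}" if "t \<in> {0..1}" for t
  proof -
    have "t * u \<le> 1 * u" using that w(2) by (intro mult_right_mono) auto
    then show ?thesis using that w(2) by auto
  qed
  have "1-lipschitz_on {0..1} (\<lambda>t. t * u)"
    by (rule lipschitz_onI) (use w(2) in \<open>auto simp: dist_real_def left_diff_distrib[symmetric] abs_mult intro!: mult_left_le\<close>)
  then have "(L * 1)-lipschitz_on {0..1} (\<lambda>t. ed v w (t * u))"
    by (rule lipschitz_on_compose2[OF _ lipschitz_on_subset[OF L]]) (use tu in fastforce)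
  then show ?thesis
    by (rule that) (use tu w ed_0[OF w(1)] in \<open>auto simp: star_def\<close>)
qed

text \<open>The only vertex in a star is its centre, so a common point of two stars lies inside an
  edge; that edge is determined by the point and must start at both centres, in its two
  orientations.\<close>

lemma star_overlap:
  assumes "v \<in> V" "v' \<in> V" "v \<noteq> v'" and x: "x \<in> star v" "x \<in> star v'"
  shows "adj v v' \<and> (\<exists>u\<in>{0<..<1}. x = ed v v' u)"
proof -
    have nV: "x \<notin> V"
    proof
      assume "x \<in> V"
      have "x = y" if y: "x \<in> star y" for y
      proof (rule ccontr)
        assume "x \<noteq> y"
        then obtain w u where w: "adj y w" "u \<in> {0..<1}" "x = ed y w u" using y by (auto simp: star_def)
        then show False using \<open>x \<in> V\<close> \<open>x \<noteq> y\<close> ed_0[of y w] ed_notin_V[of y w u] by (cases "u = 0") auto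
      qed
      then show False using x assms(3) by auto
    qed
    have int: "\<exists>w u. adj y w \<and> u \<in> {0<..<1} \<and> x = ed y w u" if y: "x \<in> star y" "y \<in> V" for y
    proof -
      obtain w u where w: "adj y w" "u \<in> {0..<1}" "x = ed y w u" using y nV by (auto simp: star_def)
      then have "u \<noteq> 0" using nV ed_0[OF w(1)] y(2) by auto
      then show ?thesis using w by (intro exI[of _ w] exI[of _ u]) auto
    qed
    obtain w u where w: "adj v w" "u \<in> {0<..<1}" "x = ed v w u" using int[OF x(1) assms(1)] by blast
    obtain w' u' where w': "adj v' w'" "u' \<in> {0<..<1}" "x = ed v' w' u'" using int[OF x(2) assms(2)] by blast
    have "w = v'" using ed_disjoint[OF w(1) w'(1) w(2) w'(2)] w(3) w'(3) assms(3) by auto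
    then show ?thesis using w by blast
qed

text \<open>In a simple graph two overlapping stars share a single open edge. Its connectedness
  makes local solutions agree on the whole overlap as soon as they agree at one point.\<close>

lemma overlap_path:
  assumes "v \<in> V" "v' \<in> V" "v \<noteq> v'" "p \<in> star v" "p \<in> star v'" "q \<in> star v" "q \<in> star v'"
  obtains \<gamma> L where "L-lipschitz_on {0..1::real} \<gamma>" "\<gamma> ` {0..1} \<subseteq> star v" "\<gamma> ` {0..1} \<subseteq> star v'" "\<gamma> 0 = p" "\<gamma> 1 = q"
proof -
  note overlap = star_overlap[OF assms(1-3)]
  obtain u where u: "u \<in> {0<..<1}" "p = ed v v' u" using overlap[of p] assms by blast
  obtain u' where u': "u' \<in> {0<..<1}" "q = ed v v' u'" using overlap[of q] assms by blast
  have vv: "adj v v'" using overlap[of p] assms by blast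
  obtain L where L: "L-lipschitz_on {0..1} (ed v v')" using ed_lipschitz[OF vv] by blast
  let ?h = "\<lambda>t. (1 - t) * u + t * u'"
  have h: "?h t \<in> {0<..<1}" if "t \<in> {0..1}" for t
    using convexD_alt[of "{0<..<1::real}" u u' t] u u' that by (simp del: greaterThanLessThan_iff)
  have "1-lipschitz_on {0..1} ?h"
  proof (rule lipschitz_onI)
    fix s t :: real
    have "?h s - ?h t = (s - t) * (u' - u)" by (simp add: algebra_simps)
    moreover have "\<bar>s - t\<bar> * \<bar>u' - u\<bar> \<le> \<bar>s - t\<bar> * 1" using u u' by (intro mult_left_mono) auto
    ultimately show "dist (?h s) (?h t) \<le> 1 * dist s t" by (simp add: dist_real_def abs_mult)
  qed simp
  then have lip: "(L * 1)-lipschitz_on {0..1} (\<lambda>t. ed v v' (?h t))"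
    by (rule lipschitz_on_compose2[OF _ lipschitz_on_subset[OF L]]) (use h in fastforce)
  have both: "ed v v' (?h t) \<in> star v \<and> ed v v' (?h t) \<in> star v'" if "t \<in> {0..1}" for t
  proof
    show "ed v v' (?h t) \<in> star v" using h[OF that] vv by (force simp: star_def)
    have "ed v v' (?h t) = ed v' v (1 - ?h t)" using ed_rev'[OF vv, of "1 - ?h t"] by simp
    moreover have "1 - ?h t \<in> {0..<1}" using h[OF that] by auto
    ultimately show "ed v v' (?h t) \<in> star v'" unfolding star_def using adj_sym[OF vv] by blast
  qed
  show ?thesis by (rule that[OF lip]) (use both u u' in blast, use both in blast, use u u' in auto)
qed

end

section \<open>Transport by triangular systems\<close>

locale graph_system = lipschitz_graph \<Gamma> V adj ed
  for \<Gamma> V :: "'a::euclidean_space set" and adj ed +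
  fixes n :: nat and f c :: "nat \<Rightarrow> 'a \<Rightarrow> real"
  assumes f_cont: "j < n \<Longrightarrow> continuous_on UNIV (f j)"
    and c_lipschitz: "j < n \<Longrightarrow> 1-lipschitz_on UNIV (c j)"
begin

definition path_solution :: "real \<Rightarrow> real \<Rightarrow> (real \<Rightarrow> 'a) \<Rightarrow> (nat \<Rightarrow> real \<Rightarrow> real) \<Rightarrow> bool"
  where "path_solution a b \<gamma> z \<longleftrightarrow> (\<forall>s\<in>{a..b}. \<forall>t\<in>{a..b}. z 0 s = z 0 t) \<and>
    (\<forall>j<n. stieltjes_diff {a..b} (z (Suc j)) (\<lambda>t. z j t * f j (\<gamma> t)) (\<lambda>t. c j (\<gamma> t)))"

definition local_solution :: "'a \<Rightarrow> (nat \<Rightarrow> 'a \<Rightarrow> real) \<Rightarrow> bool"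
  where "local_solution v Z \<longleftrightarrow> (\<exists>k. Z 0 = (\<lambda>_. k)) \<and>
    (\<forall>j<n. local_primitive v (\<lambda>p. Z j p * f j p) (c j) (Z (Suc j)))"

text \<open>States are functions on all natural numbers of which only the components up to
  \<open>n\<close> carry meaning, so equality is relaxed accordingly.\<close>

definition eqn :: "(nat \<Rightarrow> real) \<Rightarrow> (nat \<Rightarrow> real) \<Rightarrow> bool"
  where "eqn z z' \<longleftrightarrow> (\<forall>j\<le>n. z j = z' j)"

lemma eqn_refl: "eqn z z" and eqn_sym: "eqn z z' \<Longrightarrow> eqn z' z"
  and eqn_trans: "eqn z z' \<Longrightarrow> eqn z' z'' \<Longrightarrow> eqn z z''"
  by (auto simp: eqn_def)

lemma path_solution_subset:
  "path_solution a b \<gamma> z \<Longrightarrow> {a'..b'} \<subseteq> {a..b} \<Longrightarrow> path_solution a' b' \<gamma> z"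
  unfolding path_solution_def by (meson stieltjes_diff_subset subsetD)

text \<open>The system is triangular, so uniqueness reduces to that of one primitive at a time. The
  point \<open>s\<close> may lie anywhere, so states are determined forwards and backwards.\<close>

lemma path_solution_unique:
  assumes z: "path_solution a b \<gamma> z" "path_solution a b \<gamma> z'" and s: "s \<in> {a..b}" "eqn (\<lambda>j. z j s) (\<lambda>j. z' j s)"
    and t: "t \<in> {a..b}"
  shows "eqn (\<lambda>j. z j t) (\<lambda>j. z' j t)"
proof -
  have "j \<le> n \<Longrightarrow> \<forall>t\<in>{a..b}. z j t = z' j t" for j
  proof (induction j)
    case 0
    then show ?case using z s unfolding path_solution_def eqn_def by (metis le0)
  next
    case (Suc j)
    have 1: "stieltjes_diff {a..b} (z (Suc j)) (\<lambda>t. z j t * f j (\<gamma> t)) (\<lambda>t. c j (\<gamma> t))"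
      and 2: "stieltjes_diff {a..b} (z' (Suc j)) (\<lambda>t. z' j t * f j (\<gamma> t)) (\<lambda>t. c j (\<gamma> t))"
      using z Suc unfolding path_solution_def by auto
    from 2 have 3: "stieltjes_diff {a..b} (z' (Suc j)) (\<lambda>t. z j t * f j (\<gamma> t)) (\<lambda>t. c j (\<gamma> t))"
      by (rule stieltjes_diff_cong) (use Suc in auto)
    show ?case
    proof
      fix t assume "t \<in> {a..b}"
      from stieltjes_diff_unique[OF 1 3 s(1) this] show "z (Suc j) t = z' (Suc j) t"
        using s(2) Suc.prems by (simp add: eqn_def)
    qed
  qed
  then show ?thesis using t by (auto simp: eqn_def)
qed

lemma local_solution_path:
  assumes "local_solution v Z" "L-lipschitz_on {a..b} \<gamma>" "\<gamma> ` {a..b} \<subseteq> star v"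
  shows "path_solution a b \<gamma> (\<lambda>j t. Z j (\<gamma> t))"
  unfolding path_solution_def
proof (intro conjI ballI allI impI)
  show "Z 0 (\<gamma> s) = Z 0 (\<gamma> t)" for s t using assms(1) unfolding local_solution_def by auto
  fix j assume "j < n"
  then have "local_primitive v (\<lambda>p. Z j p * f j p) (c j) (Z (Suc j))" using assms(1) unfolding local_solution_def by simp
  then show "stieltjes_diff {a..b} (\<lambda>t. Z (Suc j) (\<gamma> t)) (\<lambda>t. Z j (\<gamma> t) * f j (\<gamma> t)) (\<lambda>t. c j (\<gamma> t))"
    using assms(2,3) unfolding local_primitive_def by auto
qed

lemma local_solution_exists:
  assumes v: "v \<in> V"
  obtains Z where "local_solution v Z" "eqn (\<lambda>j. Z j p) z"
proof -
  have "m \<le> n \<Longrightarrow> \<exists>Z. (\<exists>k. Z 0 = (\<lambda>_. k)) \<and> continuous_on (closed_star v) (Z m) \<and>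
      (\<forall>j<m. local_primitive v (\<lambda>p. Z j p * f j p) (c j) (Z (Suc j))) \<and> (\<forall>j\<le>m. Z j p = z j)" for m
  proof (induction m)
    case 0
    show ?case by (rule exI[of _ "\<lambda>_ _. z 0"]) auto
  next
    case (Suc m)
    then obtain Z where Z: "\<exists>k. Z 0 = (\<lambda>_. k)" "continuous_on (closed_star v) (Z m)"
      "\<And>j. j < m \<Longrightarrow> local_primitive v (\<lambda>p. Z j p * f j p) (c j) (Z (Suc j))" "\<And>j. j \<le> m \<Longrightarrow> Z j p = z j" by auto
    have "continuous_on (closed_star v) (\<lambda>p. Z m p * f m p)"
      using Z(2) f_cont[of m] Suc.prems by (intro continuous_intros) (auto intro: continuous_on_subset)
    then obtain g where g: "local_primitive v (\<lambda>p. Z m p * f m p) (c m) g" "g p = z (Suc m)"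
      using local_primitive_exists[OF v _ c_lipschitz] Suc.prems by (metis Suc_le_lessD)
    then have gc: "continuous_on (closed_star v) g" by (simp add: local_primitive_def)
    show ?case
      by (rule exI[of _ "Z(Suc m := g)"]) (use Z g gc in \<open>auto simp: less_Suc_eq le_Suc_eq\<close>)
  qed
  from this[OF order_refl] show ?thesis using that unfolding local_solution_def eqn_def by blast
qed

lemma local_solutions_agree:
  assumes v: "v \<in> V" "v' \<in> V" and Z: "local_solution v Z" "local_solution v' Z'"
    and p: "p \<in> star v" "p \<in> star v'" and q: "q \<in> star v" "q \<in> star v'" and e: "eqn (\<lambda>j. Z j p) (\<lambda>j. Z' j p)"
  shows "eqn (\<lambda>j. Z j q) (\<lambda>j. Z' j q)"
proof (cases "v = v'")
  case True
  \<comment> \<open>Two points of a star are compared through the centre; one leg, run in either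
    direction, is treated here.\<close>
  have 1: "eqn (\<lambda>j. Z j x) (\<lambda>j. Z' j x)"
    if xy: "x \<in> star v" "y \<in> star v" "eqn (\<lambda>j. Z j y) (\<lambda>j. Z' j y)" "x = v \<or> y = v" for x y
  proof -
    obtain r where r: "r \<in> star v" "x = v \<and> y = r \<or> x = r \<and> y = v" using xy by blast
    obtain \<gamma> L where \<gamma>: "L-lipschitz_on {0..1::real} \<gamma>" "\<gamma> ` {0..1} \<subseteq> star v" "\<gamma> 0 = v" "\<gamma> 1 = r"
      using star_path_from_vertex[OF v(1) r(1)] .
    note s = local_solution_path[OF Z(1) \<gamma>(1,2)] local_solution_path[OF Z(2)[folded True] \<gamma>(1,2)]
    show ?thesis
      using path_solution_unique[OF s, of 0 1] path_solution_unique[OF s, of 1 0] r(2) xy(3) \<gamma>(3,4) by auto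
  qed
  have "v \<in> star v" by (simp add: star_def)
  then show ?thesis using 1[of v p] 1[of q v] p q e by blast
next
  case False
  obtain \<gamma> L where \<gamma>: "L-lipschitz_on {0..1::real} \<gamma>" "\<gamma> ` {0..1} \<subseteq> star v" "\<gamma> ` {0..1} \<subseteq> star v'" "\<gamma> 0 = p" "\<gamma> 1 = q"
    using overlap_path[OF v False p q] .
  show ?thesis
    using path_solution_unique[OF local_solution_path[OF Z(1) \<gamma>(1,2)] local_solution_path[OF Z(2) \<gamma>(1,3)], of 0 1] e \<gamma>(4,5)
    by simp
qed

text \<open>A relation instead of a function: independence of the star and of the local solution is
  a theorem, and it holds up to \<open>eqn\<close> only.\<close>

definition transport :: "'a \<Rightarrow> (nat \<Rightarrow> real) \<Rightarrow> 'a \<Rightarrow> (nat \<Rightarrow> real) \<Rightarrow> bool"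
  where "transport p z q z' \<longleftrightarrow> (\<exists>v\<in>V. \<exists>Z. local_solution v Z \<and> p \<in> star v \<and> q \<in> star v \<and>
    eqn (\<lambda>j. Z j p) z \<and> eqn (\<lambda>j. Z j q) z')"

lemma transport_functional:
  assumes "transport p z q z1" "transport p z' q z2" "eqn z z'"
  shows "eqn z1 z2"
proof -
  obtain v Z where 1: "v \<in> V" "local_solution v Z" "p \<in> star v" "q \<in> star v" "eqn (\<lambda>j. Z j p) z" "eqn (\<lambda>j. Z j q) z1"
    using assms(1) unfolding transport_def by blast
  obtain v' Z' where 2: "v' \<in> V" "local_solution v' Z'" "p \<in> star v'" "q \<in> star v'" "eqn (\<lambda>j. Z' j p) z'" "eqn (\<lambda>j. Z' j q) z2"
    using assms(2) unfolding transport_def by blast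
  have "eqn (\<lambda>j. Z j q) (\<lambda>j. Z' j q)"
    by (rule local_solutions_agree[OF 1(1) 2(1) 1(2) 2(2) 1(3) 2(3) 1(4) 2(4)])
      (use 1(5) 2(5) assms(3) in \<open>auto simp: eqn_def\<close>)
  then show ?thesis using 1(6) 2(6) by (auto simp: eqn_def)
qed

lemma transport_exists:
  assumes "v \<in> V" "p \<in> star v" "q \<in> star v"
  obtains z' where "transport p z q z'"
proof -
  obtain Z where "local_solution v Z" "eqn (\<lambda>j. Z j p) z" using local_solution_exists[OF assms(1)] .
  then have "transport p z q (\<lambda>j. Z j q)" unfolding transport_def using assms eqn_refl by blast
  then show ?thesis by (rule that)
qed

text \<open>The analogue of a lift to a covering space: near each time the states are read off from
  one local solution. This makes sense for paths that are merely continuous.\<close>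

definition lifts :: "(real \<Rightarrow> 'a) \<Rightarrow> (real \<Rightarrow> nat \<Rightarrow> real) \<Rightarrow> bool"
  where "lifts p \<zeta> \<longleftrightarrow> (\<forall>t\<in>{0..1}. \<exists>e>0. \<exists>v\<in>V. \<exists>Z. local_solution v Z \<and>
    (\<forall>s\<in>{0..1}. \<bar>s - t\<bar> < e \<longrightarrow> p s \<in> star v \<and> eqn (\<zeta> s) (\<lambda>j. Z j (p s))))"

text \<open>Agreement with the local solution of one star is passed along the segment by bisection,
  the local solutions of the lift serving as intermediaries.\<close>

lemma lifts_segment:
  assumes l: "lifts p \<zeta>" and st: "0 \<le> s" "s \<le> t" "t \<le> 1" and v: "v \<in> V" "p ` {s..t} \<subseteq> star v"
  shows "transport (p s) (\<zeta> s) (p t) (\<zeta> t)"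
proof -
  obtain Z where Z: "local_solution v Z" "eqn (\<lambda>j. Z j (p s)) (\<zeta> s)" using local_solution_exists[OF v(1)] .
  have "s \<le> s \<and> t \<le> t \<longrightarrow> eqn (\<lambda>j. Z j (p s)) (\<zeta> s) \<longrightarrow> eqn (\<lambda>j. Z j (p t)) (\<zeta> t)"
  proof (rule Bolzano[where P = "\<lambda>x y. s \<le> x \<and> y \<le> t \<longrightarrow> eqn (\<lambda>j. Z j (p x)) (\<zeta> x) \<longrightarrow> eqn (\<lambda>j. Z j (p y)) (\<zeta> y)", OF st(2)])
    fix r assume r: "s \<le> r" "r \<le> t"
    then have "r \<in> {0..1}" using st by auto
    then obtain e v' Z' where e: "e > 0" "v' \<in> V" "local_solution v' Z'"
      "\<And>x. x \<in> {0..1} \<Longrightarrow> \<bar>x - r\<bar> < e \<Longrightarrow> p x \<in> star v' \<and> eqn (\<zeta> x) (\<lambda>j. Z' j (p x))"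
      using l unfolding lifts_def by meson
    show "\<exists>d>0. \<forall>x y. x \<le> r \<and> r \<le> y \<and> y - x < d \<longrightarrow> s \<le> x \<and> y \<le> t \<longrightarrow> eqn (\<lambda>j. Z j (p x)) (\<zeta> x) \<longrightarrow> eqn (\<lambda>j. Z j (p y)) (\<zeta> y)"
    proof (intro exI[of _ e] conjI allI impI)
      fix x y assume xy: "x \<le> r \<and> r \<le> y \<and> y - x < e" "s \<le> x \<and> y \<le> t" "eqn (\<lambda>j. Z j (p x)) (\<zeta> x)"
      have x: "p x \<in> star v'" "eqn (\<zeta> x) (\<lambda>j. Z' j (p x))" using e(4)[of x] xy st by auto
      have y: "p y \<in> star v'" "eqn (\<zeta> y) (\<lambda>j. Z' j (p y))" using e(4)[of y] xy st by auto
      have sv: "p x \<in> star v" "p y \<in> star v" using v(2) xy r by auto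
      have "eqn (\<lambda>j. Z j (p y)) (\<lambda>j. Z' j (p y))"
        by (rule local_solutions_agree[OF v(1) e(2) Z(1) e(3) sv(1) x(1) sv(2) y(1)]) (rule eqn_trans[OF xy(3) x(2)])
      then show "eqn (\<lambda>j. Z j (p y)) (\<zeta> y)" using y(2) eqn_trans eqn_sym by blast
    qed (fact e)
  qed auto
  then have "eqn (\<lambda>j. Z j (p t)) (\<zeta> t)" using Z(2) by simp
  moreover have "p s \<in> star v" "p t \<in> star v" using v(2) st by auto
  ultimately show ?thesis unfolding transport_def using v(1) Z by blast
qed

lemma stays_in_star:
  assumes p: "path p" "path_image p \<subseteq> \<Gamma>" and v: "v \<in> V" and t: "t \<in> {0..1}" "p t \<in> star v"
  obtains e where "e > 0" "\<And>s. s \<in> {0..1} \<Longrightarrow> \<bar>s - t\<bar> < e \<Longrightarrow> p s \<in> star v"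
proof -
  obtain U where U: "open U" "star v = \<Gamma> \<inter> U" using star_open[OF v] .
  obtain r where r: "r > 0" "ball (p t) r \<subseteq> U" using U t(2) openE by blast
  obtain e where e: "e > 0" "\<And>s. s \<in> {0..1} \<Longrightarrow> dist s t < e \<Longrightarrow> dist (p s) (p t) < r"
    using p(1) t(1) r(1) unfolding path_def continuous_on_iff by metis
  show ?thesis
  proof (rule that[OF e(1)])
    fix s assume s: "s \<in> {0..1}" "\<bar>s - t\<bar> < e"
    then have "p s \<in> U" using e(2)[of s] r(2) by (auto simp: dist_real_def dist_commute)
    then show "p s \<in> star v" using U(2) p(2) s(1) by (auto simp: path_image_def)
  qed
qed

text \<open>For a short time the path stays in one star, where the local solution through its
  current state must follow the given solution by uniqueness.\<close>

lemma path_solution_lifts: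
  assumes \<gamma>: "L-lipschitz_on {0..1} \<gamma>" "\<gamma> ` {0..1} \<subseteq> \<Gamma>" and z: "path_solution 0 1 \<gamma> z"
  shows "lifts \<gamma> (\<lambda>t j. z j t)"
  unfolding lifts_def
proof
  fix t :: real assume t: "t \<in> {0..1}"
  have p: "path \<gamma>" "path_image \<gamma> \<subseteq> \<Gamma>" using \<gamma> lipschitz_on_continuous_on by (auto simp: path_def path_image_def)
  obtain v where v: "v \<in> V" "\<gamma> t \<in> star v" using star_cover \<gamma>(2) t by blast
  obtain e where e: "v \<in> V" "e > 0" "\<And>s. s \<in> {0..1} \<Longrightarrow> \<bar>s - t\<bar> < e \<Longrightarrow> \<gamma> s \<in> star v"
    using stays_in_star[OF p v(1) t v(2)] v(1) by metis
  obtain Z where Z: "local_solution v Z" "eqn (\<lambda>j. Z j (\<gamma> t)) (\<lambda>j. z j t)" using local_solution_exists[OF e(1)] .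
  have "eqn (\<lambda>j. z j s) (\<lambda>j. Z j (\<gamma> s))" if s: "s \<in> {0..1}" "\<bar>s - t\<bar> < e" for s
  proof -
    let ?a = "min s t" and ?b = "max s t"
    have sub: "{?a..?b} \<subseteq> {0..1}" using s t by auto
    have "\<gamma> ` {?a..?b} \<subseteq> star v"
    proof (rule image_subsetI)
      fix x assume "x \<in> {?a..?b}"
      then show "\<gamma> x \<in> star v" using s t by (intro e(3)) (auto simp: min_def max_def split: if_splits)
    qed
    from local_solution_path[OF Z(1) lipschitz_on_subset[OF \<gamma>(1) sub] this]
    show ?thesis by (rule path_solution_unique[OF path_solution_subset[OF z sub], where s = t]) (use Z(2) eqn_sym in auto)
  qed
  then show "\<exists>e>0. \<exists>v\<in>V. \<exists>Z. local_solution v Z \<and>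
      (\<forall>s\<in>{0..1}. \<bar>s - t\<bar> < e \<longrightarrow> \<gamma> s \<in> star v \<and> eqn (\<lambda>j. z j s) (\<lambda>j. Z j (\<gamma> s)))"
    using e Z by blast
qed

lemma chain_exists:
  assumes "\<And>i. i < N \<Longrightarrow> \<exists>v\<in>V. H i \<in> star v \<and> H (Suc i) \<in> star v"
  shows "\<exists>S. S 0 = z \<and> (\<forall>i<N. transport (H i) (S i) (H (Suc i)) (S (Suc i)))"
  using assms
proof (induction N)
  case (Suc N)
  then obtain S where S: "S 0 = z" "\<And>i. i < N \<Longrightarrow> transport (H i) (S i) (H (Suc i)) (S (Suc i))" by auto
  obtain v where "v \<in> V" "H N \<in> star v" "H (Suc N) \<in> star v" using Suc.prems[of N] by auto
  then obtain z' where "transport (H N) (S N) (H (Suc N)) z'" using transport_exists by metis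
  then show ?case by (intro exI[of _ "S(Suc N := z')"]) (use S in \<open>auto simp: less_Suc_eq\<close>)
qed auto

text \<open>The four corners of a grid square lie in one star, and a single local solution there
  shows that the transports around the square commute.\<close>

lemma grid_step:
  assumes sq: "\<And>i. i < N \<Longrightarrow> \<exists>v\<in>V. H i \<in> star v \<and> H (Suc i) \<in> star v \<and> H' i \<in> star v \<and> H' (Suc i) \<in> star v"
    and S: "\<And>i. i < N \<Longrightarrow> transport (H i) (S i) (H (Suc i)) (S (Suc i))"
    and S': "\<And>i. i < N \<Longrightarrow> transport (H' i) (S' i) (H' (Suc i)) (S' (Suc i))"
    and start: "transport (H 0) (S 0) (H' 0) (S' 0)"
  shows "i \<le> N \<Longrightarrow> transport (H i) (S i) (H' i) (S' i)"
proof (induction i)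
  case (Suc i)
  then have IH: "transport (H i) (S i) (H' i) (S' i)" and i: "i < N" by auto
  obtain v where v: "v \<in> V" "H i \<in> star v" "H (Suc i) \<in> star v" "H' i \<in> star v" "H' (Suc i) \<in> star v" using sq[OF i] by blast
  obtain Z where Z: "local_solution v Z" "eqn (\<lambda>j. Z j (H i)) (S i)" using local_solution_exists[OF v(1)] .
  have tr: "transport x (\<lambda>j. Z j x) y (\<lambda>j. Z j y)" if "x \<in> star v" "y \<in> star v" for x y
    unfolding transport_def using that v(1) Z(1) eqn_refl by blast
  have 1: "eqn (\<lambda>j. Z j (H (Suc i))) (S (Suc i))" by (rule transport_functional[OF tr[OF v(2,3)] S[OF i] Z(2)])
  have 2: "eqn (\<lambda>j. Z j (H' i)) (S' i)" by (rule transport_functional[OF tr[OF v(2,4)] IH Z(2)])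
  have 3: "eqn (\<lambda>j. Z j (H' (Suc i))) (S' (Suc i))" by (rule transport_functional[OF tr[OF v(4,5)] S'[OF i] 2])
  show ?case unfolding transport_def using v Z(1) 1 3 by blast
qed (rule start)

text \<open>Any two points of \<open>\<Gamma>\<close> at distance less than the Lebesgue number of the cover by stars have a
  well-defined transport between them, so the transport along a path is read off a fine grid.\<close>

theorem lifts_homotopy_invariant:
  assumes hom: "homotopic_paths \<Gamma> p q" and lp: "lifts p \<zeta>" and lq: "lifts q \<xi>" and e: "eqn (\<zeta> 0) (\<xi> 0)"
  shows "eqn (\<zeta> 1) (\<xi> 1)"
proof -
  obtain h :: "real \<times> real \<Rightarrow> 'a" where h: "continuous_on ({0..1} \<times> {0..1}) h" "h ` ({0..1} \<times> {0..1}) \<subseteq> \<Gamma>"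
    "\<And>x. x \<in> {0..1} \<Longrightarrow> h (0, x) = p x" "\<And>x. x \<in> {0..1} \<Longrightarrow> h (1, x) = q x"
    "\<And>t. t \<in> {0..1} \<Longrightarrow> h (t, 0) = p 0" "\<And>t. t \<in> {0..1} \<Longrightarrow> h (t, 1) = p 1"
  proof -
    obtain h :: "real \<times> real \<Rightarrow> 'a" where h: "continuous_on ({0..1} \<times> {0..1}) h" "h \<in> {0..1} \<times> {0..1} \<rightarrow> \<Gamma>"
      "\<forall>x\<in>{0..1}. h (0, x) = p x" "\<forall>x\<in>{0..1}. h (1, x) = q x"
      "\<forall>t\<in>{0..1}. pathstart (h \<circ> Pair t) = pathstart p \<and> pathfinish (h \<circ> Pair t) = pathfinish p"
      using hom unfolding homotopic_paths by blast
    then show thesis by (intro that[of h]) (auto simp: pathstart_def pathfinish_def Pi_iff)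
  qed
  obtain \<delta> where \<delta>: "\<delta> > 0" "\<And>S. S \<subseteq> \<Gamma> \<Longrightarrow> S \<noteq> {} \<Longrightarrow> (\<And>x y. x \<in> S \<Longrightarrow> y \<in> S \<Longrightarrow> dist x y < \<delta>) \<Longrightarrow> \<exists>v\<in>V. S \<subseteq> star v"
    using star_lebesgue_number by metis
  have "uniformly_continuous_on ({0..1} \<times> {0..1}) h"
    using h(1) by (intro compact_uniformly_continuous compact_Times) auto
  then obtain d where d: "d > 0" "\<And>x y. x \<in> {0..1} \<times> {0..1} \<Longrightarrow> y \<in> {0..1} \<times> {0..1} \<Longrightarrow> dist y x < d \<Longrightarrow> dist (h y) (h x) < \<delta>"
    unfolding uniformly_continuous_on_def using \<delta>(1) by metis
  \<comment> \<open>Both coordinates of two points in a grid square differ by at most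
    \<open>1 / N\<close>, so the points are within \<open>2 / N\<close> of each other.\<close>
  obtain N where N: "N > 0" "2 / real N < d"
  proof -
    obtain N where "N > 0" "inverse (real N) < d / 2" using ex_inverse_of_nat_less[of "d / 2"] d(1) by auto
    then show thesis by (intro that[of N]) (auto simp: inverse_eq_divide)
  qed
  define g where "g i = real i / real N" for i
  have g01: "g i \<in> {0..1}" if "i \<le> N" for i using that N(1) by (simp add: g_def)
  have gS: "g i \<le> g (Suc i)" "g (Suc i) - g i = 1 / N" for i using N(1) by (auto simp: g_def field_simps)
  have g0: "g 0 = 0" and gN: "g N = 1" using N by (auto simp: g_def)
  have square: "\<exists>v\<in>V. \<forall>k\<in>{g a..g (Suc a)}. \<forall>x\<in>{g i..g (Suc i)}. h (k, x) \<in> star v" if ia: "i < N" "a < N" for i a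
  proof -
    let ?S = "h ` ({g a..g (Suc a)} \<times> {g i..g (Suc i)})"
    have sub: "{g a..g (Suc a)} \<times> {g i..g (Suc i)} \<subseteq> {0..1} \<times> {0..1}"
      using g01[of a] g01[of "Suc a"] g01[of i] g01[of "Suc i"] ia by auto
    have "dist (h x) (h y) < \<delta>" if xy: "x \<in> {g a..g (Suc a)} \<times> {g i..g (Suc i)}" "y \<in> {g a..g (Suc a)} \<times> {g i..g (Suc i)}" for x y
    proof (rule d(2))
      have "dist (fst x) (fst y) \<le> 1 / N" "dist (snd x) (snd y) \<le> 1 / N"
        using xy gS(2)[of a] gS(2)[of i] by (auto simp: dist_real_def)
      moreover have "dist x y \<le> dist (fst x) (fst y) + dist (snd x) (snd y)"
        unfolding dist_prod_def by (rule sqrt_sum_squares_le_sum) auto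
      ultimately show "dist x y < d" using N(2) by simp
    qed (use xy sub in blast)+
    then have "\<exists>v\<in>V. ?S \<subseteq> star v" using h(2) sub gS(1)[of a] gS(1)[of i] by (intro \<delta>(2)) (blast, auto)
    then show ?thesis by blast
  qed
  define H where "H a i = h (g a, g i)" for a i
  have corner: "\<exists>v\<in>V. H a i \<in> star v \<and> H a (Suc i) \<in> star v \<and> H (Suc a) i \<in> star v \<and> H (Suc a) (Suc i) \<in> star v"
    if "i < N" "a < N" for i a
    using square[OF that] gS(1)[of a] gS(1)[of i] unfolding H_def by (meson atLeastAtMost_iff order_refl)
  \<comment> \<open>The last row \<open>a = N\<close> has no square beyond it and borrows a star
    from the squares before it.\<close>
  have row: "\<exists>v\<in>V. H a i \<in> star v \<and> H a (Suc i) \<in> star v" if "i < N" "a \<le> N" for i a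
  proof (cases "a < N")
    case True then show ?thesis using corner[of i a] that by blast
  next
    case False
    then have "a = Suc (N - 1)" "N - 1 < N" using that N by auto
    then show ?thesis using corner[of i "N - 1"] that by metis
  qed
  define chain where "chain a S \<longleftrightarrow> (\<forall>i<N. transport (H a i) (S i) (H a (Suc i)) (S (Suc i)))" for a S
  have tr_refl: "transport x z x z" if x: "x \<in> \<Gamma>" for x z
  proof -
    obtain v where v: "v \<in> V" "x \<in> star v" using x star_cover by blast
    obtain Z where "local_solution v Z" "eqn (\<lambda>j. Z j x) z" using local_solution_exists[OF v(1)] .
    then show ?thesis unfolding transport_def using v by blast
  qed
  have H0: "H a 0 = p 0" and HN: "H a N = p 1" if "a \<le> N" for a
    using h(5,6)[OF g01[OF that]] by (simp_all add: H_def g0 gN)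
  have "p 0 \<in> \<Gamma>" "p 1 \<in> \<Gamma>" 
  proof -
    have "h (0, 0) \<in> \<Gamma>" "h (0, 1) \<in> \<Gamma>" using h(2) by auto
    then show "p 0 \<in> \<Gamma>" "p 1 \<in> \<Gamma>" using h(3)[of 0] h(3)[of 1] by auto
  qed
  have step: "eqn (S N) (S' N)" if S: "chain a S" "chain (Suc a) S'" "S 0 = S' 0" and a: "a < N" for a S S'
  proof -
    have "transport (H a N) (S N) (H (Suc a) N) (S' N)"
    proof (rule grid_step[where N = N and i = N and H = "H a" and H' = "H (Suc a)" and S = S and S' = S'])
      show "transport (H a 0) (S 0) (H (Suc a) 0) (S' 0)"
        using H0[of a] H0[of "Suc a"] a S(3) tr_refl[OF \<open>p 0 \<in> \<Gamma>\<close>] by simp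
    qed (use S corner[OF _ a] in \<open>auto simp: chain_def\<close>)
    then have "transport (p 1) (S N) (p 1) (S' N)" using HN[of a] HN[of "Suc a"] a by simp
    then show ?thesis using transport_functional[OF tr_refl[OF \<open>p 1 \<in> \<Gamma>\<close>] _ eqn_refl] by blast
  qed
  have chain_lift: "chain a (\<lambda>i. \<zeta>' (g i))" if l: "lifts r \<zeta>'" and a: "a = 0 \<or> a = N" and r: "\<And>x. x \<in> {0..1} \<Longrightarrow> h (g a, x) = r x" for a r \<zeta>'
    unfolding chain_def
  proof (intro allI impI)
    fix i assume i: "i < N"
    \<comment> \<open>\<open>b\<close> indexes the strip of squares adjacent to the boundary row
      \<open>a\<close>, the first or the last strip.\<close>
    define b where "b = (if a = 0 then 0 else N - 1)"
    have b: "b < N" "g a \<in> {g b..g (Suc b)}" using a N(1) gS(1)[of 0] gS(1)[of "N - 1"] by (auto simp: b_def)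
    obtain v where v: "v \<in> V" "\<And>x. x \<in> {g i..g (Suc i)} \<Longrightarrow> h (g a, x) \<in> star v" using square[OF i b(1)] b(2) by blast
    have sub: "{g i..g (Suc i)} \<subseteq> {0..1}" using g01[of i] g01[of "Suc i"] i by auto
    have "transport (r (g i)) (\<zeta>' (g i)) (r (g (Suc i))) (\<zeta>' (g (Suc i)))"
      by (rule lifts_segment[OF l _ gS(1) _ v(1)]) (use g01[of i] g01[of "Suc i"] i v(2) r sub in force)+
    then show "transport (H a i) (\<zeta>' (g i)) (H a (Suc i)) (\<zeta>' (g (Suc i)))"
      unfolding H_def using r[of "g i"] r[of "g (Suc i)"] g01[of i] g01[of "Suc i"] i by simp
  qed
  have c0: "chain 0 (\<lambda>i. \<zeta> (g i))" by (rule chain_lift[OF lp]) (use h(3) g0 in auto)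
  have cN: "chain N (\<lambda>i. \<xi> (g i))" by (rule chain_lift[OF lq]) (use h(4) gN in auto)
  have unique: "eqn (S i) (S' i)" if S: "chain a S" "chain a S'" "eqn (S 0) (S' 0)" and i: "i \<le> N" for a S S' i
    using i
  proof (induction i)
    case (Suc i)
    then show ?case using S transport_functional unfolding chain_def by (meson Suc_leD Suc_le_lessD)
  qed (rule S(3))
  \<comment> \<open>All rows start from the same state; the end state passes from each row to the
    next because the homotopy is constant on its two sides of end points.\<close>
  have "a \<le> N \<Longrightarrow> \<exists>S. chain a S \<and> S 0 = \<zeta> 0 \<and> eqn (S N) (\<zeta> 1)" for a
  proof (induction a)
    case 0
    then show ?case using c0 g0 gN eqn_refl by (intro exI[of _ "\<lambda>i. \<zeta> (g i)"]) auto
  next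
    case (Suc a)
    then obtain S where S: "chain a S" "S 0 = \<zeta> 0" "eqn (S N) (\<zeta> 1)" by auto
    obtain S' where S': "chain (Suc a) S'" "S' 0 = \<zeta> 0"
      using chain_exists[of N "H (Suc a)" "\<zeta> 0"] row[of _ "Suc a"] Suc.prems unfolding chain_def by auto
    have "eqn (S N) (S' N)" by (rule step[OF S(1) S'(1)]) (use S S' Suc.prems in auto)
    then show ?case using S S' eqn_trans eqn_sym by blast
  qed
  then obtain S where S: "chain N S" "S 0 = \<zeta> 0" "eqn (S N) (\<zeta> 1)" by blast
  have "eqn (S N) (\<xi> (g N))" by (rule unique[OF S(1) cN]) (use S e g0 in auto)
  then show ?thesis using S(3) gN eqn_trans eqn_sym by metis
qed

end

section \<open>Edge walks\<close>

context lipschitz_graph begin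

fun edge_walk :: "'a list \<Rightarrow> bool" where
  "edge_walk [] \<longleftrightarrow> False"
| "edge_walk [v] \<longleftrightarrow> v \<in> V"
| "edge_walk (v # w # vs) \<longleftrightarrow> adj v w \<and> edge_walk (w # vs)"

fun walk_path :: "'a list \<Rightarrow> real \<Rightarrow> 'a" where
  "walk_path [] = (\<lambda>_. 0)"
| "walk_path [v] = (\<lambda>_. v)"
| "walk_path (v # w # vs) = ed v w +++ walk_path (w # vs)"

fun non_backtracking :: "'a list \<Rightarrow> bool" where
  "non_backtracking (u # v # w # vs) \<longleftrightarrow> u \<noteq> w \<and> non_backtracking (v # w # vs)"
| "non_backtracking _ \<longleftrightarrow> True"

lemma pathstart_ed [simp]: "adj v w \<Longrightarrow> pathstart (ed v w) = v"
  and pathfinish_ed [simp]: "adj v w \<Longrightarrow> pathfinish (ed v w) = w"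
  unfolding pathstart_def pathfinish_def by (rule ed_0, assumption, rule ed_1, assumption)

lemma path_image_ed: "path_image (ed v w) = ed v w ` {0..1}"
  by (simp add: path_image_def)

lemma path_image_ed_closed_star: "adj v w \<Longrightarrow> path_image (ed v w) \<subseteq> closed_star v"
  by (auto simp: closed_star_def path_image_ed)

lemma path_image_ed_closed_star': "adj v w \<Longrightarrow> path_image (ed v w) \<subseteq> closed_star w"
proof -
  assume vw: "adj v w"
  have "path_image (ed w v) \<subseteq> closed_star w" by (rule path_image_ed_closed_star[OF adj_sym[OF vw]])
  then show ?thesis using ed_rev[OF vw] by (simp add: path_image_reversepath)
qed

lemma walk_path_start [simp]: "vs \<noteq> [] \<Longrightarrow> edge_walk vs \<Longrightarrow> pathstart (walk_path vs) = hd vs"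
  by (induction vs rule: walk_path.induct) (auto simp: pathstart_def joinpaths_def ed_0)

lemma walk_path_props:
  "edge_walk vs \<Longrightarrow> path (walk_path vs) \<and> path_image (walk_path vs) \<subseteq> \<Gamma> \<and> (\<exists>L. L-lipschitz_on {0..1} (walk_path vs))"
proof (induction vs rule: walk_path.induct)
  case (2 v)
  then have "v \<in> \<Gamma>" using \<Gamma>_eq by auto
  then show ?case by (auto simp: path_def path_image_def intro: lipschitz_on_constant)
next
  case (3 v w vs)
  then have vw: "adj v w" and IH: "path (walk_path (w # vs))" "path_image (walk_path (w # vs)) \<subseteq> \<Gamma>" and wk: "edge_walk (w # vs)" by auto
  obtain M where M: "M-lipschitz_on {0..1} (walk_path (w # vs))" using 3 by auto
  obtain L where L: "L-lipschitz_on {0..1} (ed v w)" using ed_lipschitz[OF vw] by blast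
  have fin: "pathfinish (ed v w) = pathstart (walk_path (w # vs))" using vw wk by simp
  have d2: "2-lipschitz_on I (\<lambda>t. 2 * t - b)" for I and b :: real
    by (rule lipschitz_onI) (simp_all add: dist_real_def abs_if)
  have l1: "(L * 2)-lipschitz_on {0..1/2} (\<lambda>t. ed v w (2 * t))"
    using lipschitz_on_compose2[OF d2[of "{0..1/2}" 0] lipschitz_on_subset[OF L]] by (simp add: image_subset_iff)
  have l2: "(M * 2)-lipschitz_on {1/2..1} (\<lambda>t. walk_path (w # vs) (2 * t - 1))"
    by (rule lipschitz_on_compose2[OF d2 lipschitz_on_subset[OF M]]) auto
  have "(max (L * 2) (M * 2))-lipschitz_on {0..1} (\<lambda>t. if t \<le> 1/2 then ed v w (2 * t) else walk_path (w # vs) (2 * t - 1))"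
    by (rule lipschitz_on_concat_max[OF l1 l2]) (use fin in \<open>simp add: pathfinish_def pathstart_def\<close>)
  then have "\<exists>K. K-lipschitz_on {0..1} (walk_path (v # w # vs))" unfolding walk_path.simps joinpaths_def by blast
  moreover have "path (walk_path (v # w # vs))" using path_ed[OF vw] IH fin by simp
  moreover have "path_image (walk_path (v # w # vs)) \<subseteq> \<Gamma>"
    unfolding walk_path.simps
    by (rule subset_path_image_join) (use IH ed_in_\<Gamma>[OF vw] in \<open>auto simp: path_image_ed\<close>)
  ultimately show ?case by blast
qed auto

text \<open>An edge and its reverse cancel up to homotopy. The drop in length makes a shortest walk
  of a homotopy class free of backtracking.\<close>

lemma backtracking_reduces:
  assumes "edge_walk vs" "\<not> non_backtracking vs"
  shows "\<exists>vs'. edge_walk vs' \<and> hd vs' = hd vs \<and> last vs' = last vs \<and> length vs' < length vs \<and>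
    homotopic_paths \<Gamma> (walk_path vs') (walk_path vs)"
  using assms
proof (induction vs rule: non_backtracking.induct)
  case (1 u v w vs)
  then have uv: "adj u v" and vw: "adj v w" and wk: "edge_walk (w # vs)" "edge_walk (v # w # vs)" by auto
  note p1 = walk_path_props[OF wk(1)] and p2 = walk_path_props[OF wk(2)]
  have i\<Gamma>: "path_image (ed u v) \<subseteq> \<Gamma>" using ed_in_\<Gamma>[OF uv] by (auto simp: path_image_ed)
  show ?case
  proof (cases "u = w")
    case True
    let ?r = "walk_path (w # vs)"
    have rev: "ed v w = reversepath (ed u v)" using ed_rev[OF uv] True by simp
    have fu: "pathstart (ed u v) = pathstart ?r" using uv wk True by simp
    have "homotopic_paths \<Gamma> (ed u v +++ (reversepath (ed u v) +++ ?r)) ((ed u v +++ reversepath (ed u v)) +++ ?r)"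
      using p1 i\<Gamma> path_ed[OF uv] fu by (intro homotopic_paths_assoc) auto
    also have "homotopic_paths \<Gamma> \<dots> (linepath (pathstart (ed u v)) (pathstart (ed u v)) +++ ?r)"
      using p1 i\<Gamma> path_ed[OF uv] fu
      by (intro homotopic_paths_join homotopic_paths_rinv) (auto simp: homotopic_paths_refl)
    also have "homotopic_paths \<Gamma> \<dots> ?r"
      using homotopic_paths_lid[of ?r \<Gamma>] p1 fu by simp
    finally have "homotopic_paths \<Gamma> (walk_path (w # vs)) (walk_path (u # v # w # vs))"
      using rev by (simp add: homotopic_paths_sym)
    then show ?thesis using wk True by (intro exI[of _ "w # vs"]) auto
  next
    case False
    then obtain vs' where vs': "edge_walk vs'" "hd vs' = v" "last vs' = last (v # w # vs)" "length vs' < length (v # w # vs)"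
      "homotopic_paths \<Gamma> (walk_path vs') (walk_path (v # w # vs))" using 1 by auto
    obtain us where us: "vs' = v # us" using vs' by (cases vs') auto
    have "homotopic_paths \<Gamma> (ed u v +++ walk_path vs') (ed u v +++ walk_path (v # w # vs))"
      using vs' path_ed[OF uv] i\<Gamma> uv by (intro homotopic_paths_join) (auto simp: homotopic_paths_refl us)
    then show ?thesis using vs' uv by (intro exI[of _ "u # vs'"]) (auto simp: us)
  qed
qed auto

text \<open>Re-anchors a connecting path at the centre of another star: a common point of both stars
  lies on the edge joining the centres, so one edge and the way back from its far end replace
  \<open>c\<close>.\<close>

lemma change_star:
  assumes vu: "v \<in> V" "u \<in> V" "v \<noteq> u" and x: "x \<in> star v" "x \<in> star u"
    and c: "path c" "path_image c \<subseteq> closed_star v" "pathstart c = v" "pathfinish c = x"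
  obtains c' where "adj v u" "path c'" "path_image c' \<subseteq> closed_star u" "pathstart c' = u" "pathfinish c' = x"
    "homotopic_paths \<Gamma> c (ed v u +++ c')"
proof -
  obtain s where s: "adj v u" "s \<in> {0<..<1}" "x = ed v u s" using star_overlap[OF vu x] by blast
  define c' where "c' = subpath 1 s (ed v u)"
  have c': "path c'" "path_image c' \<subseteq> path_image (ed v u)" "pathstart c' = u" "pathfinish c' = x"
    using s path_ed[OF s(1)] path_image_subpath_subset[of 1 s "ed v u"] by (auto simp: c'_def ed_1)
  have "homotopic_paths \<Gamma> c (ed v u +++ c')"
  proof (rule homotopic_paths_in_closed_star[OF vu(1) c(1)])
    show "path_image (ed v u +++ c') \<subseteq> closed_star v"
      using c' path_image_ed_closed_star[OF s(1)] by (intro subset_path_image_join) auto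
  qed (use c c' s path_ed[OF s(1)] in auto)
  then show ?thesis using that[OF s(1) c'(1) _ c'(3,4)] c'(2) path_image_ed_closed_star'[OF s(1)] by blast
qed

text \<open>The path is cut into pieces lying in single stars and read from its end backwards, so
  that each step prepends at most one edge to the walk already found. The induction carries a
  connecting path \<open>c\<close> from the centre of a star to the current point; a change of star
  trades \<open>c\<close> for an edge followed by a new connecting path.\<close>

theorem path_homotopic_to_walk:
  assumes p: "path p" "path_image p \<subseteq> \<Gamma>" "pathstart p \<in> V" "pathfinish p \<in> V"
  obtains vs where "edge_walk vs" "hd vs = pathstart p" "last vs = pathfinish p" "homotopic_paths \<Gamma> p (walk_path vs)"
proof -
  obtain \<delta> where \<delta>: "\<delta> > 0" "\<And>S. S \<subseteq> \<Gamma> \<Longrightarrow> S \<noteq> {} \<Longrightarrow> (\<And>x y. x \<in> S \<Longrightarrow> y \<in> S \<Longrightarrow> dist x y < \<delta>) \<Longrightarrow> \<exists>v\<in>V. S \<subseteq> star v"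
    using star_lebesgue_number by metis
  have "uniformly_continuous_on {0..1} p"
    using p(1) unfolding path_def by (intro compact_uniformly_continuous) auto
  then obtain d where d: "d > 0" "\<And>x y. x \<in> {0..1} \<Longrightarrow> y \<in> {0..1} \<Longrightarrow> dist y x < d \<Longrightarrow> dist (p y) (p x) < \<delta>"
    unfolding uniformly_continuous_on_def using \<delta>(1) by metis
  obtain N where N: "N > 0" "1 / real N < d"
  proof -
    obtain N where "N > 0" "inverse (real N) < d" using ex_inverse_of_nat_less[OF d(1)] by auto
    then show thesis by (intro that[of N]) (auto simp: inverse_eq_divide)
  qed
  define \<tau> where "\<tau> m = 1 - real m / real N" for m
  have \<tau>01: "\<tau> m \<in> {0..1}" if "m \<le> N" for m using that N(1) by (simp add: \<tau>_def)
  have \<tau>S: "\<tau> (Suc m) \<le> \<tau> m" "\<tau> m - \<tau> (Suc m) = 1 / N" for m using N(1) by (auto simp: \<tau>_def field_simps)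
  have vstar: "y = v" if y: "y \<in> V" "y \<in> star v" for y v
  proof (rule ccontr)
    assume "y \<noteq> v"
    then obtain w u where w: "adj v w" "u \<in> {0..<1}" "y = ed v w u" using y(2) by (auto simp: star_def)
    then show False using y(1) \<open>y \<noteq> v\<close> ed_0[of v w] ed_notin_V[of v w u] by (cases "u = 0") auto
  qed
  let ?b = "pathfinish p"
  have "m \<le> N \<Longrightarrow> \<forall>v\<in>V. p (\<tau> m) \<in> star v \<longrightarrow> (\<forall>c. path c \<and> path_image c \<subseteq> closed_star v \<and> pathstart c = v \<and> pathfinish c = p (\<tau> m) \<longrightarrow>
     (\<exists>vs. edge_walk vs \<and> hd vs = v \<and> last vs = ?b \<and> homotopic_paths \<Gamma> (c +++ subpath (\<tau> m) 1 p) (walk_path vs)))" for m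
  proof (induction m)
    case 0
    have t: "\<tau> 0 = 1" by (simp add: \<tau>_def)
    show ?case unfolding t
    proof (intro ballI impI allI)
      fix v c assume v: "v \<in> V" "p 1 \<in> star v" and c: "path c \<and> path_image c \<subseteq> closed_star v \<and> pathstart c = v \<and> pathfinish c = p 1"
      \<comment> \<open>The end point is a vertex, and the only vertex in a star is its
        centre.\<close>
      have b: "?b = v" using vstar[of ?b v] v p(4) by (simp add: pathfinish_def)
      then have pv: "p 1 = v" by (simp add: pathfinish_def)
      have q: "path (subpath 1 1 p)" "path_image (subpath 1 1 p) = {v}" "pathstart (subpath 1 1 p) = v" "pathfinish (subpath 1 1 p) = v"
        using p(1) pv by (auto simp: path_image_subpath intro!: path_subpath)
      have "homotopic_paths \<Gamma> (c +++ subpath 1 1 p) (\<lambda>_. v)"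
      proof (rule homotopic_paths_in_closed_star[OF v(1)])
        show "path (c +++ subpath 1 1 p)" using c q pv by simp
        show "path_image (c +++ subpath 1 1 p) \<subseteq> closed_star v"
          by (rule subset_path_image_join) (use c q in \<open>auto simp: closed_star_def\<close>)
        show "path_image (\<lambda>_::real. v) \<subseteq> closed_star v" by (auto simp: path_image_def closed_star_def)
        show "path (\<lambda>_::real. v)" by (simp add: path_def)
      qed (use c q in \<open>simp_all, simp_all add: pathstart_def pathfinish_def\<close>)
      then show "\<exists>vs. edge_walk vs \<and> hd vs = v \<and> last vs = ?b \<and> homotopic_paths \<Gamma> (c +++ subpath 1 1 p) (walk_path vs)"
        using v b by (intro exI[of _ "[v]"]) auto
    qed
  next
    case (Suc m)
    let ?t' = "\<tau> (Suc m)" and ?t = "\<tau> m"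
    have t: "?t' \<in> {0..1}" "?t \<in> {0..1}" "?t' \<le> ?t" using \<tau>01 Suc.prems \<tau>S by auto
    have "\<exists>u\<in>V. p ` {?t'..?t} \<subseteq> star u"
    proof (rule \<delta>(2))
      show "p ` {?t'..?t} \<subseteq> \<Gamma>" using p(2) t by (auto simp: path_image_def)
      show "p ` {?t'..?t} \<noteq> {}" using t by auto
      fix x y assume "x \<in> p ` {?t'..?t}" "y \<in> p ` {?t'..?t}"
      then obtain a b where ab: "a \<in> {?t'..?t}" "b \<in> {?t'..?t}" "x = p a" "y = p b" by blast
      have "\<bar>a - b\<bar> \<le> 1 / N" using ab \<tau>S(2)[of m] by auto
      then show "dist x y < \<delta>" unfolding ab using ab t N by (intro d(2)) (auto simp: dist_real_def)
    qed
    then obtain u where u: "u \<in> V" "p ` {?t'..?t} \<subseteq> star u" by blast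
    have pt: "p ?t' \<in> star u" "p ?t \<in> star u" using u t by auto
    have sub: "path_image (subpath ?t' ?t p) \<subseteq> star u" "path (subpath ?t' ?t p)" "path (subpath ?t 1 p)" "path (subpath ?t' 1 p)"
      "path_image (subpath ?t 1 p) \<subseteq> \<Gamma>" "path_image (subpath ?t' 1 p) \<subseteq> \<Gamma>" "path_image (subpath ?t' ?t p) \<subseteq> \<Gamma>"
    proof -
      have "p ` {0..1} \<subseteq> \<Gamma>" using p(2) by (simp add: path_image_def)
      then show "path_image (subpath ?t' ?t p) \<subseteq> star u" "path (subpath ?t' ?t p)" "path (subpath ?t 1 p)" "path (subpath ?t' 1 p)"
        "path_image (subpath ?t 1 p) \<subseteq> \<Gamma>" "path_image (subpath ?t' 1 p) \<subseteq> \<Gamma>" "path_image (subpath ?t' ?t p) \<subseteq> \<Gamma>"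
        using u(2) t p(1) by (auto simp: path_image_subpath intro!: path_subpath)
    qed
    have split: "homotopic_paths \<Gamma> (subpath ?t' 1 p) (subpath ?t' ?t p +++ subpath ?t 1 p)"
      using homotopic_join_subpaths[of p \<Gamma> ?t' ?t 1] p t by (auto simp: homotopic_paths_sym)
    have main: "\<exists>vs. edge_walk vs \<and> hd vs = u \<and> last vs = ?b \<and> homotopic_paths \<Gamma> (c' +++ subpath ?t' 1 p) (walk_path vs)"
      if c': "path c'" "path_image c' \<subseteq> closed_star u" "pathstart c' = u" "pathfinish c' = p ?t'" for c'
    proof -
      let ?c = "c' +++ subpath ?t' ?t p"
      have c\<Gamma>: "path_image c' \<subseteq> \<Gamma>" using c'(2) closed_star_subset[OF u(1)] by blast
      have "path ?c" "path_image ?c \<subseteq> closed_star u" "pathstart ?c = u" "pathfinish ?c = p ?t"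
        using subset_path_image_join[OF c'(2) order_trans[OF sub(1) star_subset_closed_star]] c' sub by auto
      then obtain vs where vs: "edge_walk vs" "hd vs = u" "last vs = ?b" "homotopic_paths \<Gamma> (?c +++ subpath ?t 1 p) (walk_path vs)"
        using Suc u(1) pt(2) by fastforce
      have "homotopic_paths \<Gamma> (c' +++ subpath ?t' 1 p) (c' +++ (subpath ?t' ?t p +++ subpath ?t 1 p))"
        using c' c\<Gamma> split by (intro homotopic_paths_join) (auto simp: homotopic_paths_refl)
      also have "homotopic_paths \<Gamma> \<dots> (?c +++ subpath ?t 1 p)"
        using c' c\<Gamma> sub by (intro homotopic_paths_assoc) auto
      also note vs(4)
      finally show ?thesis using vs by blast
    qed
    show ?case
    proof (intro ballI impI allI)
      fix v c assume v: "v \<in> V" "p ?t' \<in> star v"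
        and c: "path c \<and> path_image c \<subseteq> closed_star v \<and> pathstart c = v \<and> pathfinish c = p ?t'"
      show "\<exists>vs. edge_walk vs \<and> hd vs = v \<and> last vs = ?b \<and> homotopic_paths \<Gamma> (c +++ subpath ?t' 1 p) (walk_path vs)"
      proof (cases "v = u")
        case True
        then show ?thesis using main[of c] c by auto
      next
        case False
        then obtain c' where vu: "adj v u" and c': "path c'" "path_image c' \<subseteq> closed_star u" "pathstart c' = u" "pathfinish c' = p ?t'"
          "homotopic_paths \<Gamma> c (ed v u +++ c')"
          using change_star[OF v(1) u(1) _ v(2) pt(1)] c by metis
        obtain vs where vs: "edge_walk vs" "hd vs = u" "last vs = ?b" "homotopic_paths \<Gamma> (c' +++ subpath ?t' 1 p) (walk_path vs)"
          using main[OF c'(1-4)] by blast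
        obtain us where us: "vs = u # us" using vs by (cases vs) auto
        have i\<Gamma>: "path_image (ed v u) \<subseteq> \<Gamma>" using ed_in_\<Gamma>[OF vu] by (auto simp: path_image_ed)
        have c\<Gamma>: "path_image c' \<subseteq> \<Gamma>" using c'(2) closed_star_subset[OF u(1)] by blast
        have "homotopic_paths \<Gamma> (c +++ subpath ?t' 1 p) ((ed v u +++ c') +++ subpath ?t' 1 p)"
          using c' c sub by (intro homotopic_paths_join) (auto simp: homotopic_paths_refl)
        also have "homotopic_paths \<Gamma> \<dots> (ed v u +++ (c' +++ subpath ?t' 1 p))"
          using c' c\<Gamma> sub vu i\<Gamma> path_ed[OF vu] by (intro homotopic_paths_sym[OF homotopic_paths_assoc]) auto
        also have "homotopic_paths \<Gamma> \<dots> (ed v u +++ walk_path vs)"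
          using vs i\<Gamma> path_ed[OF vu] c' vu by (intro homotopic_paths_join) (auto simp: homotopic_paths_refl)
        finally show ?thesis using vs vu by (intro exI[of _ "v # vs"]) (auto simp: us)
      qed
    qed
  qed
  from this[OF order_refl]
  have *: "\<And>v c. v \<in> V \<Longrightarrow> p 0 \<in> star v \<Longrightarrow> path c \<Longrightarrow> path_image c \<subseteq> closed_star v \<Longrightarrow> pathstart c = v \<Longrightarrow> pathfinish c = p 0 \<Longrightarrow>
     \<exists>vs. edge_walk vs \<and> hd vs = v \<and> last vs = ?b \<and> homotopic_paths \<Gamma> (c +++ subpath 0 1 p) (walk_path vs)"
    using N(1) by (simp add: \<tau>_def)
  let ?a = "pathstart p"
  have "\<exists>vs. edge_walk vs \<and> hd vs = ?a \<and> last vs = ?b \<and> homotopic_paths \<Gamma> (linepath ?a ?a +++ subpath 0 1 p) (walk_path vs)"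
    by (rule *) (use p in \<open>auto simp: star_def closed_star_def pathstart_def\<close>)
  then obtain vs where vs: "edge_walk vs" "hd vs = ?a" "last vs = ?b" "homotopic_paths \<Gamma> (linepath ?a ?a +++ p) (walk_path vs)"
    by (auto simp: subpath_trivial)
  have "homotopic_paths \<Gamma> p (walk_path vs)"
    using homotopic_paths_trans[OF homotopic_paths_sym[OF homotopic_paths_lid[OF p(1,2)]] vs(4)] .
  then show ?thesis using vs that by blast
qed

lemma path_homotopic_to_reduced_walk:
  assumes p: "path p" "path_image p \<subseteq> \<Gamma>" "pathstart p \<in> V" "pathfinish p \<in> V"
  obtains vs where "edge_walk vs" "hd vs = pathstart p" "last vs = pathfinish p" "non_backtracking vs" "homotopic_paths \<Gamma> p (walk_path vs)"
proof -
  let ?P = "\<lambda>vs. edge_walk vs \<and> hd vs = pathstart p \<and> last vs = pathfinish p \<and> homotopic_paths \<Gamma> p (walk_path vs)"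
  obtain vs0 where "?P vs0" using path_homotopic_to_walk[OF p] by metis
  then obtain vs where vs: "?P vs" "\<And>vs'. ?P vs' \<Longrightarrow> length vs \<le> length vs'" using ex_has_least_nat[of ?P vs0 length] by blast
  have "non_backtracking vs"
  proof (rule ccontr)
    assume "\<not> non_backtracking vs"
    with vs(1) obtain vs' where vs': "edge_walk vs'" "hd vs' = hd vs" "last vs' = last vs" "length vs' < length vs"
      "homotopic_paths \<Gamma> (walk_path vs') (walk_path vs)" using backtracking_reduces by blast
    then have "?P vs'" using vs(1) homotopic_paths_trans homotopic_paths_sym by metis
    then show False using vs(2)[of vs'] vs'(4) by simp
  qed
  then show ?thesis using vs that by blast
qed

end

section \<open>Bump forms and the transport along a walk without backtracking\<close>

lemma stieltjes_diff_increment_bound: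
  assumes F: "stieltjes_diff {a..b} F g x" and g: "\<And>t. t \<in> {a..b} \<Longrightarrow> \<bar>g t\<bar> \<le> B" and x: "L-lipschitz_on {a..b} x" and ab: "a \<le> b"
  shows "\<bar>F b - F a\<bar> \<le> B * L * (b - a)"
proof (rule field_le_epsilon)
  fix e :: real assume e: "e > 0"
  have L: "L \<ge> 0" using x by (rule lipschitz_on_nonneg)
  define \<epsilon> where "\<epsilon> = e / (b - a + 1)"
  have \<epsilon>: "\<epsilon> > 0" using e ab by (simp add: \<epsilon>_def)
  obtain d where d: "d > 0" "\<And>s t. \<lbrakk>s \<in> {a..b}; t \<in> {a..b}; \<bar>t - s\<bar> < d\<rbrakk> \<Longrightarrow>
     \<bar>F t - F s - g s * (x t - x s)\<bar> \<le> \<epsilon> * \<bar>t - s\<bar>" using stieltjes_diffE[OF F \<epsilon>] by blast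
  have "a \<le> a \<and> b \<le> b \<longrightarrow> \<bar>F b - F a\<bar> \<le> (B * L + \<epsilon>) * (b - a)"
  proof (rule Bolzano[where P = "\<lambda>s t. a \<le> s \<and> t \<le> b \<longrightarrow> \<bar>F t - F s\<bar> \<le> (B * L + \<epsilon>) * (t - s)", OF ab])
    fix s t r assume st: "a \<le> s \<and> t \<le> b \<longrightarrow> \<bar>F t - F s\<bar> \<le> (B * L + \<epsilon>) * (t - s)"
      "a \<le> t \<and> r \<le> b \<longrightarrow> \<bar>F r - F t\<bar> \<le> (B * L + \<epsilon>) * (r - t)" "s \<le> t" "t \<le> r"
    show "a \<le> s \<and> r \<le> b \<longrightarrow> \<bar>F r - F s\<bar> \<le> (B * L + \<epsilon>) * (r - s)"
    proof
      assume "a \<le> s \<and> r \<le> b"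
      then have "\<bar>F r - F s\<bar> \<le> (B * L + \<epsilon>) * (t - s) + (B * L + \<epsilon>) * (r - t)" using st by auto
      then show "\<bar>F r - F s\<bar> \<le> (B * L + \<epsilon>) * (r - s)" by (simp add: algebra_simps)
    qed
  next
    fix y assume "a \<le> y" "y \<le> b"
    show "\<exists>d>0. \<forall>s t. s \<le> y \<and> y \<le> t \<and> t - s < d \<longrightarrow> a \<le> s \<and> t \<le> b \<longrightarrow> \<bar>F t - F s\<bar> \<le> (B * L + \<epsilon>) * (t - s)"
    proof (intro exI[of _ d] conjI allI impI)
      fix s t assume st: "s \<le> y \<and> y \<le> t \<and> t - s < d" "a \<le> s \<and> t \<le> b"
      then have "\<bar>F t - F s - g s * (x t - x s)\<bar> \<le> \<epsilon> * (t - s)" using d(2)[of s t] by auto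
      moreover have "\<bar>g s * (x t - x s)\<bar> \<le> B * (L * (t - s))" unfolding abs_mult
        using g[of s] lipschitz_onD[OF x, of t s] st L by (intro mult_mono) (auto simp: dist_real_def)
      ultimately show "\<bar>F t - F s\<bar> \<le> (B * L + \<epsilon>) * (t - s)" by (simp add: algebra_simps)
    qed (fact d)
  qed
  then have "\<bar>F b - F a\<bar> \<le> B * L * (b - a) + \<epsilon> * (b - a)" by (simp add: algebra_simps)
  also have "\<epsilon> * (b - a) \<le> e" using e ab by (simp add: \<epsilon>_def field_simps)
  finally show "\<bar>F b - F a\<bar> \<le> B * L * (b - a) + e" by simp
qed

lemma stieltjes_diff_zero:
  assumes "stieltjes_diff {a..b} F g x" "\<And>t. t \<in> {a..b} \<Longrightarrow> g t = 0" "s \<in> {a..b}" "t \<in> {a..b}"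
  shows "F s = F t"
proof -
  have "stieltjes_diff {a..b} F (\<lambda>_. 0) x" by (rule stieltjes_diff_cong[OF assms(1)]) (use assms(2) in auto)
  from stieltjes_diff_unique[OF this stieltjes_diff_const assms(3,4)] show ?thesis by simp
qed

context lipschitz_graph begin

text \<open>A coordinate that separates the images of 1/3 and 2/3, times a bump over the middle
  third of the edge. The middle third contributes exactly \<open>k\<close> times the coordinate
  difference; two short transition zones can cancel at most half of it, and elsewhere the form
  vanishes.\<close>

lemma edge_bump_form:
  assumes vw: "adj v w"
  obtains \<phi> b where "b \<in> Basis" "continuous_on UNIV \<phi>"
    "\<And>a b u. adj a b \<Longrightarrow> {a, b} \<noteq> {v, w} \<Longrightarrow> u \<in> {0..1} \<Longrightarrow> \<phi> (ed a b u) = (0::real)"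
    "\<And>F k. k \<noteq> 0 \<Longrightarrow> stieltjes_diff {0..1} F (\<lambda>u. k * \<phi> (ed v w u)) (\<lambda>u. ed v w u \<bullet> b) \<Longrightarrow> F 1 \<noteq> F 0"
proof -
  let ?h = "ed v w"
  obtain L where L: "L-lipschitz_on {0..1} ?h" using ed_lipschitz[OF vw] by blast
  have L0: "L \<ge> 0" using L by (rule lipschitz_on_nonneg)
  have "?h (1/3) \<noteq> ?h (2/3)" using inj_onD[OF ed_inj[OF vw], of "1/3" "2/3"] by auto
  then obtain b where b: "b \<in> Basis" "?h (1/3) \<bullet> b \<noteq> ?h (2/3) \<bullet> b" using euclidean_eq_iff by blast
  let ?x = "\<lambda>u. ?h u \<bullet> b"
  have x: "L-lipschitz_on {0..1} ?x"
  proof (rule lipschitz_onI)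
    fix s t :: real assume st: "s \<in> {0..1}" "t \<in> {0..1}"
    have "dist (?x s) (?x t) = \<bar>(?h s - ?h t) \<bullet> b\<bar>" by (simp add: dist_real_def inner_diff_left)
    also have "\<dots> \<le> dist (?h s) (?h t)" using Basis_le_norm[OF b(1)] by (simp add: dist_norm)
    also have "\<dots> \<le> L * dist s t" using lipschitz_onD[OF L] st by blast
    finally show "dist (?x s) (?x t) \<le> L * dist s t" .
  qed (fact L0)
  define \<Delta> where "\<Delta> = \<bar>?x (2/3) - ?x (1/3)\<bar>"
  have \<Delta>: "\<Delta> > 0" using b(2) by (simp add: \<Delta>_def)
  \<comment> \<open>\<open>1/6\<close> keeps the transition zones inside the edge; the other bound
    limits the contribution of each zone to a quarter of that of the middle third.\<close>
  define \<eta> where "\<eta> = min (1/6) (\<Delta> / (4 * (L + 1)))"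
  have \<eta>: "\<eta> > 0" "\<eta> \<le> 1/6"
    using \<Delta> L0 unfolding \<eta>_def by (simp, intro min.cobounded1)
  have "L * \<eta> \<le> (L + 1) * (\<Delta> / (4 * (L + 1)))" using \<eta> L0 by (intro mult_mono) (auto simp: \<eta>_def)
  also have "\<dots> = ((L + 1) * \<Delta>) / ((L + 1) * 4)" by (simp only: times_divide_eq_right mult_ac)
  also have "\<dots> = \<Delta> / 4" using L0 by (intro mult_divide_mult_cancel_left) simp
  finally have L\<eta>: "L * \<eta> \<le> \<Delta> / 4" .
  define K where "K = ?h ` {1/3..2/3}"
  define C where "C = (\<Union>(a, b)\<in>{(a, b). adj a b \<and> {a, b} \<noteq> {v, w}}. ed a b ` {0..1}) \<union> ?h ` ({0..1/3 - \<eta>} \<union> {2/3 + \<eta>..1})"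
  have hc: "continuous_on S ?h" if "S \<subseteq> {0..1}" for S using continuous_on_ed[OF vw] that by (rule continuous_on_subset)
  have K: "compact K" "K \<noteq> {}" unfolding K_def by (auto intro!: compact_continuous_image hc)
  have "finite {(a, b). adj a b \<and> {a, b} \<noteq> {v, w}}" by (rule finite_subset[OF _ finite_adj(1)]) auto
  then have "compact C" unfolding C_def
    using \<eta> by (intro compact_Un[OF compact_UN] compact_continuous_image hc compact_Un) (auto intro: compact_ed)
  then have C: "closed C" by (rule compact_imp_closed)
  have "K \<inter> C = {}"
  proof (rule ccontr)
    assume "K \<inter> C \<noteq> {}"
    then obtain u where u: "u \<in> {1/3..2/3}" "?h u \<in> C" unfolding K_def by blast
    then have u01: "u \<in> {0<..<1}" by auto
    have "?h u \<notin> ?h ` ({0..1/3 - \<eta>} \<union> {2/3 + \<eta>..1})"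
    proof
      assume "?h u \<in> ?h ` ({0..1/3 - \<eta>} \<union> {2/3 + \<eta>..1})"
      then obtain t where t: "t \<in> {0..1/3 - \<eta>} \<union> {2/3 + \<eta>..1}" "?h u = ?h t" by blast
      then have "u = t" using \<eta> u by (intro inj_onD[OF ed_inj[OF vw]]) auto
      then show False using t(1) u(1) \<eta> by auto
    qed
    then have "?h u \<in> (\<Union>(a, b)\<in>{(a, b). adj a b \<and> {a, b} \<noteq> {v, w}}. ed a b ` {0..1})" using u(2) unfolding C_def by blast
    then obtain z where "z \<in> {(a, b). adj a b \<and> {a, b} \<noteq> {v, w}}" "?h u \<in> (case z of (a, b) \<Rightarrow> ed a b ` {0..1})"
      by (rule UN_E)
    then obtain a b y where ab: "adj a b" "{a, b} \<noteq> {v, w}" "y \<in> {0..1}" "?h u = ed a b y" by (cases z) blast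
    have "y \<noteq> 0" "y \<noteq> 1" using ab ed_notin_V[OF vw u01] ed_0 ed_1 adj_V adj_V2 by metis+
    then show False using ed_disjoint[OF vw ab(1) u01, of y] ab by auto
  qed
  then obtain d where d: "d > 0" "\<And>p q. p \<in> K \<Longrightarrow> q \<in> C \<Longrightarrow> d \<le> dist p q"
    using separate_compact_closed[OF K(1) C] by blast
  \<comment> \<open>A tent that is 1 on the middle third \<open>K\<close> and has dropped to 0 at
    distance \<open>d\<close>, hence on \<open>C\<close>, which holds the other edges and the outer
    parts of this one.\<close>
  define \<phi> where "\<phi> p = max 0 (1 - infdist p K / d)" for p
  have \<phi>K: "\<phi> p = 1" if "p \<in> K" for p using that d by (simp add: \<phi>_def)
  have \<phi>C: "\<phi> p = 0" if "p \<in> C" for p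
  proof -
    have "d \<le> infdist p K" unfolding infdist_def using K(2) d(2) that by (auto simp: dist_commute intro!: cINF_greatest)
    then show ?thesis using d(1) by (simp add: \<phi>_def)
  qed
  have \<phi>1: "\<bar>\<phi> p\<bar> \<le> 1" for p
    using divide_nonneg_pos[OF infdist_nonneg d(1), of p K] by (simp add: \<phi>_def)
  show ?thesis
  proof (rule that[OF b(1), of \<phi>])
    show "continuous_on UNIV \<phi>" unfolding \<phi>_def by (intro continuous_intros) (use d in auto)
    show "\<phi> (ed a b u) = 0" if "adj a b" "{a, b} \<noteq> {v, w}" "u \<in> {0..1}" for a b u
      using that by (intro \<phi>C) (fastforce simp: C_def)
    fix F and k :: real assume k: "k \<noteq> 0" and F: "stieltjes_diff {0..1} F (\<lambda>u. k * \<phi> (?h u)) ?x"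
    have inc: "\<bar>F t - F s\<bar> \<le> \<bar>k\<bar> * L * (t - s)" if "0 \<le> s" "s \<le> t" "t \<le> 1" for s t
    proof (rule stieltjes_diff_increment_bound[OF stieltjes_diff_subset[OF F] _ lipschitz_on_subset[OF x]])
      show "\<bar>k * \<phi> (?h u)\<bar> \<le> \<bar>k\<bar>" for u using \<phi>1[of "?h u"] mult_left_mono[of "\<bar>\<phi> (?h u)\<bar>" 1 "\<bar>k\<bar>"] by (simp add: abs_mult)
    qed (use that in auto)
    have flat: "F s = F t" if st: "s \<in> S" "t \<in> S" "S = {0..1/3 - \<eta>} \<or> S = {2/3 + \<eta>..1}" for s t S
    proof -
      obtain a b where S: "S = {a..b}" "{a..b} \<subseteq> {0..1}" using st(3) \<eta> by auto
      show ?thesis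
        by (rule stieltjes_diff_zero[OF stieltjes_diff_subset[OF F S(2)]]) (use S that in \<open>auto intro!: \<phi>C simp: C_def\<close>)
    qed
    have "stieltjes_diff {1/3..2/3} F (\<lambda>u. k) ?x"
      by (rule stieltjes_diff_cong[OF stieltjes_diff_subset[OF F]]) (auto intro!: \<phi>K simp: K_def)
    moreover have "stieltjes_diff {1/3..2/3} (\<lambda>u. k * ?x u) (\<lambda>u. k) ?x"
      by (auto simp: stieltjes_diff_def algebra_simps intro!: exI[of _ 1])
    ultimately have "F (2/3) - F (1/3) = k * ?x (2/3) - k * ?x (1/3)" by (rule stieltjes_diff_unique) auto
    then have m: "\<bar>F (2/3) - F (1/3)\<bar> = \<bar>k\<bar> * \<Delta>" by (simp add: \<Delta>_def abs_mult[symmetric] right_diff_distrib)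
    have "\<bar>k\<bar> * (L * \<eta>) \<le> \<bar>k\<bar> * (\<Delta> / 4)" by (intro mult_left_mono L\<eta>) simp
    moreover have "\<bar>F (1/3) - F (1/3 - \<eta>)\<bar> \<le> \<bar>k\<bar> * (L * \<eta>)" using inc[of "1/3 - \<eta>" "1/3"] \<eta> by (simp add: mult.assoc)
    moreover have "\<bar>F (2/3 + \<eta>) - F (2/3)\<bar> \<le> \<bar>k\<bar> * (L * \<eta>)" using inc[of "2/3" "2/3 + \<eta>"] \<eta> by (simp add: mult.assoc)
    moreover have "F 0 = F (1/3 - \<eta>)" "F 1 = F (2/3 + \<eta>)"
      using flat[of 0 "{0..1/3 - \<eta>}" "1/3 - \<eta>"] flat[of 1 "{2/3 + \<eta>..1}" "2/3 + \<eta>"] \<eta> by auto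
    moreover have "\<bar>k\<bar> * \<Delta> > 0" using k \<Delta> by simp
    ultimately show "F 1 \<noteq> F 0" using m by auto
  qed
qed

end

context graph_system begin

definition path_transport :: "(real \<Rightarrow> 'a) \<Rightarrow> (nat \<Rightarrow> real) \<Rightarrow> (nat \<Rightarrow> real) \<Rightarrow> bool"
  where "path_transport p z z' \<longleftrightarrow> (\<exists>\<zeta>. lifts p \<zeta> \<and> eqn (\<zeta> 0) z \<and> eqn (\<zeta> 1) z')"

lemma path_transport_join:
  assumes p: "path p" "path_image p \<subseteq> \<Gamma>" and q: "path q" "path_image q \<subseteq> \<Gamma>" and pq: "pathfinish p = pathstart q"
    and tp: "path_transport p z z'" and tq: "path_transport q z' z''"
  shows "path_transport (p +++ q) z z''"
proof -
  obtain \<zeta> where \<zeta>: "lifts p \<zeta>" "eqn (\<zeta> 0) z" "eqn (\<zeta> 1) z'" using tp by (auto simp: path_transport_def)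
  obtain \<xi> where \<xi>: "lifts q \<xi>" "eqn (\<xi> 0) z'" "eqn (\<xi> 1) z''" using tq by (auto simp: path_transport_def)
  define \<omega> where "\<omega> t = (if t \<le> 1/2 then \<zeta> (2 * t) else \<xi> (2 * t - 1))" for t
  have "lifts (p +++ q) \<omega>" unfolding lifts_def
  proof
    fix t :: real assume t: "t \<in> {0..1}"
    consider "t < 1/2" | "t > 1/2" | "t = 1/2" by linarith
    then show "\<exists>e>0. \<exists>v\<in>V. \<exists>Z. local_solution v Z \<and>
       (\<forall>s\<in>{0..1}. \<bar>s - t\<bar> < e \<longrightarrow> (p +++ q) s \<in> star v \<and> eqn (\<omega> s) (\<lambda>j. Z j ((p +++ q) s)))"
    proof cases
      case 1
      obtain e v Z where e: "e > 0" "v \<in> V" "local_solution v Z"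
        "\<And>s. s \<in> {0..1} \<Longrightarrow> \<bar>s - 2 * t\<bar> < e \<Longrightarrow> p s \<in> star v \<and> eqn (\<zeta> s) (\<lambda>j. Z j (p s))"
        using \<zeta>(1)[unfolded lifts_def, rule_format, of "2 * t"] 1 t by auto
      have "(p +++ q) s \<in> star v \<and> eqn (\<omega> s) (\<lambda>j. Z j ((p +++ q) s))"
        if "s \<in> {0..1}" "\<bar>s - t\<bar> < min (e/2) (1/2 - t)" for s
      proof -
        have "s \<le> 1/2" "\<bar>2 * s - 2 * t\<bar> < e" using that 1 by (auto simp: abs_if split: if_splits)
        then show ?thesis using e(4)[of "2 * s"] that by (simp add: \<omega>_def joinpaths_def)
      qed
      then show ?thesis using e 1 by (intro exI[of _ "min (e/2) (1/2 - t)"] conjI bexI[of _ v] exI[of _ Z]) auto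
    next
      case 2
      obtain e v Z where e: "e > 0" "v \<in> V" "local_solution v Z"
        "\<And>s. s \<in> {0..1} \<Longrightarrow> \<bar>s - (2 * t - 1)\<bar> < e \<Longrightarrow> q s \<in> star v \<and> eqn (\<xi> s) (\<lambda>j. Z j (q s))"
        using \<xi>(1)[unfolded lifts_def, rule_format, of "2 * t - 1"] 2 t by auto
      have "(p +++ q) s \<in> star v \<and> eqn (\<omega> s) (\<lambda>j. Z j ((p +++ q) s))"
        if "s \<in> {0..1}" "\<bar>s - t\<bar> < min (e/2) (t - 1/2)" for s
      proof -
        have "s > 1/2" "\<bar>2 * s - 1 - (2 * t - 1)\<bar> < e" using that 2 by (auto simp: abs_if split: if_splits)
        then show ?thesis using e(4)[of "2 * s - 1"] that by (simp add: \<omega>_def joinpaths_def)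
      qed
      then show ?thesis using e 2 by (intro exI[of _ "min (e/2) (t - 1/2)"] conjI bexI[of _ v] exI[of _ Z]) auto
    next
      \<comment> \<open>At the joint the local solution belonging to \<open>p\<close> also serves
        for the start of \<open>q\<close>: both local solutions agree at the common point, hence on
        the overlap of their stars.\<close>
      case 3
      obtain e1 v Z where e1: "e1 > 0" "v \<in> V" "local_solution v Z"
        "\<And>s. s \<in> {0..1} \<Longrightarrow> \<bar>s - 1\<bar> < e1 \<Longrightarrow> p s \<in> star v \<and> eqn (\<zeta> s) (\<lambda>j. Z j (p s))"
        using \<zeta>(1)[unfolded lifts_def, rule_format, of 1] by auto
      obtain e2 v' Z' where e2: "e2 > 0" "v' \<in> V" "local_solution v' Z'"
        "\<And>s. s \<in> {0..1} \<Longrightarrow> \<bar>s - 0\<bar> < e2 \<Longrightarrow> q s \<in> star v' \<and> eqn (\<xi> s) (\<lambda>j. Z' j (q s))"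
        using \<xi>(1)[unfolded lifts_def, rule_format, of 0] by auto
      have pq': "p 1 = q 0" using pq by (simp add: pathfinish_def pathstart_def)
      have mid: "q 0 \<in> star v" "q 0 \<in> star v'" "eqn (\<zeta> 1) (\<lambda>j. Z j (q 0))" "eqn (\<xi> 0) (\<lambda>j. Z' j (q 0))"
        using e1(1) e1(4)[of 1] e2(1) e2(4)[of 0] pq' by auto
      then have ZZ: "eqn (\<lambda>j. Z j (q 0)) (\<lambda>j. Z' j (q 0))" using \<zeta>(3) \<xi>(2) by (simp add: eqn_def)
      obtain e3 where e3: "e3 > 0" "\<And>s. s \<in> {0..1} \<Longrightarrow> \<bar>s - 0\<bar> < e3 \<Longrightarrow> q s \<in> star v"
        using stays_in_star[OF q e1(2), of 0] mid(1) by auto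
      define e where "e = min (e1/2) (min (e2/2) (e3/2))"
      have "(p +++ q) s \<in> star v \<and> eqn (\<omega> s) (\<lambda>j. Z j ((p +++ q) s))" if s: "s \<in> {0..1}" "\<bar>s - t\<bar> < e" for s
      proof (cases "s \<le> 1/2")
        case True
        then have "2 * s \<in> {0..1}" "\<bar>2 * s - 1\<bar> < e1" using s 3 by (auto simp: e_def abs_if split: if_splits)
        then show ?thesis using e1(4)[of "2 * s"] True by (simp add: \<omega>_def joinpaths_def)
      next
        case False
        then have r: "2 * s - 1 \<in> {0..1}" "\<bar>2 * s - 1 - 0\<bar> < e2" "\<bar>2 * s - 1 - 0\<bar> < e3" using s 3 by (auto simp: e_def abs_if split: if_splits)
        have x: "q (2 * s - 1) \<in> star v" "q (2 * s - 1) \<in> star v'" "eqn (\<xi> (2 * s - 1)) (\<lambda>j. Z' j (q (2 * s - 1)))"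
          using e2(4)[OF r(1,2)] e3(2)[OF r(1,3)] by auto
        have "eqn (\<lambda>j. Z j (q (2 * s - 1))) (\<lambda>j. Z' j (q (2 * s - 1)))"
          by (rule local_solutions_agree[OF e1(2) e2(2) e1(3) e2(3) mid(1,2) x(1,2) ZZ])
        then show ?thesis using x False by (simp add: \<omega>_def joinpaths_def eqn_def)
      qed
      moreover have "e > 0" using e1 e2 e3 by (simp add: e_def)
      ultimately show ?thesis using e1 by (intro exI[of _ e] conjI bexI[of _ v] exI[of _ Z]) auto
    qed
  qed
  then show ?thesis unfolding path_transport_def using \<zeta>(2) \<xi>(3) by (intro exI[of _ \<omega>]) (auto simp: \<omega>_def)
qed

lemma path_solution_exists:
  assumes \<gamma>: "L-lipschitz_on {0..1} \<gamma>"
  obtains z where "path_solution 0 1 \<gamma> z" "eqn (\<lambda>j. z j 0) z0"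
proof -
  have \<gamma>c: "continuous_on {0..1} \<gamma>" using \<gamma> by (rule lipschitz_on_continuous_on)
  have "m \<le> n \<Longrightarrow> \<exists>z. (\<forall>s t. z 0 s = z 0 t) \<and> continuous_on {0..1} (z m) \<and>
      (\<forall>j<m. stieltjes_diff {0..1} (z (Suc j)) (\<lambda>t. z j t * f j (\<gamma> t)) (\<lambda>t. c j (\<gamma> t))) \<and> (\<forall>j\<le>m. z j 0 = z0 j)" for m
  proof (induction m)
    case 0
    show ?case by (rule exI[of _ "\<lambda>_ _. z0 0"]) auto
  next
    case (Suc m)
    then obtain z where z: "\<forall>s t. z 0 s = z 0 t" "continuous_on {0..1} (z m)"
      "\<And>j. j < m \<Longrightarrow> stieltjes_diff {0..1} (z (Suc j)) (\<lambda>t. z j t * f j (\<gamma> t)) (\<lambda>t. c j (\<gamma> t))" "\<And>j. j \<le> m \<Longrightarrow> z j 0 = z0 j" by auto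
    have m: "m < n" using Suc.prems by simp
    have g: "continuous_on {0..1} (\<lambda>t. z m t * f m (\<gamma> t))"
      by (intro continuous_intros z(2) continuous_on_compose2[OF f_cont[OF m] \<gamma>c]) auto
    have "(1 * L)-lipschitz_on {0..1} (\<lambda>t. c m (\<gamma> t))"
      by (rule lipschitz_on_compose2[OF \<gamma> lipschitz_on_subset[OF c_lipschitz[OF m]]]) simp
    from stieltjes_diff_exists[OF this g, of "z0 (Suc m)"] obtain F where
      F: "stieltjes_diff {0..1} F (\<lambda>t. z m t * f m (\<gamma> t)) (\<lambda>t. c m (\<gamma> t))" "F 0 = z0 (Suc m)" "continuous_on {0..1} F" .
    show ?case
      by (rule exI[of _ "z(Suc m := F)"]) (use z F in \<open>auto simp: less_Suc_eq le_Suc_eq\<close>)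
  qed
  from this[OF order_refl] show ?thesis using that unfolding path_solution_def eqn_def by blast
qed

text \<open>Invariant on reaching vertex number \<open>i\<close>: component \<open>i\<close> is
  nonzero and all later ones vanish. On the next edge \<open>f (i - 1)\<close> and
  \<open>f (i + 1)\<close> are zero because neighbouring edges of the walk differ. So component
  \<open>i\<close> keeps its value, component \<open>i + 1\<close> moves away from 0, and the
  components from \<open>i + 2\<close> on stay 0. Those before \<open>i\<close> may change
  freely.\<close>

lemma walk_transport_nonzero:
  assumes vs: "edge_walk vs" "length vs = Suc n"
    and nb: "\<And>j. j + 2 \<le> n \<Longrightarrow> vs ! j \<noteq> vs ! (j + 2)"
    and zero: "\<And>j a b u. \<lbrakk>j < n; adj a b; {a, b} \<noteq> {vs ! j, vs ! Suc j}; u \<in> {0..1}\<rbrakk> \<Longrightarrow> f j (ed a b u) = 0"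
    and nz: "\<And>j F k. \<lbrakk>j < n; k \<noteq> 0; stieltjes_diff {0..1} F (\<lambda>u. k * f j (ed (vs ! j) (vs ! Suc j) u)) (\<lambda>u. c j (ed (vs ! j) (vs ! Suc j) u))\<rbrakk> \<Longrightarrow> F 1 \<noteq> F 0"
  shows "\<lbrakk>i \<le> n; z i \<noteq> 0; \<And>j. i < j \<Longrightarrow> j \<le> n \<Longrightarrow> z j = 0\<rbrakk> \<Longrightarrow> \<exists>z'. path_transport (walk_path (drop i vs)) z z' \<and> z' n \<noteq> 0"
proof (induction i arbitrary: z rule: measure_induct_rule[where f = "\<lambda>i. n - i"])
  case (less i)
  have walk: "edge_walk (drop k vs)" if "k \<le> n" for k
    using that
  proof (induction k)
    case (Suc k)
    have d: "drop k vs = vs ! k # drop (Suc k) vs" "drop (Suc k) vs = vs ! Suc k # drop (Suc (Suc k)) vs"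
      using Suc.prems vs(2) by (simp_all add: Cons_nth_drop_Suc)
    then have "edge_walk (vs ! k # vs ! Suc k # drop (Suc (Suc k)) vs)" using Suc by simp
    then show ?case unfolding d(2) by simp
  qed (use vs in simp)
  show ?case
  proof (cases "i = n")
    case True
    have d: "drop i vs = [vs ! n]" using True vs(2) by (simp add: Cons_nth_drop_Suc[symmetric])
    have V: "vs ! n \<in> V" using walk[of n] d True by simp
    have "path_solution 0 1 (\<lambda>_. vs ! n) (\<lambda>j _. z j)"
      unfolding path_solution_def by (auto simp: stieltjes_diff_def intro!: exI[of _ 1])
    then have "lifts (\<lambda>_. vs ! n) (\<lambda>t j. z j)"
      using V \<Gamma>_eq by (intro path_solution_lifts[OF lipschitz_on_constant]) auto
    then show ?thesis unfolding d using less.prems True by (auto simp: path_transport_def intro!: exI[of _ z] exI[of _ "\<lambda>t j. z j"] eqn_refl)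
  next
    case False
    then have i: "i < n" using less.prems by simp
    define v w where "v = vs ! i" and "w = vs ! Suc i"
    have d: "drop i vs = v # w # drop (Suc (Suc i)) vs" "drop (Suc i) vs = w # drop (Suc (Suc i)) vs"
      using i vs(2) by (simp_all add: Cons_nth_drop_Suc v_def w_def)
    have vw: "adj v w" and wk: "edge_walk (drop (Suc i) vs)" using walk[of i] i d by auto
    obtain L where L: "L-lipschitz_on {0..1} (ed v w)" using ed_lipschitz[OF vw] by blast
    obtain y where y: "path_solution 0 1 (ed v w) y" "eqn (\<lambda>j. y j 0) z" using path_solution_exists[OF L] .
    have y0: "y j 0 = z j" if "j \<le> n" for j using y(2) that by (simp add: eqn_def)
    have yd: "stieltjes_diff {0..1} (y (Suc j)) (\<lambda>t. y j t * f j (ed v w t)) (\<lambda>t. c j (ed v w t))" if "j < n" for j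
      using y(1) that by (simp add: path_solution_def)
    have yi: "y i t = z i" if t: "t \<in> {0..1}" for t
    proof (cases i)
      case 0
      then show ?thesis using y(1) y0[of 0] t unfolding path_solution_def by (metis atLeastAtMost_iff le0 order_refl zero_le_one)
    next
      case (Suc k)
      have "vs ! k \<noteq> w" using nb[of k] i Suc by (simp add: w_def)
      \<comment> \<open>Since the walk does not turn back at \<open>v\<close>, the current edge is
        not the previous one, on which alone \<open>f k\<close> lives.\<close>
      then have ne: "{v, w} \<noteq> {vs ! k, vs ! Suc k}" using Suc by (auto simp: v_def doubleton_eq_iff)
      have "y (Suc k) t = y (Suc k) 0"
        by (rule stieltjes_diff_zero[OF yd]) (use zero[OF _ vw ne] t i Suc in auto)
      then show ?thesis using y0[of i] i Suc by simp
    qed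
    have yi1: "y (Suc i) 1 \<noteq> y (Suc i) 0"
    proof (rule nz[OF i less.prems(2), folded v_def w_def])
      show "stieltjes_diff {0..1} (y (Suc i)) (\<lambda>u. z i * f i (ed v w u)) (\<lambda>u. c i (ed v w u))"
        by (rule stieltjes_diff_cong[OF yd[OF i]]) (use yi in auto)
    qed
    have tail: "y j t = 0" if "j \<ge> i + 2" "j \<le> n" "t \<in> {0..1}" for j t
      using that
    proof (induction j arbitrary: t rule: nat_induct_at_least[of "i + 2"])
      case base
      have "vs ! i \<noteq> vs ! (i + 2)" using nb[of i] base by simp
      then have ne: "{v, w} \<noteq> {vs ! Suc i, vs ! Suc (Suc i)}" by (auto simp: v_def w_def doubleton_eq_iff)
      have "y (Suc (Suc i)) t = y (Suc (Suc i)) 0"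
        by (rule stieltjes_diff_zero[OF yd]) (use zero[OF _ vw ne] base in auto)
      then show ?case using y0[of "i + 2"] less.prems(3)[of "i + 2"] base by simp
    next
      \<comment> \<open>The edge may occur again later in the walk, so \<open>f j\<close> can be
        nonzero here; component \<open>j\<close>, however, is already known to vanish.\<close>
      case (Suc j)
      have "y (Suc j) t = y (Suc j) 0"
        by (rule stieltjes_diff_zero[OF yd]) (use Suc in auto)
      then show ?case using y0[of "Suc j"] less.prems(3)[of "Suc j"] Suc by simp
    qed
    have "\<exists>z'. path_transport (walk_path (drop (Suc i) vs)) (\<lambda>j. y j 1) z' \<and> z' n \<noteq> 0"
    proof (rule less.IH)
      show "y (Suc i) 1 \<noteq> 0" using yi1 y0[of "Suc i"] less.prems(3)[of "Suc i"] i by simp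
      show "y j 1 = 0" if "Suc i < j" "j \<le> n" for j using tail[of j 1] that by simp
    qed (use i in auto)
    then obtain z' where z': "path_transport (walk_path (drop (Suc i) vs)) (\<lambda>j. y j 1) z'" "z' n \<noteq> 0" by blast
    have ed\<Gamma>: "path_image (ed v w) \<subseteq> \<Gamma>" using ed_in_\<Gamma>[OF vw] by (auto simp: path_image_ed)
    have "path_transport (ed v w) z (\<lambda>j. y j 1)" unfolding path_transport_def
      using path_solution_lifts[OF L _ y(1)] ed\<Gamma> y(2) eqn_refl by (intro exI[of _ "\<lambda>t j. y j t"]) (auto simp: path_image_def)
    then have "path_transport (ed v w +++ walk_path (drop (Suc i) vs)) z z'"
      using walk_path_props[OF wk] ed\<Gamma> path_ed[OF vw] vw d wk z'(1)
      by (intro path_transport_join[of "ed v w" _ z "\<lambda>j. y j 1" z']) auto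
    then show ?thesis using z'(2) d by auto
  qed
qed

end

context lipschitz_graph begin

lemma non_backtracking_nth:
  "non_backtracking vs \<Longrightarrow> j + 2 < length vs \<Longrightarrow> vs ! j \<noteq> vs ! (j + 2)"
proof (induction vs arbitrary: j rule: non_backtracking.induct)
  case (1 u v w vs)
  then show ?case by (cases j) auto
qed auto

text \<open>A walk without backtracking, with \<open>n > 0\<close> edges and homotopic to the path,
  would carry the state \<open>(1, 0, ..., 0)\<close> to one with nonzero last component, whereas
  the hypothesis provides a solution along the path that returns to
  \<open>(1, 0, ..., 0)\<close>.\<close>

theorem null_homotopic_if_systems_closed:
  fixes \<gamma> :: "real \<Rightarrow> 'a"
  assumes \<gamma>: "L-lipschitz_on {0..1} \<gamma>" "\<gamma> ` {0..1} \<subseteq> \<Gamma>" "\<gamma> 0 = x" "\<gamma> 1 = x" "x \<in> V"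
    and sys: "\<And>n f b. \<lbrakk>\<And>j. j < n \<Longrightarrow> continuous_on UNIV (f j :: 'a \<Rightarrow> real); \<And>j. j < n \<Longrightarrow> b j \<in> Basis\<rbrakk> \<Longrightarrow>
      \<exists>z. (\<forall>s\<in>{0..1}. \<forall>t\<in>{0..1}. z 0 s = z 0 t) \<and>
        (\<forall>j<n. stieltjes_diff {0..1} (z (Suc j)) (\<lambda>t. z j t * f j (\<gamma> t)) (\<lambda>t. \<gamma> t \<bullet> b j)) \<and>
        (\<forall>j\<le>n. z j 0 = (if j = 0 then 1 else 0) \<and> z j 1 = (if j = 0 then 1 else (0::real)))"
  shows "homotopic_paths \<Gamma> \<gamma> (\<lambda>_. x)"
proof -
  have p: "path \<gamma>" "path_image \<gamma> \<subseteq> \<Gamma>" "pathstart \<gamma> = x" "pathfinish \<gamma> = x"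
    using \<gamma> lipschitz_on_continuous_on by (auto simp: path_def path_image_def pathstart_def pathfinish_def)
  obtain vs where vs: "edge_walk vs" "hd vs = x" "last vs = x" "non_backtracking vs" "homotopic_paths \<Gamma> \<gamma> (walk_path vs)"
    using path_homotopic_to_reduced_walk[OF p(1,2)] p(3,4) \<gamma>(5) by metis
  have ne: "vs \<noteq> []" using vs(1) by auto
  define n where "n = length vs - 1"
  have len: "length vs = Suc n" using ne by (simp add: n_def)
  have "n = 0"
  proof (rule ccontr)
    assume n0: "n \<noteq> 0"
    have adj: "adj (vs ! j) (vs ! Suc j)" if "j < n" for j
    proof -
      have "edge_walk us \<Longrightarrow> Suc j < length us \<Longrightarrow> adj (us ! j) (us ! Suc j)" for us
        by (induction us arbitrary: j rule: edge_walk.induct) (auto simp: nth_Cons split: nat.splits)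
      then show ?thesis using vs(1) that len by simp
    qed
    define BP where "BP j \<phi> b \<longleftrightarrow> b \<in> Basis \<and> continuous_on UNIV \<phi> \<and>
       (\<forall>a b u. adj a b \<longrightarrow> {a, b} \<noteq> {vs ! j, vs ! Suc j} \<longrightarrow> u \<in> {0..1} \<longrightarrow> \<phi> (ed a b u) = (0::real)) \<and>
       (\<forall>F k. k \<noteq> 0 \<longrightarrow> stieltjes_diff {0..1} F (\<lambda>u. k * \<phi> (ed (vs ! j) (vs ! Suc j) u)) (\<lambda>u. ed (vs ! j) (vs ! Suc j) u \<bullet> b) \<longrightarrow> F 1 \<noteq> F 0)"
      for j and \<phi> :: "'a \<Rightarrow> real" and b
    have "\<exists>\<phi> b. BP j \<phi> b" if "j < n" for j
      by (rule edge_bump_form[OF adj[OF that]]) (unfold BP_def, blast)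
    then obtain f b where "\<And>j. j < n \<Longrightarrow> BP j (f j) (b j)" by metis
    then have fb: "\<And>j. j < n \<Longrightarrow> b j \<in> Basis" "\<And>j. j < n \<Longrightarrow> continuous_on UNIV (f j)"
      "\<And>j a b u. j < n \<Longrightarrow> adj a b \<Longrightarrow> {a, b} \<noteq> {vs ! j, vs ! Suc j} \<Longrightarrow> u \<in> {0..1} \<Longrightarrow> f j (ed a b u) = (0::real)"
      "\<And>j F k. j < n \<Longrightarrow> k \<noteq> 0 \<Longrightarrow> stieltjes_diff {0..1} F (\<lambda>u. k * f j (ed (vs ! j) (vs ! Suc j) u)) (\<lambda>u. ed (vs ! j) (vs ! Suc j) u \<bullet> b j) \<Longrightarrow> F 1 \<noteq> F 0"
      unfolding BP_def by simp_all
    have lip: "1-lipschitz_on UNIV (\<lambda>p. p \<bullet> b j)" if "j < n" for j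
    proof (rule lipschitz_onI)
      fix p q :: 'a
      show "dist (p \<bullet> b j) (q \<bullet> b j) \<le> 1 * dist p q"
        using Basis_le_norm[OF fb(1)[OF that], of "p - q"] by (simp add: dist_norm inner_diff_left)
    qed simp
    interpret S: graph_system \<Gamma> V adj ed n f "\<lambda>j p. p \<bullet> b j"
      by unfold_locales (fact fb(2), fact lip)
    let ?e = "\<lambda>j::nat. if j = 0 then 1 else (0::real)"
    have "\<exists>z'. S.path_transport (walk_path (drop 0 vs)) ?e z' \<and> z' n \<noteq> 0"
    proof (rule S.walk_transport_nonzero[OF vs(1) len])
      show "vs ! j \<noteq> vs ! (j + 2)" if "j + 2 \<le> n" for j
        using non_backtracking_nth[OF vs(4), of j] that len by simp
    qed (use fb in auto)
    then obtain z' \<xi> where \<xi>: "S.lifts (walk_path vs) \<xi>" "S.eqn (\<xi> 0) ?e" "S.eqn (\<xi> 1) z'" "z' n \<noteq> 0"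
      by (auto simp: S.path_transport_def)
    obtain z where z: "\<forall>s\<in>{0..1}. \<forall>t\<in>{0..1}. z 0 s = z 0 t"
      "\<And>j. j < n \<Longrightarrow> stieltjes_diff {0..1} (z (Suc j)) (\<lambda>t. z j t * f j (\<gamma> t)) (\<lambda>t. \<gamma> t \<bullet> b j)"
      "\<And>j. j \<le> n \<Longrightarrow> z j 0 = ?e j \<and> z j 1 = ?e j"
      by (rule exE[OF sys[of n f b]], erule fb(2), erule fb(1)) blast
    have "S.path_solution 0 1 \<gamma> z" unfolding S.path_solution_def
      by (intro conjI z(1) allI impI z(2))
    then have l: "S.lifts \<gamma> (\<lambda>t j. z j t)" by (rule S.path_solution_lifts[OF \<gamma>(1,2)])
    have "S.eqn (\<lambda>j. z j 1) (\<xi> 1)"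
      by (rule S.lifts_homotopy_invariant[OF vs(5) l \<xi>(1)]) (use z(3) \<xi>(2) in \<open>simp add: S.eqn_def\<close>)
    then have "z n 1 = z' n" using \<xi>(3) by (simp add: S.eqn_def)
    then show False using \<xi>(4) z(3)[of n] n0 by simp
  qed
  then have "vs = [x]" using len vs(2) by (cases vs) auto
  then show ?thesis using vs(5) by simp
qed

text \<open>Along the constant path the state stays put, and homotopy invariance transfers this to
  the end state of the given solution.\<close>

theorem null_homotopic_imp_system_closed:
  fixes \<gamma> :: "real \<Rightarrow> 'a"
  assumes \<gamma>: "L-lipschitz_on {0..1} \<gamma>" "\<gamma> ` {0..1} \<subseteq> \<Gamma>" and hom: "homotopic_paths \<Gamma> \<gamma> (\<lambda>_. x)"
    and f: "\<And>j. j < n \<Longrightarrow> continuous_on UNIV (f j :: 'a \<Rightarrow> real)" and c: "\<And>j. j < n \<Longrightarrow> 1-lipschitz_on UNIV (c j)"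
    and z: "\<And>s t. s \<in> {0..1} \<Longrightarrow> t \<in> {0..1} \<Longrightarrow> z 0 s = z 0 t"
      "\<And>j. j < n \<Longrightarrow> stieltjes_diff {0..1} (z (Suc j)) (\<lambda>t. z j t * f j (\<gamma> t)) (\<lambda>t. c j (\<gamma> t))"
  shows "z n 0 = z n 1"
proof -
  interpret S: graph_system \<Gamma> V adj ed n f c by unfold_locales (use f c in auto)
  have "S.path_solution 0 1 \<gamma> z" unfolding S.path_solution_def
    by (intro conjI ballI allI impI z)
  then have l: "S.lifts \<gamma> (\<lambda>t j. z j t)" by (rule S.path_solution_lifts[OF \<gamma>])
  have "x \<in> \<Gamma>" using homotopic_paths_imp_subset[OF hom] by (auto simp: path_image_def)
  have "S.path_solution 0 1 (\<lambda>_. x) (\<lambda>j _. z j 0)"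
    unfolding S.path_solution_def by (auto simp: stieltjes_diff_def intro!: exI[of _ 1])
  then have lc: "S.lifts (\<lambda>_. x) (\<lambda>t j. z j 0)"
    using \<open>x \<in> \<Gamma>\<close> by (intro S.path_solution_lifts[OF lipschitz_on_constant]) auto
  have "S.eqn (\<lambda>j. z j 1) (\<lambda>j. z j 0)"
    by (rule S.lifts_homotopy_invariant[OF hom l lc S.eqn_refl])
  then show ?thesis by (simp add: S.eqn_def)
qed

end

section \<open>Vanishing iterated integrals\<close>

definition coord :: "nat \<Rightarrow> real \<times> real \<Rightarrow> real"
  where "coord i p = (if i = 1 then fst p else snd p)"

lemma coord_primitive_path: "coord i (primitive_path a t) = integral {0..t} (component a i)"
  by (simp add: coord_def primitive_path_def component_def)

lemma bdd_measurable_component: "a \<in> abel_coeffs T \<Longrightarrow> bdd_measurable T (component a i)"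
  by (simp add: abel_coeffs_bdd_measurable component_def)

lemma iterated_tail_Cons:
  "iterated_tail T a (i # w) = (\<lambda>s. integral {s..T} (\<lambda>u. component a i u * iterated_tail T a w u))"
  by (simp add: fun_eq_iff)

lemma continuous_on_tail_integral:
  assumes "a \<in> abel_coeffs T" "continuous_on {0..T} g"
  shows "bdd_measurable T (\<lambda>u. component a i u * g u)"
    "continuous_on {0..T} (\<lambda>s. integral {s..T} (\<lambda>u. component a i u * g u))"
proof -
  show b: "bdd_measurable T (\<lambda>u. component a i u * g u)"
    by (intro bdd_measurable_mult bdd_measurable_component bdd_measurable_continuous assms)
  show "continuous_on {0..T} (\<lambda>s. integral {s..T} (\<lambda>u. component a i u * g u))"
    by (rule primitive_on_continuous[OF primitive_on_tail[OF b]])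
qed

lemma continuous_on_iterated_tail: "a \<in> abel_coeffs T \<Longrightarrow> continuous_on {0..T} (iterated_tail T a w)"
proof (induction w)
  case (Cons i w)
  then show ?case unfolding iterated_tail_Cons by (intro continuous_on_tail_integral(2)) auto
qed simp

lemma stieltjes_diff_tail_integral:
  assumes a: "a \<in> abel_coeffs T" and g: "continuous_on {0..T} g"
  shows "stieltjes_diff {0..T} (\<lambda>s. integral {s..T} (\<lambda>u. component a i u * g u)) (\<lambda>s. - g s)
    (\<lambda>s. coord i (primitive_path a s))"
proof -
  let ?h = "\<lambda>u. component a i u * g u"
  have "stieltjes_diff {0..T} (\<lambda>t. - integral {0..t} ?h + integral {0..T} ?h) (\<lambda>s. - g s) (\<lambda>t. integral {0..t} (component a i))"
    by (intro stieltjes_diff_add_const stieltjes_diff_minus stieltjes_diff_integral bdd_measurable_component a g)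
  then show ?thesis
  proof (rule stieltjes_diff_cong)
    fix t assume t: "t \<in> {0..T}"
    then have "integral {0..t} ?h + integral {t..T} ?h = integral {0..T} ?h"
      by (intro Henstock_Kurzweil_Integration.integral_combine bdd_measurable_integrable[OF continuous_on_tail_integral(1)[OF a g]]) auto
    then show "- integral {0..t} ?h + integral {0..T} ?h = integral {t..T} ?h" by simp
  qed (simp_all add: coord_primitive_path)
qed

section \<open>The span of the iterated tails and its uniform closure\<close>

text \<open>The empty word puts the constants into the span. Integrating a tail against a component
  prefixes a letter to its word, so vanishing iterated integrals say that such integrals over
  \<open>[0, T]\<close> are 0 for the whole span.\<close>

inductive tail_span :: "real \<Rightarrow> coeff_pair \<Rightarrow> (real \<Rightarrow> real) \<Rightarrow> bool" for T a where
  tail: "set w \<subseteq> {1, 2} \<Longrightarrow> tail_span T a (iterated_tail T a w)"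
| add: "tail_span T a F \<Longrightarrow> tail_span T a G \<Longrightarrow> tail_span T a (\<lambda>s. F s + G s)"
| scale: "tail_span T a F \<Longrightarrow> tail_span T a (\<lambda>s. k * F s)"

definition tail_closure :: "real \<Rightarrow> coeff_pair \<Rightarrow> (real \<Rightarrow> real) \<Rightarrow> bool"
  where "tail_closure T a F \<longleftrightarrow> (\<forall>e>0. \<exists>G. tail_span T a G \<and> (\<forall>s\<in>{0..T}. \<bar>F s - G s\<bar> \<le> e))"

lemma tail_span_continuous: "tail_span T a F \<Longrightarrow> a \<in> abel_coeffs T \<Longrightarrow> continuous_on {0..T} F"
  by (induction rule: tail_span.induct) (auto intro!: continuous_intros continuous_on_iterated_tail)

lemma tail_span_imp_closure: "tail_span T a F \<Longrightarrow> tail_closure T a F"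
  unfolding tail_closure_def by (auto intro: exI[of _ F])

lemma tail_closure_limit:
  assumes "\<And>e. e > 0 \<Longrightarrow> \<exists>G. tail_closure T a G \<and> (\<forall>s\<in>{0..T}. \<bar>F s - G s\<bar> \<le> e)"
  shows "tail_closure T a F"
  unfolding tail_closure_def
proof (intro allI impI)
  fix e :: real assume "e > 0"
  then obtain G where G: "tail_closure T a G" "\<And>s. s \<in> {0..T} \<Longrightarrow> \<bar>F s - G s\<bar> \<le> e/2" using assms[of "e/2"] by auto
  then obtain H where H: "tail_span T a H" "\<And>s. s \<in> {0..T} \<Longrightarrow> \<bar>G s - H s\<bar> \<le> e/2"
    unfolding tail_closure_def using \<open>e > 0\<close> by (meson half_gt_zero)
  have "\<bar>F s - H s\<bar> \<le> e" if "s \<in> {0..T}" for s using G(2)[OF that] H(2)[OF that] by linarith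
  then show "\<exists>G. tail_span T a G \<and> (\<forall>s\<in>{0..T}. \<bar>F s - G s\<bar> \<le> e)" using H(1) by blast
qed

lemma tail_closure_cong:
  assumes "tail_closure T a F" "\<And>s. s \<in> {0..T} \<Longrightarrow> F s = G s" shows "tail_closure T a G"
  using assms unfolding tail_closure_def by auto

lemma tail_closure_add:
  assumes "tail_closure T a F" "tail_closure T a G"
  shows "tail_closure T a (\<lambda>s. F s + G s)"
  unfolding tail_closure_def
proof (intro allI impI)
  fix e :: real assume "e > 0"
  then obtain F' G' where F': "tail_span T a F'" "\<And>s. s \<in> {0..T} \<Longrightarrow> \<bar>F s - F' s\<bar> \<le> e/2"
    and G': "tail_span T a G'" "\<And>s. s \<in> {0..T} \<Longrightarrow> \<bar>G s - G' s\<bar> \<le> e/2"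
    using assms unfolding tail_closure_def by (meson half_gt_zero)
  have "\<bar>F s + G s - (F' s + G' s)\<bar> \<le> e" if "s \<in> {0..T}" for s using F'(2)[OF that] G'(2)[OF that] by linarith
  then show "\<exists>H. tail_span T a H \<and> (\<forall>s\<in>{0..T}. \<bar>F s + G s - H s\<bar> \<le> e)"
    using tail_span.add[OF F'(1) G'(1)] by (intro exI[of _ "\<lambda>s. F' s + G' s"]) auto
qed

text \<open>Extension of a sup-norm bounded operator from the span to its closure. Boundedness is
  asked only between \<open>F\<close> and members of the span, because the integral operator is
  controlled on continuous functions.\<close>

lemma tail_closure_limit_op:
  assumes F: "tail_closure T a F" and B: "B > 0"
    and \<Phi>: "\<And>G. tail_span T a G \<Longrightarrow> tail_closure T a (\<Phi> G)"
    and bound: "\<And>G s e. \<lbrakk>tail_span T a G; \<And>s. s \<in> {0..T} \<Longrightarrow> \<bar>F s - G s\<bar> \<le> e; s \<in> {0..T}\<rbrakk> \<Longrightarrow> \<bar>\<Phi> F s - \<Phi> G s\<bar> \<le> B * e"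
  shows "tail_closure T a (\<Phi> F)"
proof (rule tail_closure_limit)
  fix e :: real assume "e > 0"
  then obtain G where G: "tail_span T a G" "\<And>s. s \<in> {0..T} \<Longrightarrow> \<bar>F s - G s\<bar> \<le> e / B"
    using F B unfolding tail_closure_def by (meson divide_pos_pos)
  have "\<bar>\<Phi> F s - \<Phi> G s\<bar> \<le> e" if "s \<in> {0..T}" for s using bound[OF G that] B by simp
  then show "\<exists>G. tail_closure T a G \<and> (\<forall>s\<in>{0..T}. \<bar>\<Phi> F s - G s\<bar> \<le> e)" using \<Phi>[OF G(1)] by blast
qed

lemma tail_closure_mult_left:
  assumes F: "tail_closure T a F" and B: "\<And>s. s \<in> {0..T} \<Longrightarrow> \<bar>h s\<bar> \<le> B"
    and h: "\<And>G. tail_span T a G \<Longrightarrow> tail_closure T a (\<lambda>s. h s * G s)"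
  shows "tail_closure T a (\<lambda>s. h s * F s)"
proof (rule tail_closure_limit_op[where \<Phi> = "\<lambda>F s. h s * F s" and B = "\<bar>B\<bar> + 1", OF F _ h])
  fix G s and e :: real assume G: "\<And>s. s \<in> {0..T} \<Longrightarrow> \<bar>F s - G s\<bar> \<le> e" and s: "s \<in> {0..T}"
  have "\<bar>h s * F s - h s * G s\<bar> = \<bar>h s\<bar> * \<bar>F s - G s\<bar>" by (simp add: abs_mult[symmetric] right_diff_distrib)
  also have "\<dots> \<le> (\<bar>B\<bar> + 1) * e" using B[OF s] G[OF s] by (intro mult_mono) auto
  finally show "\<bar>h s * F s - h s * G s\<bar> \<le> (\<bar>B\<bar> + 1) * e" .
qed auto

lemma tail_closure_scale: "tail_closure T a F \<Longrightarrow> tail_closure T a (\<lambda>s. k * F s)"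
  by (rule tail_closure_mult_left[where B = "\<bar>k\<bar>"]) (auto intro: tail_span_imp_closure tail_span.scale)

lemma tail_integral_diff_bound:
  assumes a: "a \<in> abel_coeffs T" and T: "T > 0" and F: "continuous_on {0..T} F" and G: "continuous_on {0..T} G"
    and K: "\<And>t. t \<in> {0..T} \<Longrightarrow> \<bar>component a i t\<bar> \<le> K" "K > 0"
    and e: "\<And>s. s \<in> {0..T} \<Longrightarrow> \<bar>F s - G s\<bar> \<le> e" and s: "s \<in> {0..T}"
  shows "\<bar>integral {s..T} (\<lambda>u. component a i u * F u) - integral {s..T} (\<lambda>u. component a i u * G u)\<bar> \<le> K * T * e"
proof -
  note b = continuous_on_tail_integral(1)[OF a F, of i] continuous_on_tail_integral(1)[OF a G, of i]
  have i: "(\<lambda>u. component a i u * F u) integrable_on {s..T}" "(\<lambda>u. component a i u * G u) integrable_on {s..T}"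
    using s by (auto intro!: bdd_measurable_integrable[OF b(1)] bdd_measurable_integrable[OF b(2)])
  have e0: "e \<ge> 0" using e[OF s] by linarith
  have "\<bar>integral {s..T} (\<lambda>u. component a i u * F u - component a i u * G u)\<bar> \<le> K * e * (T - s)"
  proof (rule integral_bound_real[OF integrable_diff[OF i]])
    fix u assume "u \<in> {s..T}"
    then have u: "u \<in> {0..T}" using s by auto
    have "\<bar>component a i u * F u - component a i u * G u\<bar> = \<bar>component a i u\<bar> * \<bar>F u - G u\<bar>"
      by (simp add: abs_mult[symmetric] right_diff_distrib)
    also have "\<dots> \<le> K * e" using K(1)[OF u] e[OF u] K(2) by (intro mult_mono) auto
    finally show "\<bar>component a i u * F u - component a i u * G u\<bar> \<le> K * e" .
  qed (use s in auto)
  also have "\<dots> \<le> K * e * T" using s e0 K by (intro mult_left_mono) auto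
  finally show ?thesis unfolding Henstock_Kurzweil_Integration.integral_diff[OF i] by (simp only: mult_ac)
qed

text \<open>On the span both claims follow by prefixing the letter \<open>i\<close>. They pass to
  the closure because integration against a component bounded by \<open>K\<close> enlarges the sup
  norm by at most \<open>K * T\<close>.\<close>

lemma tail_closure_integral:
  assumes a: "a \<in> abel_coeffs T" and T: "T > 0" and i: "i \<in> {1, 2}" and F: "tail_closure T a F" "continuous_on {0..T} F"
  shows "tail_closure T a (\<lambda>s. integral {s..T} (\<lambda>u. component a i u * F u))"
    "(\<And>w. w \<noteq> [] \<Longrightarrow> set w \<subseteq> {1, 2} \<Longrightarrow> iterated_integral T a w = 0) \<Longrightarrow> integral {0..T} (\<lambda>u. component a i u * F u) = 0"
proof -
  obtain K where K: "K > 0" "\<And>t. t \<in> {0..T} \<Longrightarrow> \<bar>component a i t\<bar> \<le> K" by (metis bdd_measurable_component[OF a] bdd_measurableE)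
  let ?I = "\<lambda>F s. integral {s..T} (\<lambda>u. component a i u * F u)"
  have lin: "?I (\<lambda>u. G u + H u) s = ?I G s + ?I H s" if "tail_span T a G" "tail_span T a H" "s \<in> {0..T}" for G H s
  proof -
    have "(\<lambda>u. component a i u * F u) integrable_on {s..T}" if "tail_span T a F" for F
      using \<open>s \<in> {0..T}\<close>
      by (intro bdd_measurable_integrable[OF continuous_on_tail_integral(1)[OF a tail_span_continuous[OF that a]]]) auto
    from Henstock_Kurzweil_Integration.integral_add[OF this[OF that(1)] this[OF that(2)]]
    show ?thesis by (simp add: distrib_left)
  qed
  have sc: "?I (\<lambda>u. k * G u) s = k * ?I G s" for k G s
    by (subst integral_mult_right[symmetric]) (simp add: mult_ac)
  have span: "tail_closure T a (?I G)" if "tail_span T a G" for G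
    using that
  proof (induction rule: tail_span.induct)
    case (tail w)
    then have "tail_span T a (iterated_tail T a (i # w))" using i by (intro tail_span.tail) auto
    then show ?case unfolding iterated_tail_Cons by (rule tail_span_imp_closure)
  next
    case (add G H)
    show ?case by (rule tail_closure_cong[OF tail_closure_add[OF add.IH]]) (use lin add in auto)
  next
    case (scale G k)
    show ?case unfolding sc by (rule tail_closure_scale[OF scale.IH])
  qed
  show "tail_closure T a (?I F)"
  proof (rule tail_closure_limit_op[where \<Phi> = ?I and B = "K * T", OF F(1) _ span])
    fix G s and e :: real
    assume "tail_span T a G" "\<And>s. s \<in> {0..T} \<Longrightarrow> \<bar>F s - G s\<bar> \<le> e" "s \<in> {0..T}"
    then show "\<bar>?I F s - ?I G s\<bar> \<le> K * T * e"
      by (intro tail_integral_diff_bound[OF a T F(2) tail_span_continuous[OF _ a] K(2,1)])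
  qed (use K T in auto)
  assume van: "\<And>w. w \<noteq> [] \<Longrightarrow> set w \<subseteq> {1, 2} \<Longrightarrow> iterated_integral T a w = 0"
  have 0: "?I G 0 = 0" if "tail_span T a G" for G
    using that
  proof (induction rule: tail_span.induct)
    case (tail w)
    then show ?case using van[of "i # w"] i by (simp add: iterated_integral_def)
  next
    case (add G H) then show ?case using lin[OF add.hyps, of 0] T by simp
  next
    case (scale G k) then show ?case by (simp only: sc)
  qed
  have "\<bar>?I F 0\<bar> \<le> 0"
  proof (rule field_le_epsilon)
    fix e :: real assume e: "e > 0"
    then have "e / (K * T) > 0" using K(1) T by simp
    then obtain G where G: "tail_span T a G" "\<And>s. s \<in> {0..T} \<Longrightarrow> \<bar>F s - G s\<bar> \<le> e / (K * T)"
      using F(1) unfolding tail_closure_def by blast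
    have "\<bar>?I F 0 - ?I G 0\<bar> \<le> K * T * (e / (K * T))"
      by (rule tail_integral_diff_bound[OF a T F(2) tail_span_continuous[OF G(1) a] K(2,1) G(2)]) (use T in auto)
    then show "\<bar>?I F 0\<bar> \<le> 0 + e" using 0[OF G(1)] K T by simp
  qed
  then show "?I F 0 = 0" by simp
qed

text \<open>Multiplication by a coordinate of the path stays in the span: this is the shuffle relation,
  obtained from integration by parts.\<close>

lemma tail_closure_coord_tail:
  assumes a: "a \<in> abel_coeffs T" and T: "T > 0" and i: "i \<in> {1, 2}" and w: "set w \<subseteq> {1, 2}"
  shows "tail_closure T a (\<lambda>s. iterated_tail T a [i] s * iterated_tail T a w s)"
  using w
proof (induction w)
  case Nil
  have "tail_closure T a (iterated_tail T a [i])" using i by (intro tail_span_imp_closure tail_span.tail) auto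
  then show ?case by (rule tail_closure_cong) simp
next
  case (Cons j w)
  let ?X = "iterated_tail T a [i]" and ?J = "iterated_tail T a (j # w)" and ?W = "iterated_tail T a w"
  let ?f = "\<lambda>u. component a i u * ?J u" and ?g = "\<lambda>u. component a j u * (?X u * ?W u)"
  note c = continuous_on_iterated_tail[OF a]
  have cX: "continuous_on {0..T} (\<lambda>u. ?X u * ?W u)" by (intro continuous_intros c)
  have pX: "primitive_on T ?X (\<lambda>s. - component a i s)"
    unfolding iterated_tail_Cons
    by (rule primitive_on_cong[OF primitive_on_tail[OF continuous_on_tail_integral(1)[OF a c[of "[]"], of i]]]) simp_all
  have pJ: "primitive_on T ?J (\<lambda>s. - (component a j s * ?W s))"
    unfolding iterated_tail_Cons by (rule primitive_on_tail[OF continuous_on_tail_integral(1)[OF a c]])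
  have p: "primitive_on T (\<lambda>s. ?X s * ?J s) (\<lambda>s. - (?f s + ?g s))"
    by (rule primitive_on_cong[OF primitive_on_mult[OF pX pJ]]) (auto simp: algebra_simps)
  have bf: "bdd_measurable T ?f" by (rule continuous_on_tail_integral(1)[OF a c])
  have bg: "bdd_measurable T ?g" by (rule continuous_on_tail_integral(1)[OF a cX])
  have eq: "integral {s..T} ?f + integral {s..T} ?g = ?X s * ?J s" if s: "s \<in> {0..T}" for s
  proof -
    have "integral {0..t} (\<lambda>s. ?f s + ?g s) = ?X 0 * ?J 0 - ?X t * ?J t" if "t \<in> {0..T}" for t
      using primitive_onD(2)[OF p that] integral_neg[of "{0..t}" "\<lambda>s. ?f s + ?g s"] by linarith
    moreover have "integral {0..s} (\<lambda>s. ?f s + ?g s) + integral {s..T} (\<lambda>s. ?f s + ?g s) = integral {0..T} (\<lambda>s. ?f s + ?g s)"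
      using s by (intro Henstock_Kurzweil_Integration.integral_combine bdd_measurable_integrable[OF bdd_measurable_add[OF bf bg]]) auto
    moreover have "integral {s..T} (\<lambda>s. ?f s + ?g s) = integral {s..T} ?f + integral {s..T} ?g"
      using s by (intro Henstock_Kurzweil_Integration.integral_add bdd_measurable_integrable[OF bf] bdd_measurable_integrable[OF bg]) auto
    moreover have "?X T = 0" by simp
    ultimately show ?thesis using s T by simp
  qed
  have "tail_closure T a (\<lambda>s. integral {s..T} ?f)"
    by (rule tail_closure_integral(1)[OF a T i tail_span_imp_closure[OF tail_span.tail] c]) (use Cons in auto)
  moreover have "tail_closure T a (\<lambda>s. integral {s..T} ?g)"
    by (rule tail_closure_integral(1)[OF a T _ Cons.IH cX]) (use Cons in auto)
  ultimately show ?case by (rule tail_closure_cong[OF tail_closure_add]) (rule eq)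
qed

lemma tail_closure_coord:
  assumes a: "a \<in> abel_coeffs T" and T: "T > 0" and i: "i \<in> {1, 2}" and F: "tail_closure T a F"
  shows "tail_closure T a (\<lambda>s. iterated_tail T a [i] s * F s)"
proof -
  obtain B where B: "\<And>s. s \<in> {0..T} \<Longrightarrow> \<bar>iterated_tail T a [i] s\<bar> \<le> B"
    by (metis bdd_measurable_continuous[OF continuous_on_iterated_tail[OF a]] bdd_measurableE)
  show ?thesis
  proof (rule tail_closure_mult_left[OF F B])
    fix G assume "tail_span T a G"
    then show "tail_closure T a (\<lambda>s. iterated_tail T a [i] s * G s)"
    proof (induction rule: tail_span.induct)
      case (tail w) then show ?case by (rule tail_closure_coord_tail[OF a T i])
    next
      case (add F G) show ?case by (rule tail_closure_cong[OF tail_closure_add[OF add.IH]]) (simp add: distrib_left)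
    next
      case (scale F k) show ?case by (rule tail_closure_cong[OF tail_closure_scale[OF scale.IH, of k]]) (simp add: mult_ac)
    qed
  qed
qed

lemma continuous_on_primitive_path: "a \<in> abel_coeffs T \<Longrightarrow> continuous_on {0..T} (primitive_path a)"
  unfolding primitive_path_def abel_coeffs_bdd_measurable by (intro continuous_on_Pair integral_continuous_bdd) auto

text \<open>For a closed path the integral from 0 to \<open>s\<close> is minus the integral from
  \<open>s\<close> to \<open>T\<close>. This brings the coordinates of the path into the span of the
  iterated tails.\<close>

lemma primitive_path_tail:
  assumes a: "a \<in> abel_coeffs T" and closed: "primitive_path a T = 0" and s: "s \<in> {0..T}"
  shows "primitive_path a s = (- iterated_tail T a [1] s, - iterated_tail T a [2] s)"
proof -
  have "integral {0..s} (component a i) + integral {s..T} (component a i) = integral {0..T} (component a i)" for i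
    using s by (intro Henstock_Kurzweil_Integration.integral_combine bdd_measurable_integrable[OF bdd_measurable_component[OF a]]) auto
  from this[of 1] this[of 2] show ?thesis using closed by (simp add: primitive_path_def component_def zero_prod_def)
qed

text \<open>Keeping \<open>F\<close> arbitrary lets the induction treat a product by applying its
  two hypotheses one after the other; linear functions reduce to the two coordinates.\<close>

lemma tail_closure_polynomial:
  assumes a: "a \<in> abel_coeffs T" and T: "T > 0" and closed: "primitive_path a T = 0" and p: "real_polynomial_function p"
  shows "tail_closure T a F \<Longrightarrow> tail_closure T a (\<lambda>s. p (primitive_path a s) * F s)"
  using p
proof (induction arbitrary: F rule: real_polynomial_function.induct)
  case (linear h)
  then interpret h: bounded_linear h by simp
  have c: "tail_closure T a (\<lambda>s. - h (1, 0) * (iterated_tail T a [1] s * F s) + - h (0, 1) * (iterated_tail T a [2] s * F s))"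
    by (intro tail_closure_add tail_closure_scale tail_closure_coord a T linear.prems) auto
  show ?case
  proof (rule tail_closure_cong[OF c])
    fix s assume "s \<in> {0..T}"
    note pp = primitive_path_tail[OF a closed this]
    have lin: "h (x, y) = x * h (1, 0) + y * h (0, 1)" for x y
    proof -
      have "(x, y) = x *\<^sub>R (1, 0) + y *\<^sub>R (0, 1)" by simp
      then have "h (x, y) = h (x *\<^sub>R (1, 0) + y *\<^sub>R (0, 1))" by (rule arg_cong)
      then show ?thesis by (simp only: h.add h.scaleR real_scaleR_def)
    qed
    show "- h (1, 0) * (iterated_tail T a [1] s * F s) + - h (0, 1) * (iterated_tail T a [2] s * F s) = h (primitive_path a s) * F s"
      unfolding pp lin[of "- iterated_tail T a [1] s" "- iterated_tail T a [2] s"] by (simp add: algebra_simps)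
  qed
next
  case (const c) then show ?case by (rule tail_closure_scale)
next
  case (add f g)
  show ?case by (rule tail_closure_cong[OF tail_closure_add[OF add.IH(1)[OF add.prems] add.IH(2)[OF add.prems]]]) (simp add: distrib_right)
next
  case (mult f g)
  show ?case by (rule tail_closure_cong[OF mult.IH(1)[OF mult.IH(2)[OF mult.prems]]]) (simp add: mult_ac)
qed

text \<open>Weierstrass approximation on the compact image of the path; the tolerance
  \<open>e / B\<close> allows for the bound \<open>B\<close> of \<open>F\<close>.\<close>

lemma tail_closure_continuous_mult:
  assumes a: "a \<in> abel_coeffs T" and T: "T > 0" and closed: "primitive_path a T = 0"
    and \<phi>: "continuous_on UNIV (\<phi> :: real \<times> real \<Rightarrow> real)" and F: "tail_closure T a F" "continuous_on {0..T} F"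
  shows "tail_closure T a (\<lambda>s. \<phi> (primitive_path a s) * F s)"
proof (rule tail_closure_limit)
  fix e :: real assume e: "e > 0"
  obtain B where B: "B > 0" "\<And>s. s \<in> {0..T} \<Longrightarrow> \<bar>F s\<bar> \<le> B" by (metis bdd_measurable_continuous[OF F(2)] bdd_measurableE)
  have "compact (primitive_path a ` {0..T})"
    by (intro compact_continuous_image continuous_on_primitive_path a) auto
  then obtain p where p: "real_polynomial_function p" "\<And>x. x \<in> primitive_path a ` {0..T} \<Longrightarrow> \<bar>\<phi> x - p x\<bar> < e / B"
    using Stone_Weierstrass_real_polynomial_function[OF _ continuous_on_subset[OF \<phi> subset_UNIV], of _ "e / B"] e B(1)
    by (metis divide_pos_pos)
  have "\<bar>\<phi> (primitive_path a s) * F s - p (primitive_path a s) * F s\<bar> \<le> e" if s: "s \<in> {0..T}" for s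
  proof -
    have "\<bar>\<phi> (primitive_path a s) * F s - p (primitive_path a s) * F s\<bar> = \<bar>\<phi> (primitive_path a s) - p (primitive_path a s)\<bar> * \<bar>F s\<bar>"
      by (simp add: abs_mult[symmetric] left_diff_distrib)
    also have "\<dots> \<le> e / B * B" using p(2)[of "primitive_path a s"] B s e by (intro mult_mono) auto
    finally show ?thesis using B by simp
  qed
  then show "\<exists>G. tail_closure T a G \<and> (\<forall>s\<in>{0..T}. \<bar>\<phi> (primitive_path a s) * F s - G s\<bar> \<le> e)"
    using tail_closure_polynomial[OF a T closed p(1) F(1)] by blast
qed

text \<open>The solution of the triangular system with state \<open>(1, 0, 0, ...)\<close> at time
  \<open>T\<close>. The minus sign offsets the one produced by the variable lower limit.\<close>

primrec form_tail :: "real \<Rightarrow> coeff_pair \<Rightarrow> (nat \<Rightarrow> real \<times> real \<Rightarrow> real) \<Rightarrow> (nat \<Rightarrow> nat) \<Rightarrow> nat \<Rightarrow> real \<Rightarrow> real" where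
  "form_tail T a f d 0 = (\<lambda>_. 1)"
| "form_tail T a f d (Suc j) = (\<lambda>s. integral {s..T} (\<lambda>u. component a (d j) u * - (f j (primitive_path a u) * form_tail T a f d j u)))"

text \<open>Each stage multiplies the previous one by a continuous function of the path and
  integrates, operations that preserve the closure. The value at 0 is a full integral of a member of
  the closure and therefore vanishes.\<close>

lemma form_tail_props:
  assumes a: "a \<in> abel_coeffs T" and T: "T > 0" and closed: "primitive_path a T = 0"
    and van: "\<And>w. w \<noteq> [] \<Longrightarrow> set w \<subseteq> {1, 2} \<Longrightarrow> iterated_integral T a w = 0"
    and f: "\<And>j. j < n \<Longrightarrow> continuous_on UNIV (f j)" and d: "\<And>j. j < n \<Longrightarrow> d j \<in> {1, 2}"
  shows "j \<le> n \<Longrightarrow> continuous_on {0..T} (form_tail T a f d j) \<and> tail_closure T a (form_tail T a f d j) \<and>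
    form_tail T a f d j 0 = (if j = 0 then 1 else 0)"
proof (induction j)
  case 0
  have "tail_closure T a (iterated_tail T a [])" by (intro tail_span_imp_closure tail_span.tail) auto
  then have "tail_closure T a (\<lambda>_. 1)" by (rule tail_closure_cong) simp
  then show ?case by simp
next
  case (Suc j)
  then have j: "j < n" by simp
  let ?g = "\<lambda>u. - (f j (primitive_path a u) * form_tail T a f d j u)"
  have c: "continuous_on {0..T} ?g"
    using Suc by (intro continuous_intros continuous_on_compose2[OF f[OF j] continuous_on_primitive_path[OF a]]) auto
  have "tail_closure T a (\<lambda>u. -1 * (f j (primitive_path a u) * form_tail T a f d j u))"
    using Suc by (intro tail_closure_scale tail_closure_continuous_mult a T closed f j) auto
  then have cl: "tail_closure T a ?g" by simp
  show ?case
    using continuous_on_tail_integral(2)[OF a c] tail_closure_integral[OF a T d[OF j] cl c] van by simp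
qed

lemma primitive_path_lipschitz:
  assumes a: "a \<in> abel_coeffs T"
  obtains L where "L-lipschitz_on {0..T} (primitive_path a)"
proof -
  have b: "bdd_measurable T (fst a)" "bdd_measurable T (snd a)" using a by (auto simp: abel_coeffs_bdd_measurable)
  obtain K where "K-lipschitz_on {0..T} (\<lambda>t. integral {0..t} (fst a))" using integral_lipschitz[OF b(1)] .
  moreover obtain M where "M-lipschitz_on {0..T} (\<lambda>t. integral {0..t} (snd a))" using integral_lipschitz[OF b(2)] .
  ultimately have "(sqrt (K\<^sup>2 + M\<^sup>2))-lipschitz_on {0..T} (primitive_path a)"
    unfolding primitive_path_def by (rule lipschitz_on_Pair)
  then show ?thesis by (rule that)
qed

lemma primitive_path_rescaled_lipschitz:
  assumes a: "a \<in> abel_coeffs T" and T: "T > 0"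
  obtains L where "L-lipschitz_on {0..1} (\<lambda>t. primitive_path a (T * t))"
proof -
  have lip: "T-lipschitz_on {0..1} (\<lambda>t. T * t)"
    by (rule lipschitz_onI) (use T in \<open>auto simp: dist_real_def right_diff_distrib[symmetric] abs_mult\<close>)
  have im: "(\<lambda>t. T * t) ` {0..1} \<subseteq> {0..T}" using T by (auto simp: mult_left_le)
  obtain L where "L-lipschitz_on {0..T} (primitive_path a)" using primitive_path_lipschitz[OF a] .
  from lipschitz_on_compose2[OF lip lipschitz_on_subset[OF this im]] show ?thesis by (rule that)
qed

lemma Basis_real_pair_coord: "b \<in> Basis \<Longrightarrow> \<exists>i\<in>{1, 2}. \<forall>p :: real \<times> real. p \<bullet> b = coord i p"
  by (auto simp: Basis_prod_def coord_def inner_prod_def)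

theorem iterated_integrals_vanish_imp_systems_closed:
  assumes a: "a \<in> abel_coeffs T" and T: "T > 0" and closed: "primitive_path a T = 0"
    and van: "\<And>w. w \<noteq> [] \<Longrightarrow> set w \<subseteq> {1, 2} \<Longrightarrow> iterated_integral T a w = 0"
    and f: "\<And>j. j < n \<Longrightarrow> continuous_on UNIV (f j :: real \<times> real \<Rightarrow> real)" and b: "\<And>j. j < n \<Longrightarrow> b j \<in> Basis"
  defines "\<gamma> \<equiv> \<lambda>t. primitive_path a (T * t)"
  shows "\<exists>z. (\<forall>s\<in>{0..1}. \<forall>t\<in>{0..1}. z 0 s = z 0 t) \<and>
        (\<forall>j<n. stieltjes_diff {0..1} (z (Suc j)) (\<lambda>t. z j t * f j (\<gamma> t)) (\<lambda>t. \<gamma> t \<bullet> b j)) \<and>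
        (\<forall>j\<le>n. z j 0 = (if j = 0 then 1 else 0) \<and> z j 1 = (if j = 0 then 1 else (0::real)))"
proof -
  have "\<forall>j. \<exists>i. j < n \<longrightarrow> i \<in> {1, 2} \<and> (\<forall>p :: real \<times> real. p \<bullet> b j = coord i p)" using Basis_real_pair_coord[OF b] by blast
  then obtain d where d: "\<And>j. j < n \<Longrightarrow> d j \<in> {1, 2}" "\<And>j p. j < n \<Longrightarrow> p \<bullet> b j = coord (d j) p" by metis
  note props = form_tail_props[OF a T closed van f d(1)]
  let ?z = "\<lambda>j t. form_tail T a f d j (T * t)"
  have lip: "T-lipschitz_on {0..1} (\<lambda>t. T * t)"
    by (rule lipschitz_onI) (use T in \<open>auto simp: dist_real_def right_diff_distrib[symmetric] abs_mult\<close>)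
  have im: "(\<lambda>t. T * t) ` {0..1} \<subseteq> {0..T}" using T by (auto simp: mult_left_le)
  have "stieltjes_diff {0..1} (?z (Suc j)) (\<lambda>t. ?z j t * f j (\<gamma> t)) (\<lambda>t. \<gamma> t \<bullet> b j)" if j: "j < n" for j
  proof -
    have c: "continuous_on {0..T} (\<lambda>u. - (f j (primitive_path a u) * form_tail T a f d j u))"
      using props[of j] j by (intro continuous_intros continuous_on_compose2[OF f[OF j] continuous_on_primitive_path[OF a]]) auto
    from stieltjes_diff_comp[OF stieltjes_diff_tail_integral[OF a c, of "d j"] lip im]
    show ?thesis by (rule stieltjes_diff_cong) (simp_all add: \<gamma>_def d(2)[OF j])
  qed
  moreover have "form_tail T a f d j T = (if j = 0 then 1 else 0)" for j by (cases j) auto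
  ultimately show ?thesis using props by (intro exI[of _ ?z]) auto
qed

text \<open>Removing the first letter of a word undoes one integration, so the tails of the suffixes
  of \<open>w\<close> solve the system with all \<open>f\<close> equal to -1. Its last component is
  0 at time \<open>T\<close>, hence also at time 0.\<close>

theorem null_homotopic_imp_iterated_integral_zero:
  assumes G: "lipschitz_graph \<Gamma> V adj ed"
    and a: "a \<in> abel_coeffs T" and T: "T > 0" and im: "primitive_path a ` {0..T} \<subseteq> \<Gamma>"
    and hom: "homotopic_paths \<Gamma> (\<lambda>t. primitive_path a (T * t)) (\<lambda>_. x)"
    and w: "w \<noteq> []"
  shows "iterated_integral T a w = 0"
proof -
  interpret lipschitz_graph \<Gamma> V adj ed by (rule G)
  define n where "n = length w"
  let ?\<gamma> = "\<lambda>t. primitive_path a (T * t)"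
  \<comment> \<open>Component \<open>j\<close> belongs to the suffix of length \<open>j\<close>; the
    empty suffix gives the constant 1.\<close>
  let ?z = "\<lambda>j t. iterated_tail T a (drop (n - j) w) (T * t)"
  obtain L where L: "L-lipschitz_on {0..1} ?\<gamma>" using primitive_path_rescaled_lipschitz[OF a T] by blast
  have lip: "T-lipschitz_on {0..1} (\<lambda>t. T * t)"
    by (rule lipschitz_onI) (use T in \<open>auto simp: dist_real_def right_diff_distrib[symmetric] abs_mult\<close>)
  have imT: "(\<lambda>t. T * t) ` {0..1} \<subseteq> {0..T}" using T by (auto simp: mult_left_le)
  have "?z n 0 = ?z n 1"
  proof (rule null_homotopic_imp_system_closed[OF L _ hom, where n = n and z = ?z and f = "\<lambda>_ _. -1" and c = "\<lambda>j. coord (w ! (n - Suc j))"])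
    show "?\<gamma> ` {0..1} \<subseteq> \<Gamma>" using im imT by blast
    show "1-lipschitz_on UNIV (coord (w ! (n - Suc j)))" for j
      by (rule lipschitz_onI) (auto simp: coord_def dist_fst_le dist_snd_le)
    fix j assume j: "j < n"
    have d: "drop (n - Suc j) w = w ! (n - Suc j) # drop (n - j) w"
      using j by (subst Cons_nth_drop_Suc[symmetric]) (auto simp: n_def Suc_diff_Suc)
    from stieltjes_diff_comp[OF stieltjes_diff_tail_integral[OF a continuous_on_iterated_tail[OF a], of "w ! (n - Suc j)" "drop (n - j) w"] lip imT]
    show "stieltjes_diff {0..1} (?z (Suc j)) (\<lambda>t. ?z j t * -1) (\<lambda>t. coord (w ! (n - Suc j)) (?\<gamma> t))"
      unfolding d iterated_tail_Cons by simp
  qed (auto simp: n_def)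
  moreover have "?z n 1 = 0" using w by (cases w) (auto simp: n_def)
  ultimately show ?thesis by (simp add: iterated_integral_def)
qed

section \<open>Triangulable curves as graphs\<close>

definition subarc :: "(real \<Rightarrow> 'a) \<Rightarrow> real \<Rightarrow> real \<Rightarrow> real \<Rightarrow> 'a"
  where "subarc g a b = (\<lambda>t. g (a + t * (b - a)))"

lemma subarc_endpoints [simp]: "subarc g a b 0 = g a" "subarc g a b 1 = g b"
  by (simp_all add: subarc_def)

lemma locally_bilipschitz_on_cong:
  assumes "locally_bilipschitz_on U f" "\<And>x. x \<in> U \<Longrightarrow> f x = g x"
  shows "locally_bilipschitz_on U g"
  unfolding locally_bilipschitz_on_def
proof
  fix x assume "x \<in> U"
  then obtain e c C where e: "e > 0" "c > 0" "\<And>s t. s \<in> ball x e \<inter> U \<Longrightarrow> t \<in> ball x e \<inter> U \<Longrightarrow>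
     c * dist s t \<le> dist (f s) (f t) \<and> dist (f s) (f t) \<le> C * dist s t"
    using assms(1) unfolding locally_bilipschitz_on_def by meson
  then have "\<forall>s\<in>ball x e \<inter> U. \<forall>t\<in>ball x e \<inter> U. c * dist s t \<le> dist (g s) (g t) \<and> dist (g s) (g t) \<le> C * dist s t"
    using assms(2) by (metis IntD2)
  then show "\<exists>e>0. \<exists>c>0. \<exists>C. \<forall>s\<in>ball x e \<inter> U. \<forall>t\<in>ball x e \<inter> U.
     c * dist s t \<le> dist (g s) (g t) \<and> dist (g s) (g t) \<le> C * dist s t"
    using e(1,2) by blast
qed

text \<open>Injectivity is confined to the open interval: once extended to \<open>[0, 1]\<close>, an
  arc may close up, and its end points may lie inside itself or inside other arcs.\<close>

definition open_arc :: "(real \<Rightarrow> 'a::euclidean_space) \<Rightarrow> bool"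
  where "open_arc g \<longleftrightarrow> (\<exists>L. L-lipschitz_on {0..1} g) \<and> locally_bilipschitz_on {0<..<1} g \<and> inj_on g {0<..<1}"

lemma affine_param:
  fixes a b t :: real
  assumes ab: "a \<in> {0..1}" "b \<in> {0..1}" "a \<noteq> b"
  shows "t \<in> {0..1} \<Longrightarrow> a + t * (b - a) \<in> {0..1}" "t \<in> {0<..<1} \<Longrightarrow> a + t * (b - a) \<in> {0<..<1}"
    "a < b \<Longrightarrow> t \<in> {0<..<1} \<Longrightarrow> a + t * (b - a) \<in> {a<..<b}"
proof -
  have eq: "a + t * (b - a) = (1 - t) * a + t * b" by (simp add: algebra_simps)
  show "a + t * (b - a) \<in> {0..1}" if "t \<in> {0..1}"
    unfolding eq using convexD_alt[of "{0..1::real}" a b t] ab that by simp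
  have between: "a + t * (b - a) \<in> {a<..<b}" if "a < b" "t \<in> {0<..<1}" for a b t :: real
  proof -
    have "0 < t * (b - a)" "t * (b - a) < 1 * (b - a)" using that by (simp, intro mult_strict_right_mono) auto
    then show ?thesis by simp
  qed
  show "a < b \<Longrightarrow> t \<in> {0<..<1} \<Longrightarrow> a + t * (b - a) \<in> {a<..<b}" using between[of a b t] by blast
  assume t: "t \<in> {0<..<1}"
  have "b + (1 - t) * (a - b) = a + t * (b - a)" by (simp add: algebra_simps)
  moreover have "b < a \<Longrightarrow> b + (1 - t) * (a - b) \<in> {b<..<a}"
    using between[of b a "1 - t"] t by auto
  ultimately have "a + t * (b - a) \<in> {a<..<b} \<or> a + t * (b - a) \<in> {b<..<a}"
    using between[of a b t] ab(3) t by (metis linorder_neqE_linordered_idom)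
  then show "a + t * (b - a) \<in> {0<..<1}" using ab(1,2) unfolding greaterThanLessThan_iff atLeastAtMost_iff by linarith
qed

lemma open_arc_subarc:
  assumes g: "open_arc g" and ab: "a \<in> {0..1}" "b \<in> {0..1}" "a \<noteq> b"
  shows "open_arc (subarc g a b)"
proof -
  let ?\<phi> = "\<lambda>t. a + t * (b - a)"
  note \<phi> = affine_param[OF ab]
  have d: "dist (?\<phi> s) (?\<phi> t) = \<bar>b - a\<bar> * dist s t" for s t
    by (simp add: dist_real_def left_diff_distrib[symmetric] abs_mult)
  obtain L where L: "L-lipschitz_on {0..1} g" using g by (auto simp: open_arc_def)
  have "\<bar>b - a\<bar>-lipschitz_on {0..1} ?\<phi>" by (rule lipschitz_onI) (simp only: d order_refl, simp)
  then have "(L * \<bar>b - a\<bar>)-lipschitz_on {0..1} (subarc g a b)" unfolding subarc_def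
    by (rule lipschitz_on_compose2[OF _ lipschitz_on_subset[OF L]]) (use \<phi>(1) in blast)
  moreover have "inj_on (subarc g a b) {0<..<1}"
  proof (rule inj_onI)
    fix s t :: real assume st: "s \<in> {0<..<1}" "t \<in> {0<..<1}" "subarc g a b s = subarc g a b t"
    then have "?\<phi> s = ?\<phi> t" using g \<phi>(2) unfolding open_arc_def subarc_def by (meson inj_onD)
    then show "s = t" using ab(3) by simp
  qed
  moreover have "locally_bilipschitz_on {0<..<1} (subarc g a b)"
    unfolding locally_bilipschitz_on_def
  proof
    fix x :: real assume "x \<in> {0<..<1}"
    then have "?\<phi> x \<in> {0<..<1}" by (rule \<phi>(2))
    then obtain e c C where e: "e > 0" "c > 0" "\<And>s t. s \<in> ball (?\<phi> x) e \<inter> {0<..<1} \<Longrightarrow> t \<in> ball (?\<phi> x) e \<inter> {0<..<1} \<Longrightarrow>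
       c * dist s t \<le> dist (g s) (g t) \<and> dist (g s) (g t) \<le> C * dist s t"
      using g unfolding open_arc_def locally_bilipschitz_on_def by meson
    have ba: "\<bar>b - a\<bar> > 0" using ab(3) by simp
    have in_ball: "?\<phi> s \<in> ball (?\<phi> x) e \<inter> {0<..<1}" if "s \<in> ball x (e / \<bar>b - a\<bar>) \<inter> {0<..<1}" for s
      using that \<phi>(2)[of s] ba d[of x s] by (auto simp: field_simps)
    show "\<exists>e>0. \<exists>c>0. \<exists>C. \<forall>s\<in>ball x e \<inter> {0<..<1}. \<forall>t\<in>ball x e \<inter> {0<..<1}.
       c * dist s t \<le> dist (subarc g a b s) (subarc g a b t) \<and> dist (subarc g a b s) (subarc g a b t) \<le> C * dist s t"
    proof (rule exI[of _ "e / \<bar>b - a\<bar>"], intro conjI, use e ba in simp,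
        rule exI[of _ "c * \<bar>b - a\<bar>"], intro conjI, use e ba in simp, rule exI[of _ "C * \<bar>b - a\<bar>"], intro ballI)
      fix s t assume "s \<in> ball x (e / \<bar>b - a\<bar>) \<inter> {0<..<1}" "t \<in> ball x (e / \<bar>b - a\<bar>) \<inter> {0<..<1}"
      from e(3)[OF in_ball[OF this(1)] in_ball[OF this(2)]]
      show "c * \<bar>b - a\<bar> * dist s t \<le> dist (subarc g a b s) (subarc g a b t) \<and>
          dist (subarc g a b s) (subarc g a b t) \<le> C * \<bar>b - a\<bar> * dist s t"
        unfolding d subarc_def by (simp add: mult.assoc)
    qed
  qed
  ultimately show ?thesis unfolding open_arc_def by blast
qed

section \<open>Subdivision of finite families of arcs\<close>

definition arc_family :: "(real \<Rightarrow> 'a::euclidean_space) set \<Rightarrow> 'a set \<Rightarrow> bool"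
  where "arc_family E P \<longleftrightarrow> finite E \<and> finite P \<and> (\<forall>h\<in>E. open_arc h \<and> h 0 \<in> P \<and> h 1 \<in> P) \<and>
    (\<forall>h\<in>E. \<forall>h'\<in>E. \<forall>u\<in>{0<..<1}. \<forall>u'\<in>{0<..<1}. h u = h' u' \<longrightarrow> h = h')"

text \<open>The pieces between consecutive parameters at which an arc meets \<open>P\<close>. It
  repairs the situation in which an end point of an arc is interior to some arc.\<close>

definition subdivision :: "(real \<Rightarrow> 'a::euclidean_space) set \<Rightarrow> 'a set \<Rightarrow> (real \<Rightarrow> 'a) set"
  where "subdivision E P = {subarc h a b |h a b. h \<in> E \<and> 0 \<le> a \<and> a < b \<and> b \<le> 1 \<and> h a \<in> P \<and> h b \<in> P \<and> (\<forall>t\<in>{a<..<b}. h t \<notin> P)}"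

lemma finite_params:
  assumes "open_arc h" "finite P"
  shows "finite {t \<in> {0..1}. h t \<in> P}"
proof -
  have "finite {t \<in> {0<..<1}. h t \<in> P}"
  proof (rule finite_imageD)
    show "finite (h ` {t \<in> {0<..<1}. h t \<in> P})" by (rule finite_subset[OF _ assms(2)]) blast
    show "inj_on h {t \<in> {0<..<1}. h t \<in> P}" using assms(1) unfolding open_arc_def by (blast intro: inj_on_subset)
  qed
  then have "finite ({0, 1} \<union> {t \<in> {0<..<1}. h t \<in> P})" by simp
  then show ?thesis by (rule finite_subset[rotated]) auto
qed

lemma subdivision_cover:
  assumes E: "arc_family E P"
  shows "P \<union> (\<Union>h\<in>subdivision E P. h ` {0..1}) = P \<union> (\<Union>h\<in>E. h ` {0..1})"
proof
  show "P \<union> (\<Union>h\<in>subdivision E P. h ` {0..1}) \<subseteq> P \<union> (\<Union>h\<in>E. h ` {0..1})"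
  proof -
    have "subarc h a b ` {0..1} \<subseteq> h ` {0..1}" if "0 \<le> a" "a < b" "b \<le> 1" for h :: "real \<Rightarrow> 'a" and a b
      using affine_param(1)[of a b] that unfolding subarc_def by auto
    then show ?thesis unfolding subdivision_def by fast
  qed
  show "P \<union> (\<Union>h\<in>E. h ` {0..1}) \<subseteq> P \<union> (\<Union>h\<in>subdivision E P. h ` {0..1})"
  proof
    fix p assume "p \<in> P \<union> (\<Union>h\<in>E. h ` {0..1})"
    then consider "p \<in> P" | h t where "p \<notin> P" "h \<in> E" "t \<in> {0..1}" "p = h t" by blast
    then show "p \<in> P \<union> (\<Union>h\<in>subdivision E P. h ` {0..1})"
    proof cases
      case 2
      define F where "F = {t \<in> {0..1}. h t \<in> P}"
      have h: "open_arc h" "h 0 \<in> P" "h 1 \<in> P" and P: "finite P" using E 2(2) by (auto simp: arc_family_def)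
      have F: "finite F" unfolding F_def by (rule finite_params[OF h(1) P])
      have F01: "0 \<in> F" "1 \<in> F" using h by (auto simp: F_def)
      have tF: "t \<notin> F" using 2 by (auto simp: F_def)
      then have t: "0 < t" "t < 1" using 2(3) F01 by (auto simp: less_le)
      \<comment> \<open>The parameters in \<open>F\<close> nearest to \<open>t\<close> on either
        side; they exist because \<open>F\<close> is finite and contains 0 and 1.\<close>
      define a where "a = Max {s \<in> F. s < t}"
      define b where "b = Min {s \<in> F. t < s}"
      have fa: "finite {s \<in> F. s < t}" "{s \<in> F. s < t} \<noteq> {}" and fb: "finite {s \<in> F. t < s}" "{s \<in> F. t < s} \<noteq> {}"
        using F F01 t by auto
      have a: "a \<in> F" "a < t" and b: "b \<in> F" "t < b" using Max_in[OF fa] Min_in[OF fb] by (auto simp: a_def b_def)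
      have between: "h s \<notin> P" if s: "s \<in> {a<..<b}" for s
      proof
        assume "h s \<in> P"
        then have sF: "s \<in> F" using a b s by (auto simp: F_def)
        then consider "s < t" | "s > t" using tF by (metis linorder_neqE_linordered_idom)
        then show False
        proof cases
          case 1 then have "s \<le> a" unfolding a_def using sF fa by (intro Max_ge) auto
          then show False using s by simp
        next
          case 2 then have "b \<le> s" unfolding b_def using sF fb by (intro Min_le) auto
          then show False using s by simp
        qed
      qed
      have "subarc h a b \<in> subdivision E P"
        unfolding subdivision_def
        by (rule CollectI, rule exI[of _ h], rule exI[of _ a], rule exI[of _ b]) (use 2(2) a b between in \<open>auto simp: F_def\<close>)
      moreover have "p = subarc h a b ((t - a) / (b - a))" "(t - a) / (b - a) \<in> {0..1}"
        using a b 2(4) by (auto simp: subarc_def)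
      ultimately show ?thesis by blast
    qed blast
  qed
qed

lemma subdivision_arc_family:
  assumes E: "arc_family E P"
  shows "arc_family (subdivision E P) P" and "\<And>h u. h \<in> subdivision E P \<Longrightarrow> u \<in> {0<..<1} \<Longrightarrow> h u \<notin> P"
proof -
  note Ed = E[unfolded arc_family_def]
  show notin: "h u \<notin> P" if h: "h \<in> subdivision E P" and u: "u \<in> {0<..<1}" for h u
  proof -
    obtain g a b where g: "h = subarc g a b" "0 \<le> a" "a < b" "b \<le> 1" "\<forall>t\<in>{a<..<b}. g t \<notin> P"
      using h unfolding subdivision_def by blast
    then show ?thesis using affine_param(3)[of a b u] u by (auto simp: subarc_def)
  qed
  show "arc_family (subdivision E P) P"
    unfolding arc_family_def
  proof (intro conjI ballI impI)
    let ?F = "\<Union>h\<in>E. {t \<in> {0..1}. h t \<in> P}"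
    have "finite ?F" using Ed finite_params by blast
    moreover have "subdivision E P \<subseteq> (\<lambda>(h, a, b). subarc h a b) ` (E \<times> ?F \<times> ?F)"
    proof
      fix e assume "e \<in> subdivision E P"
      then obtain h a b where e: "e = subarc h a b" "h \<in> E" "0 \<le> a" "a < b" "b \<le> 1" "h a \<in> P" "h b \<in> P"
        unfolding subdivision_def by blast
      then have "(h, a, b) \<in> E \<times> ?F \<times> ?F" by auto
      then show "e \<in> (\<lambda>(h, a, b). subarc h a b) ` (E \<times> ?F \<times> ?F)" using e(1) by force
    qed
    ultimately show "finite (subdivision E P)" using Ed by (meson finite_SigmaI finite_imageI finite_subset)
    show "finite P" using Ed by blast
  next
    fix e assume "e \<in> subdivision E P"
    then obtain h a b where e: "e = subarc h a b" "h \<in> E" "0 \<le> a" "a < b" "b \<le> 1" "h a \<in> P" "h b \<in> P"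
      unfolding subdivision_def by blast
    then show "open_arc e" "e 0 \<in> P" "e 1 \<in> P" using Ed by (auto intro!: open_arc_subarc)
  next
    fix e e' u u' assume "e \<in> subdivision E P" "e' \<in> subdivision E P" and u: "u \<in> {0<..<1::real}" "u' \<in> {0<..<1::real}" and eq: "e u = e' u'"
    then obtain h a b h' a' b' where e: "e = subarc h a b" "h \<in> E" "0 \<le> a" "a < b" "b \<le> 1" "h a \<in> P" "h b \<in> P" "\<forall>t\<in>{a<..<b}. h t \<notin> P"
      and e': "e' = subarc h' a' b'" "h' \<in> E" "0 \<le> a'" "a' < b'" "b' \<le> 1" "h' a' \<in> P" "h' b' \<in> P" "\<forall>t\<in>{a'<..<b'}. h' t \<notin> P"
      unfolding subdivision_def by blast
    define t where "t = a + u * (b - a)"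
    define t' where "t' = a' + u' * (b' - a')"
    have t: "t \<in> {a<..<b}" "t \<in> {0<..<1}" and t': "t' \<in> {a'<..<b'}" "t' \<in> {0<..<1}"
      unfolding t_def t'_def using affine_param(2,3)[of a b u] affine_param(2,3)[of a' b' u'] e e' u by auto
    have ht: "h t = h' t'" using eq by (simp add: e(1) e'(1) subarc_def t_def t'_def)
    then have hh: "h = h'" using Ed e(2) e'(2) t(2) t'(2) by blast
    have "inj_on h {0<..<1}" using Ed e(2) by (auto simp: open_arc_def)
    then have tt: "t = t'" using ht hh t(2) t'(2) by (auto dest: inj_onD)
    \<comment> \<open>Both open intervals contain the common parameter, so an end of one lying
      beyond an end of the other would give an interior parameter with value in
      \<open>P\<close>.\<close>
    have "\<not> a' < a" "\<not> a < a'" "\<not> b < b'" "\<not> b' < b" using e e' hh tt t(1) t'(1) by auto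
    then show "e = e'" using e(1) e'(1) hh by simp
  qed
qed

text \<open>Without loops and parallel arcs an arc is determined by the unordered pair of its ends,
  so pairs of vertices can serve as names of edges.\<close>

lemma arc_family_imp_lipschitz_graph:
  assumes E: "arc_family E V" and notin: "\<And>h u. h \<in> E \<Longrightarrow> u \<in> {0<..<1} \<Longrightarrow> h u \<notin> V"
    and noloop: "\<And>h. h \<in> E \<Longrightarrow> h 0 \<noteq> h 1"
    and simple: "\<And>h h'. h \<in> E \<Longrightarrow> h' \<in> E \<Longrightarrow> {h 0, h 1} = {h' 0, h' 1} \<Longrightarrow> h = h'"
    and \<Gamma>: "\<Gamma> = V \<union> (\<Union>h\<in>E. h ` {0..1})"
  obtains adj ed where "lipschitz_graph \<Gamma> V adj ed"
proof -
  note Ed = E[unfolded arc_family_def]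
  define adj where "adj v w \<longleftrightarrow> (\<exists>h\<in>E. {h 0, h 1} = {v, w})" for v w
  define e where "e v w = (THE h. h \<in> E \<and> {h 0, h 1} = {v, w})" for v w
  \<comment> \<open>The family stores each arc in one orientation; it is run backwards when it
    starts at \<open>w\<close>.\<close>
  define ed where "ed v w = (if e v w 0 = v then subarc (e v w) 0 1 else subarc (e v w) 1 0)" for v w
  have e: "e v w \<in> E \<and> {e v w 0, e v w 1} = {v, w}" if vw: "adj v w" for v w
  proof -
    obtain h where h: "h \<in> E" "{h 0, h 1} = {v, w}" using vw unfolding adj_def by blast
    show ?thesis unfolding e_def by (rule theI2[of _ h]) (use h simple in auto)
  qed
  have sym: "e v w = e w v" for v w unfolding e_def by (simp add: insert_commute)
  have e01: "e v w 0 = v \<and> e v w 1 = w \<or> e v w 0 = w \<and> e v w 1 = v" if "adj v w" for v w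
    using e[OF that] by (auto simp: doubleton_eq_iff)
  have vw: "v \<noteq> w" if "adj v w" for v w using e01[OF that] noloop e[OF that] by metis
  have form: "\<exists>a b. (a = 0 \<and> b = 1 \<or> a = 1 \<and> b = 0) \<and> ed v w = subarc (e v w) a b \<and> e v w a = v \<and> e v w b = w" if "adj v w" for v w
    using e01[OF that] vw[OF that] unfolding ed_def by auto
  have arc: "open_arc (ed v w)" if "adj v w" for v w
    using form[OF that] e[OF that] Ed by (auto intro!: open_arc_subarc)
  have ends: "ed v w 0 = v" "ed v w 1 = w" if "adj v w" for v w using form[OF that] by auto
  have interior: "\<exists>u'\<in>{0<..<1}. ed v w u = e v w u'" if vwu: "adj v w" "u \<in> {0<..<1}" for v w u
  proof -
    obtain a b where ab: "a = 0 \<and> b = 1 \<or> a = 1 \<and> b = 0" "ed v w = subarc (e v w) a b" using form[OF vwu(1)] by blast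
    have "a + u * (b - a) \<in> {0<..<1}" using ab(1) vwu(2) by auto
    then show ?thesis unfolding ab(2) subarc_def by (intro bexI[of _ "a + u * (b - a)"]) simp_all
  qed
  have image: "ed v w ` {0..1} = e v w ` {0..1}" if "adj v w" for v w
  proof -
    have "subarc g 1 0 ` {0..1} = g ` {0..1}" for g :: "real \<Rightarrow> 'a"
    proof -
      have "subarc g 1 0 = g \<circ> (\<lambda>t. 1 - t)" by (simp add: subarc_def fun_eq_iff)
      moreover have "(\<lambda>t. 1 - t) ` {0..1} = {0..1::real}" by (simp add: image_diff_atLeastAtMost)
      ultimately show ?thesis by (simp only: image_comp[symmetric])
    qed
    moreover have "subarc g 0 1 = g" for g :: "real \<Rightarrow> 'a" by (simp add: subarc_def)
    ultimately show ?thesis by (simp add: ed_def)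
  qed
  have adjV: "v \<in> V" "w \<in> V" if "adj v w" for v w using e[OF that] e01[OF that] Ed by metis+
  have "lipschitz_graph \<Gamma> V adj ed"
  proof
    show "finite V" using Ed by blast
    fix v w assume a: "adj v w"
    show "v \<in> V" by (rule adjV[OF a])
    show "adj w v" using a by (auto simp: adj_def insert_commute)
    show "ed w v = reversepath (ed v w)"
      using e01[OF a] vw[OF a] sym[of w v] by (auto simp: ed_def subarc_def reversepath_def fun_eq_iff)
    show "\<exists>L. L-lipschitz_on {0..1} (ed v w)" "locally_bilipschitz_on {0<..<1} (ed v w)" using arc[OF a] by (auto simp: open_arc_def)
    show "ed v w 0 = v" by (rule ends[OF a])
    show nV: "ed v w u \<notin> V" if "u \<in> {0<..<1}" for u using interior[OF a that] notin e[OF a] by metis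
    show "inj_on (ed v w) {0..1}"
    proof (rule inj_onI)
      fix s t :: real assume st: "s \<in> {0..1}" "t \<in> {0..1}" "ed v w s = ed v w t"
      have V: "ed v w x \<in> V \<longleftrightarrow> x = 0 \<or> x = 1" if "x \<in> {0..1}" for x
        using nV[of x] ends[OF a] adjV[OF a] that by (cases "x = 0 \<or> x = 1") auto
      show "s = t"
      proof (cases "ed v w s \<in> V")
        case True
        then have "s = 0 \<or> s = 1" "t = 0 \<or> t = 1" using V st by metis+
        then show ?thesis using st(3) ends[OF a] vw[OF a] by auto
      next
        case False
        then have "s \<in> {0<..<1}" "t \<in> {0<..<1}" using V[OF st(1)] V[OF st(2)] st by auto
        then show ?thesis using arc[OF a] st(3) by (auto simp: open_arc_def dest: inj_onD)
      qed
    qed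
    fix v' w' u u' assume a': "adj v' w'" and u: "u \<in> {0<..<1::real}" "u' \<in> {0<..<1::real}" and eq: "ed v w u = ed v' w' u'"
    obtain s s' where "s \<in> {0<..<1}" "s' \<in> {0<..<1}" "e v w s = e v' w' s'" using interior[OF a u(1)] interior[OF a' u(2)] eq by metis
    then have "e v w = e v' w'" using Ed e[OF a] e[OF a'] by blast
    then have "{v, w} = {v', w'}" using e[OF a] e[OF a'] by metis
    then show "v = v' \<and> w = w' \<or> v = w' \<and> w = v'" by (auto simp: doubleton_eq_iff)
  next
    have "(\<Union>h\<in>E. h ` {0..1}) = (\<Union>(v, w)\<in>{(v, w). adj v w}. ed v w ` {0..1})"
    proof (intro equalityI subsetI)
      fix p assume "p \<in> (\<Union>h\<in>E. h ` {0..1})"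
      then obtain h where h: "h \<in> E" "p \<in> h ` {0..1}" by blast
      have a: "adj (h 0) (h 1)" using h(1) by (auto simp: adj_def)
      have "e (h 0) (h 1) = h" using simple[of "e (h 0) (h 1)" h] e[OF a] h(1) by simp
      then have "p \<in> ed (h 0) (h 1) ` {0..1}" using image[OF a] h(2) by simp
      then show "p \<in> (\<Union>(v, w)\<in>{(v, w). adj v w}. ed v w ` {0..1})"
        by (intro UN_I[of "(h 0, h 1)"]) (use a in simp_all)
    next
      fix p assume "p \<in> (\<Union>(v, w)\<in>{(v, w). adj v w}. ed v w ` {0..1})"
      then obtain v w where "adj v w" "p \<in> ed v w ` {0..1}" by blast
      then show "p \<in> (\<Union>h\<in>E. h ` {0..1})" using image[of v w] e[of v w] by auto
    qed
    then show "\<Gamma> = V \<union> (\<Union>(v, w)\<in>{(v, w). adj v w}. ed v w ` {0..1})" using \<Gamma> by simp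
  qed
  then show ?thesis by (rule that)
qed

text \<open>Subdividing every arc into three parts removes loops and multiple edges.\<close>

lemma trisection_graph:
  assumes E: "arc_family E P" and notin: "\<And>h u. h \<in> E \<Longrightarrow> u \<in> {0<..<1} \<Longrightarrow> h u \<notin> P"
    and \<Gamma>: "\<Gamma> = P \<union> (\<Union>h\<in>E. h ` {0..1})"
  obtains V adj ed where "P \<subseteq> V" "lipschitz_graph \<Gamma> V adj ed"
proof -
  note Ed = E[unfolded arc_family_def]
  define V where "V = P \<union> (\<Union>h\<in>E. {h (1/3), h (2/3)})"
  have EV: "arc_family E V" using Ed unfolding arc_family_def V_def by auto
  let ?E = "subdivision E V"
  have params: "t \<in> {0, 1/3, 2/3, 1}" if h: "h \<in> E" and t: "t \<in> {0..1}" "h t \<in> V" for h t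
  proof (rule ccontr)
    assume nt: "t \<notin> {0, 1/3, 2/3, 1}"
    then have t01: "t \<in> {0<..<1}" using t by auto
    then obtain h' s where h': "h' \<in> E" "s \<in> {1/3, 2/3}" "h t = h' s" using t(2) notin[OF h] unfolding V_def by blast
    then have s: "s \<in> {0<..<1}" by auto
    then have "h = h'" using Ed h h' t01 by blast
    moreover have "inj_on h {0<..<1}" using Ed h by (auto simp: open_arc_def)
    ultimately show False using h'(2,3) s t01 nt by (auto dest: inj_onD)
  qed
  have thirds: "\<exists>h\<in>E. \<exists>a b. e = subarc h a b \<and> (a = 0 \<and> b = 1/3 \<or> a = 1/3 \<and> b = 2/3 \<or> a = 2/3 \<and> b = 1)" if ee: "e \<in> ?E" for e
  proof -
    obtain h a b where e: "e = subarc h a b" "h \<in> E" "0 \<le> a" "a < b" "b \<le> 1" "h a \<in> V" "h b \<in> V" "\<forall>t\<in>{a<..<b}. h t \<notin> V"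
      using ee unfolding subdivision_def by blast
    have "h (1/3) \<in> V" "h (2/3) \<in> V" using e(2) unfolding V_def by blast+
    then have "1/3 \<notin> {a<..<b}" "2/3 \<notin> {a<..<b}" using e(8) by blast+
    moreover have "a \<in> {0, 1/3, 2/3, 1}" by (rule params[OF e(2) _ e(6)]) (use e in simp)
    moreover have "b \<in> {0, 1/3, 2/3, 1}" by (rule params[OF e(2) _ e(7)]) (use e in simp)
    ultimately have "a = 0 \<and> b = 1/3 \<or> a = 1/3 \<and> b = 2/3 \<or> a = 2/3 \<and> b = 1" using e(3-5) by auto
    then show ?thesis using e(1,2) by blast
  qed
  have vals: "h (1/3) \<notin> P" "h (2/3) \<notin> P" "h 0 \<in> P" "h 1 \<in> P" "h (1/3) \<noteq> h (2/3)" if "h \<in> E" for h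
  proof -
    show "h (1/3) \<notin> P" "h (2/3) \<notin> P" using notin[OF that] by auto
    show "h 0 \<in> P" "h 1 \<in> P" using Ed that by auto
    have "inj_on h {0<..<1}" using Ed that by (auto simp: open_arc_def)
    then show "h (1/3) \<noteq> h (2/3)" using inj_onD[of h "{0<..<1}" "1/3" "2/3"] by auto
  qed
  have same: "h = h'" if "h \<in> E" "h' \<in> E" "h s = h' s'" "s \<in> {1/3, 2/3}" "s' \<in> {1/3, 2/3}" for h h' s s'
  proof -
    have "s \<in> {0<..<1}" "s' \<in> {0<..<1}" using that(4,5) by auto
    then show ?thesis using Ed that(1-3) by blast
  qed
  obtain adj ed where "lipschitz_graph \<Gamma> V adj ed"
  proof (rule arc_family_imp_lipschitz_graph[where E = ?E and V = V and \<Gamma> = \<Gamma>])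
    show "arc_family ?E V" by (rule subdivision_arc_family(1)[OF EV])
    show "h u \<notin> V" if "h \<in> ?E" "u \<in> {0<..<1}" for h u using subdivision_arc_family(2)[OF EV that] .
    fix e assume "e \<in> ?E"
    then show "e 0 \<noteq> e 1" using thirds[of e] vals by fastforce
  next
    fix e e' assume e: "e \<in> ?E" and e': "e' \<in> ?E" and eq: "{e 0, e 1} = {e' 0, e' 1}"
    obtain h a b where h: "h \<in> E" "e = subarc h a b" "a = 0 \<and> b = 1/3 \<or> a = 1/3 \<and> b = 2/3 \<or> a = 2/3 \<and> b = 1" using thirds[OF e] by blast
    obtain h' a' b' where h': "h' \<in> E" "e' = subarc h' a' b'" "a' = 0 \<and> b' = 1/3 \<or> a' = 1/3 \<and> b' = 2/3 \<or> a' = 2/3 \<and> b' = 1" using thirds[OF e'] by blast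
    have eq': "{h a, h b} = {h' a', h' b'}" using eq h(2) h'(2) by simp
    \<comment> \<open>Each third has at least one of the two new division points as an end, and such
      a point lies on one arc of the family only.\<close>
    have "\<exists>s\<in>{1/3, 2/3}. \<exists>s'\<in>{1/3, 2/3}. h s = h' s'"
      using h(3) h'(3) eq' vals[OF h(1)] vals[OF h'(1)] by (elim disjE conjE) (auto simp: doubleton_eq_iff)
    then have hh: "h = h'" using same h(1) h'(1) by blast
    \<comment> \<open>Even when the arc is a loop, its three thirds have different pairs of
      ends.\<close>
    have "a = a' \<and> b = b'"
      using h(3) h'(3) eq' vals[OF h(1)] unfolding hh[symmetric] by (elim disjE conjE) (auto simp: doubleton_eq_iff)
    then show "e = e'" using h(2) h'(2) hh by simp
  next
    have "V \<subseteq> P \<union> (\<Union>h\<in>E. h ` {0..1})" unfolding V_def by force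
    then have "\<Gamma> = V \<union> (\<Union>h\<in>E. h ` {0..1})" unfolding \<Gamma> by (auto simp: V_def)
    then show "\<Gamma> = V \<union> (\<Union>h\<in>?E. h ` {0..1})" using subdivision_cover[OF EV] by simp
  qed blast
  moreover have "P \<subseteq> V" by (simp add: V_def)
  ultimately show ?thesis using that by blast
qed

text \<open>Each arc extends to a Lipschitz map on \<open>[0, 1]\<close>, whose end points lie in
  the compact set \<open>\<Gamma>\<close> but possibly inside other arcs. Subdividing at all these
  points, at \<open>S\<close> and at the base point makes arcs meet at ends only; trisection then
  makes the graph simple.\<close>

theorem triangulable_curve_graph:
  assumes \<Gamma>: "lipschitz_triangulable_curve \<Gamma>" and x: "x \<in> \<Gamma>"
  obtains V adj ed where "lipschitz_graph \<Gamma> V adj ed" "x \<in> V"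
proof -
  have comp: "compact \<Gamma>" using \<Gamma> unfolding lipschitz_triangulable_curve_def by (rule conjunct1)
  have "\<exists>S k. \<exists>h :: nat \<Rightarrow> real \<Rightarrow> real \<times> real. finite S \<and> S \<subseteq> \<Gamma> \<and> (\<forall>i\<in>{1..k}. lipschitz_arc (h i)) \<and>
      disjoint_family_on (\<lambda>i. h i ` {0<..<1}) {1..k} \<and> \<Gamma> - S = (\<Union>i\<in>{1..k}. h i ` {0<..<1})"
    using \<Gamma> unfolding lipschitz_triangulable_curve_def by (rule conjunct2)
  then obtain S k and h :: "nat \<Rightarrow> real \<Rightarrow> real \<times> real" where "finite S \<and> S \<subseteq> \<Gamma> \<and> (\<forall>i\<in>{1..k}. lipschitz_arc (h i)) \<and>
      disjoint_family_on (\<lambda>i. h i ` {0<..<1}) {1..k} \<and> \<Gamma> - S = (\<Union>i\<in>{1..k}. h i ` {0<..<1})" by (elim exE)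
  then have S: "finite S" "S \<subseteq> \<Gamma>" and h: "\<And>i. i \<in> {1..k} \<Longrightarrow> lipschitz_arc (h i)"
    and disj: "disjoint_family_on (\<lambda>i. h i ` {0<..<1}) {1..k}" and cover: "\<Gamma> - S = (\<Union>i\<in>{1..k}. h i ` {0<..<1})"
    by simp_all
  have "\<exists>g. (\<exists>L. L-lipschitz_on {0..1} g) \<and> (\<forall>t\<in>{0<..<1}. g t = h i t)" if i: "i \<in> {1..k}" for i
  proof -
    obtain L where "L-lipschitz_on {0<..<1} (h i)" using h[OF i] by (auto simp: lipschitz_arc_def)
    from lipschitz_extend_closure[OF this] show ?thesis by auto
  qed
  then obtain g where g: "\<And>i. i \<in> {1..k} \<Longrightarrow> \<exists>L. L-lipschitz_on {0..1} (g i)" "\<And>i t. i \<in> {1..k} \<Longrightarrow> t \<in> {0<..<1} \<Longrightarrow> g i t = h i t"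
    by metis
  have gi: "g i ` {0<..<1} = h i ` {0<..<1}" if "i \<in> {1..k}" for i by (rule image_cong) (use g(2)[OF that] in auto)
  have g\<Gamma>: "g i t \<in> \<Gamma>" if i: "i \<in> {1..k}" and t: "t \<in> {0..1}" for i t
  proof -
    have c: "continuous_on {0..1} (g i)" using g(1)[OF i] lipschitz_on_continuous_on by blast
    have "g i ` {0<..<1} \<subseteq> \<Gamma>" unfolding gi[OF i] using cover i by blast
    with c have "g i ` closure {0<..<1} \<subseteq> \<Gamma>" by (intro image_closure_subset compact_imp_closed comp) simp_all
    then show ?thesis using t by (simp add: image_subset_iff)
  qed
  have arc: "open_arc (g i)" if i: "i \<in> {1..k}" for i
  proof -
    have "inj_on (g i) {0<..<1}" using h[OF i] g(2)[OF i] by (auto simp: lipschitz_arc_def inj_on_def)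
    moreover have "locally_bilipschitz_on {0<..<1} (g i)"
      by (rule locally_bilipschitz_on_cong[of _ "h i"]) (use h[OF i] g(2)[OF i] in \<open>auto simp: lipschitz_arc_def\<close>)
    ultimately show ?thesis using g(1)[OF i] by (simp add: open_arc_def)
  qed
  \<comment> \<open>The point \<open>x\<close> joins the vertices so that it can be the base point
    of edge walks.\<close>
  define P where "P = insert x S \<union> (\<Union>i\<in>{1..k}. {g i 0, g i 1})"
  have E: "arc_family (g ` {1..k}) P"
    unfolding arc_family_def
  proof (intro conjI ballI impI)
    fix e e' u u' assume "e \<in> g ` {1..k}" "e' \<in> g ` {1..k}" and u: "u \<in> {0<..<1::real}" "u' \<in> {0<..<1::real}" and eq: "e u = e' u'"
    then obtain i j where ij: "i \<in> {1..k}" "j \<in> {1..k}" "e = g i" "e' = g j" by blast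
    have "h i u = h j u'" using eq g(2)[OF ij(1) u(1)] g(2)[OF ij(2) u(2)] ij by simp
    then have "h i ` {0<..<1} \<inter> h j ` {0<..<1} \<noteq> {}" using u by blast
    then have "i = j" using disj ij(1,2) unfolding disjoint_family_on_def by blast
    then show "e = e'" using ij by simp
  qed (use S arc in \<open>auto simp: P_def\<close>)
  have \<Gamma>P: "\<Gamma> = P \<union> (\<Union>h\<in>g ` {1..k}. h ` {0..1})"
  proof
    have "\<Gamma> \<subseteq> S \<union> (\<Union>i\<in>{1..k}. g i ` {0<..<1})" using cover gi by auto
    also have "\<dots> \<subseteq> P \<union> (\<Union>h\<in>g ` {1..k}. h ` {0..1})" by (force simp: P_def)
    finally show "\<Gamma> \<subseteq> P \<union> (\<Union>h\<in>g ` {1..k}. h ` {0..1})" .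
    show "P \<union> (\<Union>h\<in>g ` {1..k}. h ` {0..1}) \<subseteq> \<Gamma>" using g\<Gamma> S x by (auto simp: P_def)
  qed
  note sub = subdivision_arc_family[OF E]
  obtain V adj ed where "P \<subseteq> V" "lipschitz_graph \<Gamma> V adj ed"
    by (rule trisection_graph[where E = "subdivision (g ` {1..k}) P" and P = P and \<Gamma> = \<Gamma>])
      (rule sub, rule sub(2), assumption+, simp only: subdivision_cover[OF E] \<Gamma>P[symmetric], blast)
  then show ?thesis using that by (auto simp: P_def)
qed

section \<open>Universal curves and the fundamental group\<close>

definition loops_at :: "'a::real_normed_vector set \<Rightarrow> 'a \<Rightarrow> (real \<Rightarrow> 'a) set"
  where "loops_at \<Gamma> x = {p. path p \<and> path_image p \<subseteq> \<Gamma> \<and> pathstart p = x \<and> pathfinish p = x}"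

lemma carrier_fundamental_group: "carrier (fundamental_group \<Gamma> x) = loop_class \<Gamma> ` loops_at \<Gamma> x"
  by (simp add: fundamental_group_def loops_at_def)

lemma loop_class_eqI: "homotopic_paths \<Gamma> p q \<Longrightarrow> loop_class \<Gamma> p = loop_class \<Gamma> q"
  unfolding loop_class_def using homotopic_paths_sym homotopic_paths_trans by blast

lemma loop_class_eqD:
  assumes "loop_class \<Gamma> p = loop_class \<Gamma> q" "path q" "path_image q \<subseteq> \<Gamma>"
  shows "homotopic_paths \<Gamma> p q"
proof -
  have "q \<in> loop_class \<Gamma> q" using assms(2,3) by (simp add: loop_class_def)
  then show ?thesis unfolding assms(1)[symmetric] by (simp add: loop_class_def)
qed

text \<open>The group product is a union over all representatives; homotopic representatives yield
  the same class, so the union collapses.\<close>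

lemma mult_loop_class:
  assumes g: "g \<in> loops_at \<Gamma> x" and h: "h \<in> loops_at \<Gamma> x"
  shows "mult (fundamental_group \<Gamma> x) (loop_class \<Gamma> g) (loop_class \<Gamma> h) = loop_class \<Gamma> (h +++ g)"
proof -
  have eq: "loop_class \<Gamma> (h' +++ g') = loop_class \<Gamma> (h +++ g)"
    if "g' \<in> loop_class \<Gamma> g" "h' \<in> loop_class \<Gamma> h" for g' h'
    by (rule sym, rule loop_class_eqI, rule homotopic_paths_join)
      (use that g h in \<open>simp_all add: loop_class_def loops_at_def\<close>)
  have "g \<in> loop_class \<Gamma> g" "h \<in> loop_class \<Gamma> h" using g h by (auto simp: loop_class_def loops_at_def)
  then have ne: "loop_class \<Gamma> g \<noteq> {}" "loop_class \<Gamma> h \<noteq> {}" by blast+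
  have "(\<Union>g'\<in>loop_class \<Gamma> g. \<Union>h'\<in>loop_class \<Gamma> h. loop_class \<Gamma> (h' +++ g')) =
      (\<Union>g'\<in>loop_class \<Gamma> g. \<Union>h'\<in>loop_class \<Gamma> h. loop_class \<Gamma> (h +++ g))"
    by (intro SUP_cong refl eq)
  also have "\<dots> = loop_class \<Gamma> (h +++ g)" using ne by simp
  finally have "(\<Union>g'\<in>loop_class \<Gamma> g. \<Union>h'\<in>loop_class \<Gamma> h. loop_class \<Gamma> (h' +++ g')) = loop_class \<Gamma> (h +++ g)" .
  then show ?thesis by (simp add: fundamental_group_def)
qed

lemma loops_at_join: "g \<in> loops_at \<Gamma> x \<Longrightarrow> h \<in> loops_at \<Gamma> x \<Longrightarrow> g +++ h \<in> loops_at \<Gamma> x"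
  by (auto simp: loops_at_def path_image_join)

lemma loops_at_reversepath: "g \<in> loops_at \<Gamma> x \<Longrightarrow> reversepath g \<in> loops_at \<Gamma> x"
  by (auto simp: loops_at_def)

lemma homotopic_if_join_reverse_null:
  assumes "q \<in> loops_at \<Gamma> x" "p \<in> loops_at \<Gamma> x" "homotopic_paths \<Gamma> (p +++ reversepath q) (\<lambda>_. x)"
  shows "homotopic_paths \<Gamma> p q"
proof (rule homotopic_paths_loop_parts)
  have "homotopic_paths \<Gamma> (p +++ reversepath q) (linepath x x)" using assms(3) by (simp add: linepath_refl)
  then show "homotopic_loops \<Gamma> (p +++ reversepath q) (linepath x x)"
    by (rule homotopic_paths_imp_homotopic_loops) (use assms in \<open>simp_all add: loops_at_def\<close>)
  show "path q" using assms(1) by (simp add: loops_at_def)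
qed

section \<open>Loops as primitive paths of coefficient pairs\<close>

lemma closed_coeffs_loop:
  assumes T: "T > 0" and a: "a \<in> closed_coeffs T \<Gamma>"
  shows "(\<lambda>s. primitive_path a (T * s)) \<in> loops_at \<Gamma> 0"
proof -
  have im: "(\<lambda>t. T * t) ` {0..1} \<subseteq> {0..T}" using T by (auto simp: mult_left_le)
  have "continuous_on {0..T} (primitive_path a)" using a by (intro continuous_on_primitive_path) (simp add: closed_coeffs_def)
  then have "continuous_on {0..1} (\<lambda>s. primitive_path a (T * s))"
    by (rule continuous_on_compose2[OF _ _ im]) (intro continuous_intros)
  moreover have "(\<lambda>s. primitive_path a (T * s)) ` {0..1} \<subseteq> \<Gamma>" using a im by (auto simp: closed_coeffs_def)
  ultimately show ?thesis
    using a by (simp add: loops_at_def path_def path_image_def pathstart_def pathfinish_def closed_coeffs_def primitive_path_def zero_prod_def)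
qed

text \<open>The coefficients are densities of the two coordinates, rescaled from
  \<open>[0, 1]\<close> to \<open>[0, T]\<close>; their bound comes from the Lipschitz
  constant.\<close>

lemma lipschitz_loop_primitive_path:
  fixes p :: "real \<Rightarrow> real \<times> real"
  assumes T: "T > 0" and p: "L-lipschitz_on {0..1} p" "p 0 = 0"
  obtains a where "a \<in> abel_coeffs T" "\<And>t. t \<in> {0..1} \<Longrightarrow> primitive_path a (T * t) = p t"
proof -
  have lip: "(1/T)-lipschitz_on {0..T} (\<lambda>t. t / T)"
    by (rule lipschitz_onI) (use T in \<open>auto simp: dist_real_def diff_divide_distrib[symmetric] abs_divide\<close>)
  have im: "(\<lambda>t. t / T) ` {0..T} \<subseteq> {0..1}" using T by auto
  have q: "(L * (1/T))-lipschitz_on {0..T} (\<lambda>t. p (t / T))"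
    by (rule lipschitz_on_compose2[OF lip lipschitz_on_subset[OF p(1) im]])
  have "(L * (1/T))-lipschitz_on {0..T} (\<lambda>t. fst (p (t / T)))"
    using q dist_fst_le unfolding lipschitz_on_def by (meson order_trans)
  then obtain a1 where a1: "a1 \<in> borel_measurable borel" "\<And>t. \<bar>a1 t\<bar> \<le> L * (1/T) + 1"
    "\<And>t. t \<in> {0..T} \<Longrightarrow> (a1 has_integral (fst (p (t / T)) - fst (p (0 / T)))) {0..t}"
    by (rule lipschitz_density) (use T in \<open>simp_all\<close>)
  have "(L * (1/T))-lipschitz_on {0..T} (\<lambda>t. snd (p (t / T)))"
    using q dist_snd_le unfolding lipschitz_on_def by (meson order_trans)
  then obtain a2 where a2: "a2 \<in> borel_measurable borel" "\<And>t. \<bar>a2 t\<bar> \<le> L * (1/T) + 1"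
    "\<And>t. t \<in> {0..T} \<Longrightarrow> (a2 has_integral (snd (p (t / T)) - snd (p (0 / T)))) {0..t}"
    by (rule lipschitz_density) (use T in \<open>simp_all\<close>)
  have meas: "f \<in> borel_measurable (lebesgue_on {0..T})" if "f \<in> borel_measurable borel" for f :: "real \<Rightarrow> real"
    using that by (intro measurable_restrict_space1 measurable_completion) simp
  show ?thesis
  proof (rule that)
    have "bounded (a1 ` {0..T})" "bounded (a2 ` {0..T})"
      by (rule boundedI[of _ "L * (1/T) + 1"], use a1(2) a2(2) in \<open>force simp del: mult_1_right\<close>)+
    then show "(a1, a2) \<in> abel_coeffs T" using meas[OF a1(1)] meas[OF a2(1)] by (simp add: abel_coeffs_def)
    show "primitive_path (a1, a2) (T * t) = p t" if "t \<in> {0..1}" for t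
    proof -
      have "T * t \<in> {0..T}" using that T by (auto simp: mult_left_le)
      from integral_unique[OF a1(3)[OF this]] integral_unique[OF a2(3)[OF this]]
      show ?thesis using T p(2) by (simp add: primitive_path_def prod_eq_iff)
    qed
  qed
qed

lemma (in lipschitz_graph) loop_homotopic_to_walk_loop:
  assumes p: "p \<in> loops_at \<Gamma> x" and x: "x \<in> V"
  obtains q L where "homotopic_paths \<Gamma> p q" "L-lipschitz_on {0..1} q"
proof -
  obtain vs where "edge_walk vs" "homotopic_paths \<Gamma> p (walk_path vs)"
    by (rule path_homotopic_to_walk[of p]) (use p x in \<open>auto simp: loops_at_def\<close>)
  then show ?thesis using walk_path_props that by blast
qed

text \<open>A continuous loop need not be Lipschitz, but it is homotopic to an edge walk, which is,
  and a Lipschitz loop from 0 is the primitive path of its densities.\<close>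

lemma path_class_surj:
  assumes G: "lipschitz_graph \<Gamma> V adj ed" and V: "0 \<in> V" and T: "T > 0" and p: "p \<in> loops_at \<Gamma> 0"
  obtains a where "a \<in> closed_coeffs T \<Gamma>" "homotopic_paths \<Gamma> p (\<lambda>s. primitive_path a (T * s))"
proof -
  obtain q L where q: "homotopic_paths \<Gamma> p q" "L-lipschitz_on {0..1} q"
    using lipschitz_graph.loop_homotopic_to_walk_loop[OF G p V] .
  have ends: "q 0 = 0" "q 1 = 0" using p homotopic_paths_imp_pathstart[OF q(1)] homotopic_paths_imp_pathfinish[OF q(1)]
    by (auto simp: loops_at_def pathstart_def pathfinish_def)
  have qi: "path q" "path_image q \<subseteq> \<Gamma>" using homotopic_paths_imp_path[OF q(1)] homotopic_paths_imp_subset[OF q(1)] by auto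
  obtain a where a: "a \<in> abel_coeffs T" "\<And>t. t \<in> {0..1} \<Longrightarrow> primitive_path a (T * t) = q t"
    using lipschitz_loop_primitive_path[OF T q(2) ends(1)] by blast
  have "primitive_path a t \<in> \<Gamma>" if t: "t \<in> {0..T}" for t
  proof -
    have t1: "t / T \<in> {0..1}" using t T by auto
    then have "primitive_path a (T * (t / T)) \<in> \<Gamma>" using a(2)[OF t1] qi(2) by (auto simp: path_image_def)
    then show ?thesis using T by simp
  qed
  moreover have "primitive_path a T = 0" using a(2)[of 1] ends by simp
  ultimately have "a \<in> closed_coeffs T \<Gamma>" using a(1) by (auto simp: closed_coeffs_def)
  moreover have "homotopic_paths \<Gamma> q (\<lambda>s. primitive_path a (T * s))" by (rule homotopic_paths_eq[OF qi]) (use a(2) in simp)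
  ultimately show ?thesis using that homotopic_paths_trans[OF q(1)] by blast
qed

text \<open>With vanishing coefficients all solutions are constant. This fixes the value of the
  homomorphism at the class of the constant loop.\<close>

lemma first_return_zero_coeffs:
  assumes T: "T > 0"
  shows "first_return T (\<lambda>_. 0, \<lambda>_. 0) = fps_X"
proof -
  let ?a = "(\<lambda>_. 0, \<lambda>_. 0) :: coeff_pair"
  have a: "?a \<in> abel_coeffs T" by (simp add: abel_coeffs_def image_constant_conv)
  have "primitive_on T (\<lambda>_. r) (abel_rhs ?a (\<lambda>_. r))" for r
    using primitive_on_const[of T r] unfolding abel_rhs_def by simp
  then have "\<exists>v. abel_solution T ?a v \<and> v 0 = r \<and> v T = r" for r
    unfolding abel_solution_iff_primitive_on[OF a] by (intro exI[of _ "\<lambda>_. r"]) simp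
  then have "has_center T ?a" unfolding has_center_def by (simp add: eventually_sequentially)
  then show ?thesis using has_center_iff_first_return[OF a T] by simp
qed

lemma zero_coeffs_closed: "0 \<in> \<Gamma> \<Longrightarrow> (\<lambda>_. 0, \<lambda>_. 0) \<in> closed_coeffs T \<Gamma>"
  by (auto simp: closed_coeffs_def abel_coeffs_def primitive_path_def zero_prod_def image_constant_conv)

lemma path_class_zero_coeffs: "path_class T \<Gamma> (\<lambda>_. 0, \<lambda>_. 0) = loop_class \<Gamma> (\<lambda>_. 0)"
  by (simp add: path_class_def primitive_path_def zero_prod_def)

theorem theorem2p1:
  fixes T :: real
    and \<Gamma> :: "(real \<times> real) set"
    and Phat :: "(real \<Rightarrow> real \<times> real) set \<Rightarrow> real fps"
  assumes "T > 0"
    and "lipschitz_triangulable_curve \<Gamma>"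
    and "connected \<Gamma>"
    and "0 \<in> \<Gamma>"
    and "Phat \<in> hom (fundamental_group \<Gamma> 0) return_group"
    and "\<forall>a\<in>closed_coeffs T \<Gamma>. first_return T a = Phat (path_class T \<Gamma> a)"
  shows "universal_curve T \<Gamma> \<longleftrightarrow> Phat \<in> mon (fundamental_group \<Gamma> 0) return_group"
proof -
  let ?G = "fundamental_group \<Gamma> 0"
  note T = assms(1) and hom = assms(5)
  have P: "first_return T a = Phat (loop_class \<Gamma> (\<lambda>s. primitive_path a (T * s)))" if "a \<in> closed_coeffs T \<Gamma>" for a
    using assms(6) that by (simp add: path_class_def)
  obtain V adj ed where G: "lipschitz_graph \<Gamma> V adj ed" and V: "0 \<in> V"
    using triangulable_curve_graph[OF assms(2,4)] .
  have Pone: "Phat (loop_class \<Gamma> (\<lambda>_. 0)) = fps_X"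
    using assms(6) zero_coeffs_closed[OF assms(4), of T] first_return_zero_coeffs[OF T] path_class_zero_coeffs[of T \<Gamma>] by metis
  have const: "(\<lambda>_. 0) \<in> loops_at \<Gamma> 0"
    using assms(4) by (auto simp: loops_at_def path_def path_image_def pathstart_def pathfinish_def)
  \<comment> \<open>The loop traversed first acts first on initial values, so its series is the
    inner one of the composition.\<close>
  have Pmult: "Phat (loop_class \<Gamma> (p +++ q)) = Phat (loop_class \<Gamma> q) oo Phat (loop_class \<Gamma> p)"
    if pq: "p \<in> loops_at \<Gamma> 0" "q \<in> loops_at \<Gamma> 0" for p q
  proof -
    have "Phat (mult ?G (loop_class \<Gamma> q) (loop_class \<Gamma> p)) = mult return_group (Phat (loop_class \<Gamma> q)) (Phat (loop_class \<Gamma> p))"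
      by (rule hom_mult[OF hom]) (use pq in \<open>simp_all add: carrier_fundamental_group\<close>)
    then show ?thesis by (simp add: mult_loop_class pq return_group_def)
  qed
  have "Phat \<in> mon ?G return_group" if univ: "universal_curve T \<Gamma>"
  proof -
    have "inj_on Phat (carrier ?G)"
    proof (rule inj_onI, unfold carrier_fundamental_group, elim imageE)
      fix X Y p q assume eq: "Phat X = Phat Y" and XY: "X = loop_class \<Gamma> p" "Y = loop_class \<Gamma> q"
        and p: "p \<in> loops_at \<Gamma> 0" and q: "q \<in> loops_at \<Gamma> 0"
      \<comment> \<open>Injectivity is tested on \<open>p\<close> followed by the reverse of
        \<open>q\<close>. As \<open>Phat\<close> agrees on the classes of \<open>p\<close> and
        \<open>q\<close>, multiplicativity gives the class of \<open>?r\<close> the same value as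
        that of \<open>q\<close> followed by its own reverse, the identity series.\<close>
      let ?r = "p +++ reversepath q"
      note q' = loops_at_reversepath[OF q]
      obtain a where a: "a \<in> closed_coeffs T \<Gamma>" and ra: "homotopic_paths \<Gamma> ?r (\<lambda>s. primitive_path a (T * s))"
        using path_class_surj[OF G V T loops_at_join[OF p q']] .
      have aT: "a \<in> abel_coeffs T" "primitive_path a T = 0" "primitive_path a ` {0..T} \<subseteq> \<Gamma>"
        using a by (auto simp: closed_coeffs_def)
      have "homotopic_paths \<Gamma> (q +++ reversepath q) (linepath 0 0)"
        using homotopic_paths_rinv[of q \<Gamma>] q by (simp add: loops_at_def)
      then have qq: "loop_class \<Gamma> (q +++ reversepath q) = loop_class \<Gamma> (\<lambda>_. 0)"
        using loop_class_eqI by (simp add: linepath_refl)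
      have "first_return T a = Phat (loop_class \<Gamma> ?r)" using P[OF a] loop_class_eqI[OF ra] by simp
      also have "\<dots> = Phat (loop_class \<Gamma> (q +++ reversepath q))"
        using eq unfolding XY Pmult[OF p q'] Pmult[OF q q'] by simp
      also have "\<dots> = fps_X" using qq Pone by simp
      finally have "has_center T a" using has_center_iff_first_return[OF aT(1) T] by simp
      then have "universal_center T a" using univ aT unfolding universal_curve_def by blast
      then have van: "iterated_integral T a w = 0" if "w \<noteq> []" "set w \<subseteq> {1, 2}" for w
        using that unfolding universal_center_def by blast
      obtain L where L: "L-lipschitz_on {0..1} (\<lambda>t. primitive_path a (T * t))"
        using primitive_path_rescaled_lipschitz[OF aT(1) T] .
      have \<gamma>: "(\<lambda>t. primitive_path a (T * t)) ` {0..1} \<subseteq> \<Gamma>" "primitive_path a (T * 0) = 0" "primitive_path a (T * 1) = 0"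
        using closed_coeffs_loop[OF T a] by (auto simp: loops_at_def path_image_def pathstart_def pathfinish_def)
      have "homotopic_paths \<Gamma> (\<lambda>t. primitive_path a (T * t)) (\<lambda>_. 0)"
        by (rule lipschitz_graph.null_homotopic_if_systems_closed[OF G L \<gamma> V])
          (rule iterated_integrals_vanish_imp_systems_closed[OF aT(1) T aT(2) van], assumption+)
      then have "homotopic_paths \<Gamma> p q"
        by (intro homotopic_if_join_reverse_null[OF q p] homotopic_paths_trans[OF ra])
      then show "X = Y" unfolding XY by (rule loop_class_eqI)
    qed
    then show ?thesis using hom by (simp add: mon_def)
  qed
  moreover have "universal_curve T \<Gamma>" if mon: "Phat \<in> mon ?G return_group"
    unfolding universal_curve_def
  proof (intro ballI impI, elim conjE)
    fix a assume a: "a \<in> abel_coeffs T" and im: "primitive_path a ` {0..T} \<subseteq> \<Gamma>" and center: "has_center T a"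
    \<comment> \<open>Only closed paths have a class in the fundamental group, so the closedness
      contained in the center condition is extracted before \<open>Phat\<close> is applied.\<close>
    have closed: "a \<in> closed_coeffs T \<Gamma>"
      using a im has_center_imp_closed[OF a T center] by (simp add: closed_coeffs_def)
    note loop = closed_coeffs_loop[OF T closed]
    have "Phat (loop_class \<Gamma> (\<lambda>s. primitive_path a (T * s))) = Phat (loop_class \<Gamma> (\<lambda>_. 0))"
      using P[OF closed] Pone center has_center_iff_first_return[OF a T] by simp
    moreover have "inj_on Phat (loop_class \<Gamma> ` loops_at \<Gamma> 0)" using mon by (simp add: mon_def carrier_fundamental_group)
    ultimately have "loop_class \<Gamma> (\<lambda>s. primitive_path a (T * s)) = loop_class \<Gamma> (\<lambda>_. 0)"
      by (elim inj_onD) (use loop const in blast)+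
    then have "homotopic_paths \<Gamma> (\<lambda>s. primitive_path a (T * s)) (\<lambda>_. 0)"
      by (rule loop_class_eqD) (use const in \<open>simp_all add: loops_at_def\<close>)
    then have "iterated_integral T a w = 0" if "w \<noteq> []" for w
      using null_homotopic_imp_iterated_integral_zero[OF G a T im] that by blast
    then show "universal_center T a" using center by (simp add: universal_center_def)
  qed
  ultimately show ?thesis by blast
qed

end
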